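(* Let $M$ be a discretely ordered subring of a real closed field $R$. If $\alpha$ is a transcendental $M$-arithmetical point of $\mathrm{Spec}_r(R[X_1,\dots,X_n])$, then $\mathrm{supp}(\alpha_M)=\{0\}$, i.e. $\alpha_M$ is a positive cone of a discrete ordering of $M[X_1,\dots,X_n]$. Conversely, if $\beta$ is a positive cone of a discrete ordering of $M[X_1,\dots,X_n]$, then there is a transcendental $M$-arithmetical point $\alpha$ of $\mathrm{Spec}_r(R[X_1,\dots,X_n])$ such that $\alpha_M=\beta$.
   Context: Rings are commutative with identity. An ordered ring is discretely ordered (its ordering is discrete) if it has no element $a$ with $0<a<1$; "discretely ordered subring of $R$" means discretely ordered by the ordering induced from $R$. The positive cone of an ordered ring is its set of non-negative elements; $M^{\ge0}$ is that of $M$. $\mathrm{Spec}_r(A)$ is the real spectrum of a ring $A$, i.e. the set of prime cones $\alpha\subseteq A$, with $\mathrm{supp}(\alpha)=\alpha\cap-\alpha$; $k(\alpha)$ is the real closure of the fraction field of $A/\mathrm{supp}(\alpha)$ with the ordering induced by $\alpha$, and $f(\alpha)$ is the image of $f\in A$ in $A/\mathrm{supp}(\alpha)\subseteq k(\alpha)$. For $\alpha\in\mathrm{Spec}_r(R[X_1,\dots,X_n])$, $\alpha_M:=\alpha\cap M[X_1,\dots,X_n]\in\mathrm{Spec}_r(M[X_1,\dots,X_n])$. For a real algebraic set $V\subseteq R^n$, $\widetilde V$ is the set of $\alpha\in\mathrm{Spec}_r(R[X_1,\dots,X_n])$ such that $(X_1(\alpha),\dots,X_n(\alpha))$ satisfies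 in $k(\alpha)$ the equations defining $V$. For a ring $A\supseteq M$, $\alpha\in\mathrm{Spec}_r(A)$ is an $M$-discrete prime cone of $A$ if (i) $M^{\ge0}\subseteq\alpha$; (ii) $M^{\ge0}\cap\mathrm{supp}(\alpha)=\{0\}$; (iii) for every $f\in A$, if $f\in\alpha$ and $f\notin\mathrm{supp}(\alpha)$ then $f-1\in\alpha$. A point $\alpha\in\mathrm{Spec}_r(R[X_1,\dots,X_n])$ is an $M$-arithmetical point if $\alpha_M$ is an $M$-discrete prime cone of $M[X_1,\dots,X_n]$; it is a transcendental $M$-arithmetical point if it is an $M$-arithmetical point that does not lie on any $\widetilde V$ with $V\subsetneq R^n$ a proper real algebraic subset defined over $M$ (i.e. by polynomials in $M[X_1,\dots,X_n]$).
   Formalization: A "discrete ordering of M[X_1,…,X_n]" is taken to extend the given ordering of M; without this the converse fails (e.g. M=Z[t] with t>0 infinite in R, and β making t negative), since every α contains the squares of R. *)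

theory Defs
  imports
    "HOL-Library.Poly_Mapping"
    "HOL-Algebra.Algebra"
    "HOL-Algebra.Algebraic_Closure_Type"
begin

section \<open>Real closed fields and discretely ordered subrings\<close>

class real_closed_field = linordered_field +
  assumes nonneg_is_square: "0 \<le> x \<Longrightarrow> \<exists>y. x = y * y"
    and odd_degree_root: "odd n \<Longrightarrow> c n \<noteq> 0 \<Longrightarrow> \<exists>x. (\<Sum>k\<le>n. c k * x ^ k) = 0"

definition discretely_ordered_subring :: "'a::linordered_field set \<Rightarrow> bool" where
  "discretely_ordered_subring M \<longleftrightarrow>
     subring M ring_of_type_algebra \<and> \<not> (\<exists>a\<in>M. 0 < a \<and> a < 1)"


section \<open>Polynomials in finitely many variables\<close>

text \<open>The variables are indexed by a finite type \<open>'n\<close>, so the whole type is $R[X_1,\dots,X_n]$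
  with $n$ the cardinality of \<open>'n\<close>, and points of $R^n$ are functions \<open>'n \<Rightarrow> 'a\<close>.\<close>

type_synonym ('n, 'a) mpoly = "('n \<Rightarrow>\<^sub>0 nat) \<Rightarrow>\<^sub>0 'a"

definition Const :: "'a::zero \<Rightarrow> ('n, 'a) mpoly" where
  "Const c = Poly_Mapping.single 0 c"

definition Var :: "'n \<Rightarrow> ('n, 'a::zero_neq_one) mpoly" where
  "Var i = Poly_Mapping.single (Poly_Mapping.single i 1) 1"

definition polys_over :: "'a::zero set \<Rightarrow> ('n, 'a) mpoly set" where
  "polys_over M = {f. \<forall>m. Poly_Mapping.lookup f m \<in> M}"

definition eval_at :: "('n::finite, 'a::comm_ring_1) mpoly \<Rightarrow> ('n \<Rightarrow> 'a) \<Rightarrow> 'a" where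
  "eval_at f x = (\<Sum>m\<in>Poly_Mapping.keys f. Poly_Mapping.lookup f m * (\<Prod>i\<in>UNIV. x i ^ Poly_Mapping.lookup m i))"

definition zero_set :: "('n::finite, 'a::comm_ring_1) mpoly set \<Rightarrow> ('n \<Rightarrow> 'a) set" where
  "zero_set F = {x. \<forall>f\<in>F. eval_at f x = 0}"


section \<open>Orderings and prime cones of a subring\<close>

definition ring_ordering :: "'b::comm_ring_1 set \<Rightarrow> ('b \<Rightarrow> 'b \<Rightarrow> bool) \<Rightarrow> bool" where
  "ring_ordering A leq \<longleftrightarrow>
     (\<forall>x\<in>A. \<forall>y\<in>A. leq x y \<or> leq y x) \<and>
     (\<forall>x\<in>A. \<forall>y\<in>A. leq x y \<and> leq y x \<longrightarrow> x = y) \<and>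
     (\<forall>x\<in>A. \<forall>y\<in>A. \<forall>z\<in>A. leq x y \<and> leq y z \<longrightarrow> leq x z) \<and>
     (\<forall>x\<in>A. \<forall>y\<in>A. \<forall>z\<in>A. leq x y \<longrightarrow> leq (x + z) (y + z)) \<and>
     (\<forall>x\<in>A. \<forall>y\<in>A. leq 0 x \<and> leq 0 y \<longrightarrow> leq 0 (x * y))"

definition discrete_ordering :: "'b::comm_ring_1 set \<Rightarrow> ('b \<Rightarrow> 'b \<Rightarrow> bool) \<Rightarrow> bool" where
  "discrete_ordering A leq \<longleftrightarrow>
     ring_ordering A leq \<and> \<not> (\<exists>a\<in>A. leq 0 a \<and> a \<noteq> 0 \<and> leq a 1 \<and> a \<noteq> 1)"

definition positive_cone :: "'b::comm_ring_1 set \<Rightarrow> ('b \<Rightarrow> 'b \<Rightarrow> bool) \<Rightarrow> 'b set" where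
  "positive_cone A leq = {f \<in> A. leq 0 f}"

text \<open>Orderings of $M[X_1,\dots,X_n]$ are understood to extend the given ordering of \<open>M\<close>.  A ring
  may carry several discrete orderings, and a cone \<open>\<beta>\<close> reversing the sign of a constant from \<open>M\<close>
  cannot be induced from a prime cone of $R[X_1,\dots,X_n]$, which contains all squares of \<open>R\<close>.\<close>

definition is_discrete_positive_cone ::
    "'a::linordered_field set \<Rightarrow> ('n, 'a) mpoly set \<Rightarrow> bool" where
  "is_discrete_positive_cone M \<beta> \<longleftrightarrow>
     (\<exists>leq. discrete_ordering (polys_over M) leq \<and>
           (\<forall>a\<in>M. \<forall>b\<in>M. leq (Const a) (Const b) \<longleftrightarrow> a \<le> b) \<and>
           \<beta> = positive_cone (polys_over M) leq)"

definition prime_cone :: "'b::comm_ring_1 set \<Rightarrow> 'b set \<Rightarrow> bool" where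
  "prime_cone A \<alpha> \<longleftrightarrow>
     \<alpha> \<subseteq> A \<and>
     (\<forall>f\<in>\<alpha>. \<forall>g\<in>\<alpha>. f + g \<in> \<alpha>) \<and>
     (\<forall>f\<in>\<alpha>. \<forall>g\<in>\<alpha>. f * g \<in> \<alpha>) \<and>
     (\<forall>f\<in>A. f * f \<in> \<alpha>) \<and>
     - 1 \<notin> \<alpha> \<and>
     (\<forall>f\<in>A. \<forall>g\<in>A. f * g \<in> \<alpha> \<longrightarrow> f \<in> \<alpha> \<or> - g \<in> \<alpha>)"

definition Spec_r :: "'b::comm_ring_1 set \<Rightarrow> 'b set set" where
  "Spec_r A = {\<alpha>. prime_cone A \<alpha>}"

definition supp :: "'b::comm_ring_1 set \<Rightarrow> 'b set" where
  "supp \<alpha> = \<alpha> \<inter> uminus ` \<alpha>"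

definition restrict_cone :: "'a::zero set \<Rightarrow> ('n, 'a) mpoly set \<Rightarrow> ('n, 'a) mpoly set" where
  "restrict_cone M \<alpha> = \<alpha> \<inter> polys_over M"

definition M_discrete_prime_cone ::
    "'a::linordered_field set \<Rightarrow> ('n, 'a) mpoly set \<Rightarrow> ('n, 'a) mpoly set \<Rightarrow> bool" where
  "M_discrete_prime_cone M A \<alpha> \<longleftrightarrow>
     \<alpha> \<in> Spec_r A \<and>
     Const ` {c \<in> M. 0 \<le> c} \<subseteq> \<alpha> \<and>
     Const ` {c \<in> M. 0 \<le> c} \<inter> supp \<alpha> = {0} \<and>
     (\<forall>f\<in>A. f \<in> \<alpha> \<and> f \<notin> supp \<alpha> \<longrightarrow> f - 1 \<in> \<alpha>)"


section \<open>The real closed field at a point of the real spectrum\<close>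

text \<open>Counterpart of the class above for rings with a carrier.  The order is not part of the
  structure: the first three clauses after \<open>field K\<close> say that the squares are the positive cone
  of a field ordering, which is then the only one.\<close>

definition real_closed :: "('k, 'm) ring_scheme \<Rightarrow> bool" where
  "real_closed K \<longleftrightarrow>
     field K \<and>
     (\<forall>x\<in>carrier K. \<forall>y\<in>carrier K. \<exists>z\<in>carrier K. x \<otimes>\<^bsub>K\<^esub> x \<oplus>\<^bsub>K\<^esub> y \<otimes>\<^bsub>K\<^esub> y = z \<otimes>\<^bsub>K\<^esub> z) \<and>
     (\<forall>x\<in>carrier K. \<ominus>\<^bsub>K\<^esub> \<one>\<^bsub>K\<^esub> \<noteq> x \<otimes>\<^bsub>K\<^esub> x) \<and>
     (\<forall>x\<in>carrier K. \<exists>y\<in>carrier K. x = y \<otimes>\<^bsub>K\<^esub> y \<or> x = \<ominus>\<^bsub>K\<^esub> (y \<otimes>\<^bsub>K\<^esub> y)) \<and>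
     (\<forall>n c. odd n \<and> c \<in> {..n} \<rightarrow> carrier K \<and> c n \<noteq> \<zero>\<^bsub>K\<^esub> \<longrightarrow>
        (\<exists>x\<in>carrier K. (\<Oplus>\<^bsub>K\<^esub>k\<in>{..n}. c k \<otimes>\<^bsub>K\<^esub> x [^]\<^bsub>K\<^esub> (k::nat)) = \<zero>\<^bsub>K\<^esub>))"

definition residue_ring :: "'b::comm_ring_1 set \<Rightarrow> 'b set ring" where
  "residue_ring \<alpha> = ring_of_type_algebra Quot (supp \<alpha>)"

definition residue :: "'b::comm_ring_1 set \<Rightarrow> 'b \<Rightarrow> 'b set" where
  "residue \<alpha> f = supp \<alpha> +>\<^bsub>ring_of_type_algebra\<^esub> f"

text \<open>\<open>K\<close> together with the embedding \<open>j\<close> is a real closure of the fraction field of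
  \<open>residue_ring \<alpha>\<close> ordered by \<open>\<alpha>\<close>.  Inside \<open>K\<close> that fraction field is the subfield generated by
  the image of \<open>j\<close>; its ordering is determined by the signs of the residues, and
  being a square in \<open>K\<close> means being non-negative.\<close>

definition is_real_closure_at ::
    "'b::comm_ring_1 set \<Rightarrow> 'k ring \<Rightarrow> ('b set \<Rightarrow> 'k) \<Rightarrow> bool" where
  "is_real_closure_at \<alpha> K j \<longleftrightarrow>
     real_closed K \<and>
     j \<in> ring_hom (residue_ring \<alpha>) K \<and>
     inj_on j (carrier (residue_ring \<alpha>)) \<and>
     (\<forall>f. f \<in> \<alpha> \<longleftrightarrow> (\<exists>y\<in>carrier K. j (residue \<alpha> f) = y \<otimes>\<^bsub>K\<^esub> y)) \<and>
     (\<forall>x\<in>carrier K. ring.algebraic K (generate_field K (j ` carrier (residue_ring \<alpha>))) x)"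

text \<open>The type of the elements of $k(\alpha)$ is large enough: an element is a root of a nonzero
  polynomial over the residue ring, hence is determined by a list of representatives of the
  coefficients and the position of the root among the finitely many roots of that polynomial.\<close>

type_synonym 'b k_elem = "'b list \<times> nat"

definition k_model :: "'b::comm_ring_1 set \<Rightarrow> 'b k_elem ring \<times> ('b set \<Rightarrow> 'b k_elem)" where
  "k_model \<alpha> = (SOME Kj. is_real_closure_at \<alpha> (fst Kj) (snd Kj))"

definition k_field :: "'b::comm_ring_1 set \<Rightarrow> 'b k_elem ring" where
  "k_field \<alpha> = fst (k_model \<alpha>)"

definition value_at :: "'b::comm_ring_1 \<Rightarrow> 'b set \<Rightarrow> 'b k_elem" where
  "value_at f \<alpha> = snd (k_model \<alpha>) (residue \<alpha> f)"

text \<open>Evaluation in $k(\alpha)$ of a polynomial over \<open>R\<close>, where \<open>R\<close> acts through the constants.\<close>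

definition k_eval ::
    "('n::finite, 'a::comm_ring_1) mpoly set \<Rightarrow> ('n, 'a) mpoly \<Rightarrow>
     ('n \<Rightarrow> ('n, 'a) mpoly k_elem) \<Rightarrow> ('n, 'a) mpoly k_elem" where
  "k_eval \<alpha> f x =
     (\<Oplus>\<^bsub>k_field \<alpha>\<^esub>m\<in>Poly_Mapping.keys f. value_at (Const (Poly_Mapping.lookup f m)) \<alpha> \<otimes>\<^bsub>k_field \<alpha>\<^esub>
        (\<Otimes>\<^bsub>k_field \<alpha>\<^esub>i\<in>UNIV. x i [^]\<^bsub>k_field \<alpha>\<^esub> (Poly_Mapping.lookup m i)))"

text \<open>$\widetilde V$ for the real algebraic set \<open>V = zero_set F\<close>, given by its defining equations
  \<open>F\<close>.  As usual it does not depend on the choice of the equations.\<close>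

definition tilde :: "('n::finite, 'a::comm_ring_1) mpoly set \<Rightarrow> ('n, 'a) mpoly set set" where
  "tilde F = {\<alpha> \<in> Spec_r UNIV. \<forall>f\<in>F. k_eval \<alpha> f (\<lambda>i. value_at (Var i) \<alpha>) = \<zero>\<^bsub>k_field \<alpha>\<^esub>}"


section \<open>Arithmetical points\<close>

definition arithmetical_point ::
    "'a::linordered_field set \<Rightarrow> ('n::finite, 'a) mpoly set \<Rightarrow> bool" where
  "arithmetical_point M \<alpha> \<longleftrightarrow>
     \<alpha> \<in> Spec_r UNIV \<and> M_discrete_prime_cone M (polys_over M) (restrict_cone M \<alpha>)"

definition transcendental_arithmetical_point ::
    "'a::linordered_field set \<Rightarrow> ('n::finite, 'a) mpoly set \<Rightarrow> bool" where
  "transcendental_arithmetical_point M \<alpha> \<longleftrightarrow>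
     arithmetical_point M \<alpha> \<and>
     (\<forall>F. F \<subseteq> polys_over M \<and> zero_set F \<subset> UNIV \<longrightarrow> \<alpha> \<notin> tilde F)"

end

theory Submission
  imports Defs
begin

text \<open>
  The value of a polynomial \<open>f\<close> at the residues of the variables in \<open>k(\<alpha>)\<close> is the residue of \<open>f\<close>.
  Hence \<open>\<alpha>\<close> lies on the tilde of the zero set of \<open>F\<close> exactly if \<open>F\<close> is contained in the support of
  \<open>\<alpha>\<close> (\<open>mem_tilde_iff\<close>).  A nonzero polynomial has a nonzero value somewhere on \<open>R\<^sup>n\<close>
  (\<open>nonzero_mpoly_eval\<close>), so every nonzero \<open>f \<in> M[X]\<close> defines a proper real algebraic set, and the
  support of a transcendental arithmetical point meets \<open>M[X]\<close> only in \<open>0\<close>.  A prime cone with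
  support \<open>0\<close> is the positive cone of an ordering, and condition (iii) for \<open>M\<close>-discrete cones says
  that this ordering is discrete (\<open>transcendental_point_restriction\<close>).

  All this rests on \<open>k(\<alpha>)\<close> really being a real closure, that is, on the existence of real
  closures.  A maximality argument gives a homomorphism into an algebraically closed field whose
  kernel is the support of the cone (\<open>hom_with_kernel\<close>).  Inside that field, take a maximal subfield
  in which \<open>-1\<close> is not a sum of squares with weights from the image of the cone.  As in the theory
  of Artin and Schreier, maximality forces square roots of positive elements and the intermediate
  value theorem for polynomials (\<open>real_closed_subfield_if_maximal\<close>,
  \<open>real_closure_of_prime_cone\<close>).  As this field is algebraic over the residue ring, it has a copy
  on the type that \<open>k(\<alpha>)\<close> is chosen from (\<open>real_closure_at_exists\<close>).

  For the converse, the ordering \<open>\<beta>\<close> of \<open>M[X]\<close> and the order of \<open>R\<close> agree on \<open>M\<close>, and the task is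
  to amalgamate them: a prime cone of \<open>R[X]\<close> has to be found that induces \<open>\<beta>\<close>
  (\<open>prime_cone_lift\<close>); it is then a transcendental point because \<open>\<beta>\<close> has support \<open>0\<close>.
  Let \<open>E\<close> be a real closed extension of \<open>R\<close>.  By Zorn's lemma there is a largest cone that induces
  \<open>\<beta>\<close> and the order of \<open>E\<close> and lives on \<open>N[X]\<close> for some ring \<open>M \<subseteq> N \<subseteq> E\<close>.  Let \<open>E1\<close> be a real
  closure for that cone; both \<open>E\<close> and \<open>E1\<close> contain \<open>N\<close>.  If, for any finitely many polynomials
  over \<open>N\<close>, some point of \<open>E1\<close> gives them the signs that they have at \<open>r \<in> E\<close>, then an ultrafilter
  of such points extends the cone to \<open>N[r][X]\<close> (\<open>extend_cone_by_element\<close>), and therefore \<open>r \<in> N\<close>.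
  Such points exist for the inverses of elements of \<open>N\<close> (\<open>match_inverse\<close>), so \<open>N\<close> is a field;
  next for the algebraic elements of least degree outside \<open>N\<close> (\<open>match_algebraic\<close>), so \<open>N\<close> is
  algebraically closed in \<open>E\<close>; and finally for all other elements (\<open>match_transcendental\<close>), because
  now all roots in \<open>E\<close> of polynomials over \<open>N\<close> lie in \<open>N\<close> and a point of \<open>N\<close> between them serves.
  Hence \<open>N = E\<close>, and restricting the cone to \<open>R[X]\<close> ends the proof.  Building the cone one element
  at a time takes the place of Tarski's transfer principle.
\<close>

section \<open>Subrings, subfields and polynomials over them\<close>

text \<open>The subrings of \<open>ring_of_type_algebra\<close> (\<open>subring_type_ring_iff\<close>), in a form that leaves the
  arithmetic to the type class.\<close>

definition is_subring :: "'a::comm_ring_1 set \<Rightarrow> bool" where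
  "is_subring S \<longleftrightarrow> 1 \<in> S \<and> (\<forall>x\<in>S. \<forall>y\<in>S. x - y \<in> S \<and> x * y \<in> S)"

definition is_subfield :: "'a::field set \<Rightarrow> bool" where
  "is_subfield S \<longleftrightarrow> is_subring S \<and> (\<forall>x\<in>S. inverse x \<in> S)"

definition poly_over :: "'a::zero set \<Rightarrow> 'a poly set" where
  "poly_over S = {p. \<forall>i. coeff p i \<in> S}"

lemma subring_one: "is_subring S \<Longrightarrow> 1 \<in> S"
  and subring_diff: "is_subring S \<Longrightarrow> x \<in> S \<Longrightarrow> y \<in> S \<Longrightarrow> x - y \<in> S"
  and subring_mult: "is_subring S \<Longrightarrow> x \<in> S \<Longrightarrow> y \<in> S \<Longrightarrow> x * y \<in> S"
  by (auto simp: is_subring_def)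

lemma subring_zero: "is_subring S \<Longrightarrow> 0 \<in> S"
  using subring_diff[of S 1 1] subring_one[of S] by simp

lemma subring_uminus: "is_subring S \<Longrightarrow> x \<in> S \<Longrightarrow> - x \<in> S"
  using subring_diff[of S 0 x] subring_zero[of S] by simp

lemma subring_add: "is_subring S \<Longrightarrow> x \<in> S \<Longrightarrow> y \<in> S \<Longrightarrow> x + y \<in> S"
  using subring_diff[of S x "- y"] subring_uminus[of S y] by simp

lemma subring_power: "is_subring S \<Longrightarrow> x \<in> S \<Longrightarrow> x ^ n \<in> S"
  by (induction n) (auto intro: subring_one subring_mult)

lemma subring_sum: "is_subring S \<Longrightarrow> (\<And>i. i \<in> I \<Longrightarrow> f i \<in> S) \<Longrightarrow> sum f I \<in> S"
  by (induction I rule: infinite_finite_induct) (auto intro: subring_zero subring_add)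

lemma subring_prod: "is_subring S \<Longrightarrow> (\<And>i. i \<in> I \<Longrightarrow> f i \<in> S) \<Longrightarrow> prod f I \<in> S"
  by (induction I rule: infinite_finite_induct) (auto intro: subring_one subring_mult)

lemma subring_of_nat: "is_subring S \<Longrightarrow> of_nat n \<in> S"
  by (induction n) (auto intro: subring_zero subring_one subring_add)

lemmas subring_closed = subring_zero subring_one subring_add subring_diff subring_uminus
  subring_mult subring_power subring_sum subring_prod subring_of_nat

lemma is_subring_UNIV: "is_subring UNIV"
  by (simp add: is_subring_def)

lemma subfield_subring: "is_subfield S \<Longrightarrow> is_subring S"
  by (simp add: is_subfield_def)

lemma subfield_inverse: "is_subfield S \<Longrightarrow> x \<in> S \<Longrightarrow> inverse x \<in> S"
  by (simp add: is_subfield_def)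

lemma subfield_divide: "is_subfield S \<Longrightarrow> x \<in> S \<Longrightarrow> y \<in> S \<Longrightarrow> x / y \<in> S"
  by (simp add: divide_inverse subfield_inverse subring_mult subfield_subring)

lemmas subfield_closed = subring_closed[OF subfield_subring] subfield_inverse subfield_divide

lemma coeff_poly_over: "p \<in> poly_over S \<Longrightarrow> coeff p i \<in> S"
  by (simp add: poly_over_def)

lemma poly_over_mono: "S \<subseteq> S' \<Longrightarrow> poly_over S \<subseteq> poly_over S'"
  by (auto simp: poly_over_def)

context
  fixes S :: "'a::comm_ring_1 set"
  assumes S: "is_subring S"
begin

lemma poly_over_0: "0 \<in> poly_over S"
  by (simp add: poly_over_def subring_zero[OF S])

lemma poly_over_1: "1 \<in> poly_over S"
  using subring_zero[OF S] subring_one[OF S] by (simp add: poly_over_def coeff_1)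

lemma poly_over_pCons: "c \<in> S \<Longrightarrow> p \<in> poly_over S \<Longrightarrow> pCons c p \<in> poly_over S"
  by (auto simp: poly_over_def coeff_pCons split: nat.split)

lemma poly_over_monom: "c \<in> S \<Longrightarrow> monom c n \<in> poly_over S"
  using subring_zero[OF S] by (auto simp: poly_over_def)

lemma poly_over_add: "p \<in> poly_over S \<Longrightarrow> q \<in> poly_over S \<Longrightarrow> p + q \<in> poly_over S"
  by (auto simp: poly_over_def intro: subring_add[OF S])

lemma poly_over_diff: "p \<in> poly_over S \<Longrightarrow> q \<in> poly_over S \<Longrightarrow> p - q \<in> poly_over S"
  by (auto simp: poly_over_def intro: subring_diff[OF S])

lemma poly_over_uminus: "p \<in> poly_over S \<Longrightarrow> - p \<in> poly_over S"
  by (auto simp: poly_over_def intro: subring_uminus[OF S])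

lemma poly_over_mult: "p \<in> poly_over S \<Longrightarrow> q \<in> poly_over S \<Longrightarrow> p * q \<in> poly_over S"
  by (auto simp: poly_over_def coeff_mult intro!: subring_sum[OF S] subring_mult[OF S])

lemma poly_over_smult: "c \<in> S \<Longrightarrow> p \<in> poly_over S \<Longrightarrow> smult c p \<in> poly_over S"
  by (auto simp: poly_over_def intro: subring_mult[OF S])

lemma poly_over_power: "p \<in> poly_over S \<Longrightarrow> p ^ n \<in> poly_over S"
  by (induction n) (auto intro: poly_over_1 poly_over_mult)

lemma poly_in_subring: "p \<in> poly_over S \<Longrightarrow> x \<in> S \<Longrightarrow> poly p x \<in> S"
  unfolding poly_altdef by (intro subring_sum subring_mult subring_power S) (auto simp: poly_over_def)

lemmas poly_over_closed = poly_over_0 poly_over_1 poly_over_pCons poly_over_monom poly_over_add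
  poly_over_diff poly_over_uminus poly_over_mult poly_over_smult poly_over_power

lemma is_subring_poly_over: "is_subring (poly_over S)"
  by (simp add: is_subring_def poly_over_closed)

lemma is_subring_simple_extension: "is_subring ((\<lambda>p. poly p a) ` poly_over S)"
  unfolding is_subring_def
proof (intro conjI ballI)
  show "1 \<in> (\<lambda>p. poly p a) ` poly_over S"
    by (rule image_eqI[of _ _ 1]) (auto simp: poly_over_1)
  fix x y assume "x \<in> (\<lambda>p. poly p a) ` poly_over S" "y \<in> (\<lambda>p. poly p a) ` poly_over S"
  then obtain p q where pq: "p \<in> poly_over S" "x = poly p a" "q \<in> poly_over S" "y = poly q a"
    by auto
  show "x - y \<in> (\<lambda>p. poly p a) ` poly_over S"
    by (rule image_eqI[of _ _ "p - q"]) (auto simp: pq poly_over_diff)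
  show "x * y \<in> (\<lambda>p. poly p a) ` poly_over S"
    by (rule image_eqI[of _ _ "p * q"]) (auto simp: pq poly_over_mult)
qed

lemma subset_simple_extension: "S \<subseteq> (\<lambda>p. poly p a) ` poly_over S"
proof
  fix c assume "c \<in> S"
  thus "c \<in> (\<lambda>p. poly p a) ` poly_over S"
    by (intro image_eqI[of _ _ "[:c:]"]) (auto intro: poly_over_closed)
qed

lemma mem_simple_extension: "a \<in> (\<lambda>p. poly p a) ` poly_over S"
  by (rule image_eqI[of _ _ "[:0, 1:]"]) (auto intro!: poly_over_closed subring_closed S)

text \<open>Multiplying the dividend by the leading coefficient of the divisor, whenever a division by it
  would be due, keeps all coefficients in \<open>S\<close>.\<close>

lemma poly_over_pseudo_division:
  assumes "g \<in> poly_over S" "g \<noteq> 0" "f \<in> poly_over S"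
  shows "\<exists>k q r. q \<in> poly_over S \<and> r \<in> poly_over S \<and>
    smult (lead_coeff g ^ k) f = q * g + r \<and> (r = 0 \<or> degree r < degree g)"
  using assms(3)
proof (induction "degree f" arbitrary: f rule: less_induct)
  case less
  show ?case
  proof (cases "f = 0 \<or> degree f < degree g")
    case True
    thus ?thesis
      by (intro exI[of _ 0] exI[of _ f]) (auto simp: less.prems poly_over_0)
  next
    case False
    define c where "c = lead_coeff g"
    define m where "m = monom (lead_coeff f) (degree f - degree g)"
    define f' where "f' = smult c f - m * g"
    have mS: "m \<in> poly_over S"
      unfolding m_def using less.prems by (intro poly_over_monom) (auto simp: poly_over_def)
    have cS: "c \<in> S" unfolding c_def using assms(1) by (auto simp: poly_over_def)
    have f'S: "f' \<in> poly_over S"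
      unfolding f'_def by (intro poly_over_closed mS cS less.prems assms(1))
    have "coeff f' i = 0" if "i \<ge> degree f" for i
    proof (cases "i = degree f")
      case True
      have "coeff (m * g) (degree f) = lead_coeff f * c"
        unfolding m_def c_def using False by (simp add: coeff_monom_mult)
      thus ?thesis unfolding f'_def using True by (simp add: mult.commute)
    next
      case i: False
      have "degree (m * g) \<le> degree f"
        using degree_mult_le[of m g] degree_monom_le[of "lead_coeff f" "degree f - degree g"] False
        unfolding m_def by linarith
      thus ?thesis unfolding f'_def using i that by (simp add: coeff_eq_0)
    qed
    hence deg: "f' = 0 \<or> degree f' < degree f"
      by (metis leI leading_coeff_0_iff)
    have "\<exists>k q r. q \<in> poly_over S \<and> r \<in> poly_over S \<and>
      smult (c ^ k) f' = q * g + r \<and> (r = 0 \<or> degree r < degree g)"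
    proof (cases "f' = 0")
      case True
      thus ?thesis by (intro exI[of _ 0]) (auto simp: poly_over_0)
    next
      case False
      thus ?thesis using less.hyps[OF _ f'S] deg unfolding c_def by auto
    qed
    then obtain k q r where kqr: "q \<in> poly_over S" "r \<in> poly_over S"
      "smult (c ^ k) f' = q * g + r" "r = 0 \<or> degree r < degree g" by blast
    have "smult (c ^ Suc k) f = smult (c ^ k) (f' + m * g)"
      by (simp add: f'_def mult.commute)
    also have "\<dots> = (q + smult (c ^ k) m) * g + r"
      by (simp add: smult_add_right kqr(3) algebra_simps)
    finally show ?thesis
      using kqr mS cS unfolding c_def
      by (intro exI[of _ "Suc k"] exI[of _ "q + smult (lead_coeff g ^ k) m"] exI[of _ r])
        (auto intro!: poly_over_closed subring_power S)
  qed
qed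

end

lemma poly_over_pderiv:
  assumes "is_subring S" "p \<in> poly_over (S :: 'a::idom set)"
  shows "pderiv p \<in> poly_over S"
  using assms by (auto simp: poly_over_def coeff_pderiv simp del: of_nat_Suc intro!: subring_mult subring_of_nat)

lemma poly_over_division:
  assumes E: "is_subfield E" and "g \<in> poly_over E" "g \<noteq> 0" "f \<in> poly_over E"
  shows "\<exists>q r. q \<in> poly_over E \<and> r \<in> poly_over E \<and> f = q * g + r \<and> (r = 0 \<or> degree r < degree g)"
proof -
  note R = subfield_subring[OF E]
  obtain k q r where kqr: "q \<in> poly_over E" "r \<in> poly_over E"
    "smult (lead_coeff g ^ k) f = q * g + r" "r = 0 \<or> degree r < degree g"
    using poly_over_pseudo_division[OF R assms(2-4)] by blast
  define d where "d = inverse (lead_coeff g ^ k)"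
  have dE: "d \<in> E" unfolding d_def
    by (intro subfield_inverse[OF E] subring_power[OF R]) (use assms(2) in \<open>auto simp: poly_over_def\<close>)
  have "d \<noteq> 0" "d * lead_coeff g ^ k = 1" using assms(3) by (auto simp: d_def)
  hence "f = smult d (q * g + r)"
    by (metis kqr(3) smult_1_left smult_smult)
  hence "f = smult d q * g + smult d r" by (simp add: smult_add_right)
  thus ?thesis using kqr(1,2,4) dE \<open>d \<noteq> 0\<close>
    by (intro exI[of _ "smult d q"] exI[of _ "smult d r"]) (auto intro: poly_over_smult[OF R])
qed

text \<open>Any nonzero multiple by a constant is allowed as well: only the least degree matters.\<close>

definition min_poly_over :: "'a::field set \<Rightarrow> 'a \<Rightarrow> 'a poly \<Rightarrow> bool" where
  "min_poly_over E \<theta> f \<longleftrightarrow> f \<in> poly_over E \<and> f \<noteq> 0 \<and> poly f \<theta> = 0 \<and>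
     (\<forall>g\<in>poly_over E. poly g \<theta> = 0 \<longrightarrow> g \<noteq> 0 \<longrightarrow> degree f \<le> degree g)"

lemma min_poly_over_exists:
  assumes "g \<in> poly_over E" "g \<noteq> 0" "poly g \<theta> = 0"
  obtains f where "min_poly_over E \<theta> f"
proof -
  let ?P = "\<lambda>f. f \<in> poly_over E \<and> f \<noteq> 0 \<and> poly f \<theta> = 0"
  have "?P (arg_min degree ?P)" "\<And>h. ?P h \<Longrightarrow> degree (arg_min degree ?P) \<le> degree h"
    using arg_min_nat_lemma[of ?P g degree] assms by auto
  thus ?thesis by (intro that[of "arg_min degree ?P"]) (auto simp: min_poly_over_def)
qed

lemma min_poly_over_dvd:
  assumes "is_subfield E" "min_poly_over E \<theta> f" "g \<in> poly_over E" "poly g \<theta> = 0"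
  obtains h where "h \<in> poly_over E" "g = h * f"
proof -
  obtain q r where qr: "q \<in> poly_over E" "r \<in> poly_over E" "g = q * f + r" "r = 0 \<or> degree r < degree f"
    using poly_over_division[OF assms(1), of f g] assms(2,3) unfolding min_poly_over_def by blast
  have "poly r \<theta> = 0" using qr(3) assms(2,4) by (simp add: min_poly_over_def)
  hence "r = 0" using qr(2,4) assms(2) unfolding min_poly_over_def by (meson leD)
  thus ?thesis using that qr by simp
qed

text \<open>Inverses come from Euclid's algorithm: if \<open>f = q * g + r\<close>, then \<open>r(\<theta>) = - q(\<theta>) * g(\<theta>)\<close>, so an inverse
  of \<open>r(\<theta>)\<close>, where \<open>r\<close> has smaller degree than \<open>g\<close>, yields one of \<open>g(\<theta>)\<close>.\<close>

lemma is_subfield_simple_extension: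
  assumes E: "is_subfield E" and f: "min_poly_over E \<theta> f"
  shows "is_subfield ((\<lambda>p. poly p \<theta>) ` poly_over E)"
proof -
  note R = subfield_subring[OF E]
  have inv: "\<exists>v\<in>poly_over E. poly v \<theta> * poly g \<theta> = 1"
    if "g \<in> poly_over E" "poly g \<theta> \<noteq> 0" "degree g < degree f" for g
    using that
  proof (induction "degree g" arbitrary: g rule: less_induct)
    case less
    show ?case
    proof (cases "degree g = 0")
      case True
      then obtain c where c: "g = [:c:]" using degree_eq_zeroE by blast
      with less.prems have "c \<in> E" "c \<noteq> 0" by (auto dest: coeff_poly_over[of _ _ 0])
      thus ?thesis using E R
        by (intro bexI[of _ "[:inverse c:]"]) (auto simp: c intro!: poly_over_closed subfield_inverse)
    next
      case False
      obtain q r where qr: "q \<in> poly_over E" "r \<in> poly_over E" "f = q * g + r" "r = 0 \<or> degree r < degree g"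
        using poly_over_division[OF E, of g f] f less.prems unfolding min_poly_over_def by force
      have f0: "poly f \<theta> = 0" "f \<noteq> 0" using f by (auto simp: min_poly_over_def)
      have "poly r \<theta> \<noteq> 0"
      proof
        assume r0: "poly r \<theta> = 0"
        have "r = 0"
          using f qr(2,4) r0 less.prems(3) unfolding min_poly_over_def by (metis leD order.strict_trans)
        hence "poly q \<theta> = 0" "q \<noteq> 0" "f = q * g" using f0 qr(3) less.prems(2) by auto
        hence "degree f \<le> degree q" using f qr(1) by (auto simp: min_poly_over_def)
        moreover have "degree f = degree q + degree g"
          using \<open>f = q * g\<close> f0(2) by (auto intro: degree_mult_eq)
        ultimately show False using False by simp
      qed
      moreover from this have "degree r < degree g" using qr(4) by auto
      ultimately obtain v where v: "v \<in> poly_over E" "poly v \<theta> * poly r \<theta> = 1"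
        using less.hyps[of r] qr(2) less.prems(3) by auto
      have "poly r \<theta> = - (poly q \<theta> * poly g \<theta>)"
        using f0(1) qr(3) by (simp add: eq_neg_iff_add_eq_0 add.commute)
      thus ?thesis using v qr(1)
        by (intro bexI[of _ "- v * q"]) (auto simp: algebra_simps intro!: poly_over_mult[OF R] poly_over_uminus[OF R])
    qed
  qed
  have "inverse x \<in> (\<lambda>p. poly p \<theta>) ` poly_over E" if x: "x \<in> (\<lambda>p. poly p \<theta>) ` poly_over E" for x
  proof (cases "x = 0")
    case True
    thus ?thesis using x by simp
  next
    case False
    obtain g where g: "g \<in> poly_over E" "x = poly g \<theta>" using x by auto
    obtain q r where qr: "q \<in> poly_over E" "r \<in> poly_over E" "g = q * f + r" "r = 0 \<or> degree r < degree f"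
      using poly_over_division[OF E _ _ g(1)] f unfolding min_poly_over_def by meson
    have xr: "x = poly r \<theta>" using qr(3) f g(2) by (simp add: min_poly_over_def)
    with False qr(4) have "degree r < degree f" by auto
    then obtain v where "v \<in> poly_over E" "poly v \<theta> * x = 1"
      using inv[OF qr(2)] xr False by auto
    thus ?thesis by (metis image_eqI inverse_unique mult.commute)
  qed
  thus ?thesis using is_subring_simple_extension[OF R] by (simp add: is_subfield_def)
qed

definition fractions :: "'a::field set \<Rightarrow> 'a set" where
  "fractions S = {x / y | x y. x \<in> S \<and> y \<in> S}"

lemma fractionsI: "a \<in> S \<Longrightarrow> b \<in> S \<Longrightarrow> a / b \<in> fractions S"
  by (auto simp: fractions_def)

lemma is_subfield_fractions:
  assumes S: "is_subring S" shows "is_subfield (fractions S)"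
  unfolding is_subfield_def is_subring_def
proof (intro conjI ballI)
  show "1 \<in> fractions S" using fractionsI[of 1 S 1] subring_one[OF S] by simp
  fix x assume "x \<in> fractions S"
  then obtain a b where x: "x = a / b" "a \<in> S" "b \<in> S" by (auto simp: fractions_def)
  show "inverse x \<in> fractions S" using fractionsI[OF x(3,2)] by (simp add: x(1))
  fix y assume "y \<in> fractions S"
  then obtain c d where y: "y = c / d" "c \<in> S" "d \<in> S" by (auto simp: fractions_def)
  show "x * y \<in> fractions S"
    using fractionsI[OF subring_mult[OF S x(2) y(2)] subring_mult[OF S x(3) y(3)]]
    by (simp add: x(1) y(1))
  show "x - y \<in> fractions S"
  proof (cases "b = 0 \<or> d = 0")
    case True
    moreover have "- y \<in> fractions S"
      using fractionsI[OF subring_uminus[OF S y(2)] y(3)] by (simp add: y(1))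
    ultimately show ?thesis using x(1) y(1) \<open>x \<in> fractions S\<close> by (elim disjE) simp_all
  next
    case False
    hence "x - y = (a * d - c * b) / (b * d)" by (simp add: x(1) y(1) diff_frac_eq)
    thus ?thesis
      using fractionsI[OF subring_diff[OF S subring_mult[OF S x(2) y(3)] subring_mult[OF S y(2) x(3)]]
          subring_mult[OF S x(3) y(3)]] by simp
  qed
qed

lemma subset_fractions: "is_subring S \<Longrightarrow> S \<subseteq> fractions S"
  using fractionsI[of _ S 1] subring_one[of S] by force

section \<open>Ordered subfields\<close>

definition nonneg_in :: "'a::comm_ring_1 set \<Rightarrow> 'a \<Rightarrow> bool" where
  "nonneg_in E x \<longleftrightarrow> (\<exists>y\<in>E. x = y * y)"

definition pos_in :: "'a::comm_ring_1 set \<Rightarrow> 'a \<Rightarrow> bool" where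
  "pos_in E x \<longleftrightarrow> x \<noteq> 0 \<and> nonneg_in E x"

text \<open>The order is the one whose positive elements are the nonzero squares.  The fields to which this
  is applied depend on a prime cone, so their order is not one of the surrounding type.\<close>

locale ordered_subfield =
  fixes E :: "'a::field set"
  assumes subfield: "is_subfield E"
    and sum_of_squares: "x \<in> E \<Longrightarrow> y \<in> E \<Longrightarrow> \<exists>z\<in>E. x * x + y * y = z * z"
    and not_square_minus_one: "x \<in> E \<Longrightarrow> x * x \<noteq> - 1"
    and square_or_minus_square: "x \<in> E \<Longrightarrow> \<exists>y\<in>E. x = y * y \<or> x = - (y * y)"
begin

lemmas subring = subfield_subring[OF subfield]
lemmas closed = subfield_closed[OF subfield]

abbreviation pos where "pos \<equiv> pos_in E"
abbreviation nonneg where "nonneg \<equiv> nonneg_in E"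

lemma pos_mem: "pos x \<Longrightarrow> x \<in> E"
  by (auto simp: pos_in_def nonneg_in_def intro: closed)

lemma nonneg_mem: "nonneg x \<Longrightarrow> x \<in> E"
  by (auto simp: nonneg_in_def intro: closed)

lemma nonneg_iff: "nonneg x \<longleftrightarrow> x = 0 \<or> pos x"
  using closed(1) by (force simp: pos_in_def nonneg_in_def)

lemma nonneg_add: "nonneg x \<Longrightarrow> nonneg y \<Longrightarrow> nonneg (x + y)"
  by (auto simp: nonneg_in_def dest: sum_of_squares)

lemma nonneg_mult: "nonneg x \<Longrightarrow> nonneg y \<Longrightarrow> nonneg (x * y)"
  unfolding nonneg_in_def by (metis mult.assoc mult.left_commute closed(6))

lemma pos_one: "pos 1"
  by (auto simp: pos_in_def nonneg_in_def intro!: bexI[of _ 1] closed)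

lemma pos_mult: "pos x \<Longrightarrow> pos y \<Longrightarrow> pos (x * y)"
  by (auto simp: pos_in_def nonneg_mult)

lemma nonneg_antisym: assumes "nonneg x" "nonneg (- x)" shows "x = 0"
proof (rule ccontr)
  assume "x \<noteq> 0"
  from assms obtain a b where ab: "a \<in> E" "b \<in> E" "x = a * a" "- x = b * b"
    by (auto simp: nonneg_in_def)
  have "(b / a) * (b / a) = - 1"
    using ab(3,4) \<open>x \<noteq> 0\<close> by (auto simp: field_simps)
  with ab(1,2) not_square_minus_one[of "b / a"] closed show False by metis
qed

lemma not_pos_both: "pos x \<Longrightarrow> \<not> pos (- x)"
  using nonneg_antisym by (auto simp: pos_in_def)

lemma not_pos_zero: "\<not> pos 0"
  by (simp add: pos_in_def)

lemma pos_add: "pos x \<Longrightarrow> pos y \<Longrightarrow> pos (x + y)"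
  unfolding pos_in_def
  by (metis add_eq_0_iff nonneg_add nonneg_antisym)

lemma pos_add_nonneg: "pos x \<Longrightarrow> nonneg y \<Longrightarrow> pos (x + y)"
  using pos_add[of x y] by (auto simp: nonneg_iff)

lemma trichotomy: "x \<in> E \<Longrightarrow> x = 0 \<or> pos x \<or> pos (- x)"
  using square_or_minus_square[of x] unfolding pos_in_def nonneg_in_def by auto

lemma pos_square: "x \<in> E \<Longrightarrow> x \<noteq> 0 \<Longrightarrow> pos (x * x)"
  by (auto simp: pos_in_def nonneg_in_def)

lemma nonneg_square: "x \<in> E \<Longrightarrow> nonneg (x * x)"
  by (auto simp: nonneg_in_def)

lemma pos_inverse: assumes "pos x" shows "pos (inverse x)"
proof -
  have "x \<noteq> 0" using assms not_pos_zero by auto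
  hence "pos (x * (inverse x * inverse x))"
    using assms by (intro pos_mult pos_square closed pos_mem) auto
  thus ?thesis using \<open>x \<noteq> 0\<close> by (simp add: mult.assoc[symmetric])
qed

lemma pos_divide: "pos x \<Longrightarrow> pos y \<Longrightarrow> pos (x / y)"
  by (simp add: divide_inverse pos_mult pos_inverse)

lemma not_nonneg_iff: "x \<in> E \<Longrightarrow> \<not> nonneg x \<longleftrightarrow> pos (- x)"
  using trichotomy[of x] not_pos_both[of x] not_pos_both[of "- x"] by (auto simp: nonneg_iff not_pos_zero)

lemma pos_mult_cancel: "pos (x * y) \<Longrightarrow> pos x \<Longrightarrow> pos y"
  using pos_divide[of "x * y" x] not_pos_zero by (cases "x = 0") auto

lemma pos_of_nat: "pos (of_nat (Suc n))"
proof (induction n)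
  case (Suc n)
  show ?case using pos_add[OF pos_one Suc] by (subst of_nat_Suc)
qed (simp add: pos_one)

lemma pos_two: "pos 2"
  using pos_of_nat[of 1] by simp

lemma pos_diff_trans: "pos (b - a) \<Longrightarrow> pos (c - b) \<Longrightarrow> pos (c - a)"
  using pos_add[of "b - a" "c - b"] by simp

lemma opposite_signs_factor:
  assumes "pos (- (u * v * (u' * v')))" "u \<in> E" "u' \<in> E" "v \<in> E" "v' \<in> E"
  shows "pos (- (u * u')) \<or> pos (- (v * v'))"
proof -
  have "u * u' \<noteq> 0" "v * v' \<noteq> 0" using assms(1) not_pos_zero by auto
  moreover have "\<not> (pos (u * u') \<and> pos (v * v'))"
  proof
    assume "pos (u * u') \<and> pos (v * v')"
    hence "pos (u * u' * (v * v'))" by (blast intro: pos_mult)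
    thus False using not_pos_both[of "u * u' * (v * v')"] assms(1) by (simp add: mult_ac)
  qed
  moreover have "u * u' \<in> E" "v * v' \<in> E" using assms closed(6) by auto
  ultimately show ?thesis using trichotomy by blast
qed

end

text \<open>The intermediate value property is the form of real closedness that maximality yields directly
  and that the order arguments use; roots of polynomials of odd degree follow
  (\<open>odd_degree_root\<close>).\<close>

locale real_closed_subfield = ordered_subfield +
  assumes intermediate_value:
    "p \<in> poly_over E \<Longrightarrow> a \<in> E \<Longrightarrow> b \<in> E \<Longrightarrow> pos (b - a) \<Longrightarrow> pos (- (poly p a * poly p b)) \<Longrightarrow>
       \<exists>c. pos (c - a) \<and> pos (b - c) \<and> poly p c = 0"


section \<open>Maximal real extensions\<close>

text \<open>The weights \<open>T\<close> are the elements that have to become non-negative: an ordering of \<open>E\<close> with this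
  property exists if and only if \<open>-1\<close> is not a weighted sum of squares.\<close>

inductive_set weighted_squares :: "'a::comm_ring_1 set \<Rightarrow> 'a set \<Rightarrow> 'a set" for T E where
  zero: "0 \<in> weighted_squares T E"
| add: "s \<in> weighted_squares T E \<Longrightarrow> t \<in> T \<Longrightarrow> x \<in> E \<Longrightarrow> s + t * (x * x) \<in> weighted_squares T E"

lemma weighted_squares_mono:
  assumes "s \<in> weighted_squares T E" "E \<subseteq> E'" shows "s \<in> weighted_squares T E'"
  using assms(1) by induction (use assms(2) in \<open>auto intro: weighted_squares.intros\<close>)

lemma weighted_squares_single: "t \<in> T \<Longrightarrow> x \<in> E \<Longrightarrow> t * (x * x) \<in> weighted_squares T E"
  using weighted_squares.add[OF weighted_squares.zero, of t T x E] by simp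

lemma weighted_squares_sum:
  assumes "s \<in> weighted_squares T E" "s' \<in> weighted_squares T E"
  shows "s + s' \<in> weighted_squares T E"
  using assms(2)
  by induction (use assms(1) in \<open>auto simp: add.assoc[symmetric] intro: weighted_squares.intros\<close>)

text \<open>Weighted sums of squares are closed under products because the weights are.\<close>

lemma weighted_squares_mult_single:
  assumes "s \<in> weighted_squares T E" "is_subring E" "\<And>t t'. t \<in> T \<Longrightarrow> t' \<in> T \<Longrightarrow> t * t' \<in> T"
    "t \<in> T" "x \<in> E"
  shows "s * (t * (x * x)) \<in> weighted_squares T E"
  using assms(1)
proof induction
  case (add s t' y)
  have "s * (t * (x * x)) + (t' * t) * ((y * x) * (y * x)) \<in> weighted_squares T E"
    using add assms by (intro weighted_squares.add) (auto intro: subring_mult)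
  thus ?case by (simp add: algebra_simps)
qed (simp add: weighted_squares.zero)

lemma weighted_squares_mult:
  assumes "s' \<in> weighted_squares T E" "s \<in> weighted_squares T E" "is_subring E"
    "\<And>t t'. t \<in> T \<Longrightarrow> t' \<in> T \<Longrightarrow> t * t' \<in> T"
  shows "s * s' \<in> weighted_squares T E"
  using assms(1)
proof induction
  case (add s' t x)
  thus ?case
    using weighted_squares_sum[OF add.IH weighted_squares_mult_single[OF assms(2-4) add(2,3)]]
    by (simp add: algebra_simps)
qed (simp add: weighted_squares.zero)

lemma weighted_squares_subset:
  assumes "s \<in> weighted_squares T E" "is_subring E" "T \<subseteq> E" shows "s \<in> E"
  using assms(1) by induction (use assms(2,3) in \<open>auto intro!: subring_closed\<close>)

lemma chain_upper_bound:
  assumes "subset.chain A C" "D \<in> C" "D' \<in> C"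
  obtains Z where "Z \<in> C" "D \<subseteq> Z" "D' \<subseteq> Z"
proof -
  have "D \<subseteq> D' \<or> D' \<subseteq> D" using assms by (simp add: subset_chain_def)
  thus ?thesis using that[OF assms(2)] that[OF assms(3)] by auto
qed

lemma is_subring_Union_chain:
  assumes "C \<noteq> {}" "subset.chain A C" "\<And>D. D \<in> C \<Longrightarrow> is_subring D"
  shows "is_subring (\<Union>C)"
  unfolding is_subring_def
proof (intro conjI ballI)
  show "1 \<in> \<Union>C" using assms(1,3) subring_one by blast
  fix x y assume "x \<in> \<Union>C" "y \<in> \<Union>C"
  then obtain Z where "Z \<in> C" "x \<in> Z" "y \<in> Z"
    by (meson UnionE assms(2) chain_upper_bound subsetD)
  thus "x - y \<in> \<Union>C" "x * y \<in> \<Union>C" using assms(3) subring_diff subring_mult by blast+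
qed

lemma weighted_squares_Union_chain:
  assumes "s \<in> weighted_squares T (\<Union>C)" "C \<noteq> {}" "subset.chain A C"
  shows "\<exists>D\<in>C. s \<in> weighted_squares T D"
  using assms(1)
proof induction
  case zero
  thus ?case using assms(2) weighted_squares.zero by blast
next
  case (add s t x)
  then obtain D Y where XY: "D \<in> C" "s \<in> weighted_squares T D" "Y \<in> C" "x \<in> Y" by blast
  obtain Z where Z: "Z \<in> C" "D \<subseteq> Z" "Y \<subseteq> Z" using chain_upper_bound[OF assms(3) XY(1,3)] .
  thus ?case using weighted_squares_mono[OF XY(2) Z(2)] add.hyps(2) weighted_squares.add XY(4) by blast
qed

definition real_extension :: "'a::field set \<Rightarrow> 'a set \<Rightarrow> 'a set \<Rightarrow> bool" where
  "real_extension T L E \<longleftrightarrow> is_subfield E \<and> T \<subseteq> E \<and> E \<subseteq> L \<and> - 1 \<notin> weighted_squares T E"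

lemma maximal_real_extension:
  assumes "real_extension T L E0"
  obtains E where "real_extension T L E" "E0 \<subseteq> E"
    "\<And>E'. real_extension T L E' \<Longrightarrow> E \<subseteq> E' \<Longrightarrow> E' = E"
proof -
  let ?A = "{E. real_extension T L E \<and> E0 \<subseteq> E}"
  have "\<exists>M\<in>?A. \<forall>D\<in>?A. M \<subseteq> D \<longrightarrow> D = M"
  proof (rule subset_Zorn_nonempty)
    show "?A \<noteq> {}" using assms by auto
    fix C assume C: "C \<noteq> {}" "subset.chain ?A C"
    hence sub: "D \<in> C \<Longrightarrow> real_extension T L D \<and> E0 \<subseteq> D" for D
      by (auto simp: subset_chain_def)
    have "is_subfield (\<Union>C)"
      using is_subring_Union_chain[OF C] sub unfolding is_subfield_def real_extension_def by blast
    moreover have "- 1 \<notin> weighted_squares T (\<Union>C)"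
      using weighted_squares_Union_chain[OF _ C] sub by (auto simp: real_extension_def)
    moreover have "T \<subseteq> \<Union>C" "\<Union>C \<subseteq> L" "E0 \<subseteq> \<Union>C"
      using sub C(1) unfolding real_extension_def by blast+
    ultimately show "\<Union>C \<in> ?A" by (simp add: real_extension_def)
  qed
  thus ?thesis using that by (smt (verit, best) mem_Collect_eq order.trans)
qed

lemma degree_le_one_cases:
  assumes "degree p \<le> 1" obtains b c where "p = [:b, c:]"
proof -
  have "p = [:coeff p 0, coeff p 1:]"
    using assms by (intro poly_eqI) (auto simp: coeff_pCons coeff_eq_0 split: nat.split)
  thus ?thesis by (rule that)
qed

text \<open>A weighted sum of squares in \<open>E[\<theta>]\<close> is the value at \<open>\<theta>\<close> of a polynomial that is itself a weighted
  sum of squares (\<open>weighted_squares_simple_extension\<close>).  Its degree is at most twice that of its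
  summands, and its values on \<open>E\<close> are weighted sums of squares again; this is what bounds the
  cofactor in the proof of the intermediate value theorem.\<close>

lemma weighted_squares_poly:
  fixes T :: "'a::field set"
  assumes "P \<in> weighted_squares ((\<lambda>t. [:t:]) ` T) {p \<in> poly_over E. degree p < d}" 
  shows "degree P \<le> 2 * (d - 1)"
    and "is_subring E \<Longrightarrow> T \<subseteq> E \<Longrightarrow> P \<in> poly_over E"
    and "is_subring E \<Longrightarrow> x \<in> E \<Longrightarrow> poly P x \<in> weighted_squares T E"
proof -
  show "degree P \<le> 2 * (d - 1)"
    using assms
  proof induction
    case (add s t x)
    then obtain c where c: "t = [:c:]" by auto
    have "degree (t * (x * x)) \<le> degree (x * x)" by (simp add: c)
    also have "\<dots> \<le> degree x + degree x" by (rule degree_mult_le)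
    also have "\<dots> \<le> 2 * (d - 1)" using add by auto
    finally show ?case using add.IH by (intro degree_add_le)
  qed simp
  show "P \<in> poly_over E" if "is_subring E" "T \<subseteq> E"
    using assms
  proof (rule weighted_squares_subset[OF weighted_squares_mono])
    show "is_subring (poly_over E)" by (rule is_subring_poly_over[OF that(1)])
    show "(\<lambda>t. [:t:]) ` T \<subseteq> poly_over E"
      using that by (auto intro!: poly_over_closed)
  qed auto
  show "poly P x \<in> weighted_squares T E" if "is_subring E" "x \<in> E"
    using assms
  proof induction
    case (add s t y)
    thus ?case using that weighted_squares.add[of "poly s x" T E _ "poly y x"] poly_in_subring[of E y x]
      by auto
  qed (simp add: weighted_squares.zero)
qed

lemma weighted_squares_simple_extension:
  assumes "s \<in> weighted_squares T ((\<lambda>p. poly p \<theta>) ` poly_over E)"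
    and E: "is_subfield E" and f: "f \<in> poly_over E" "poly f \<theta> = 0" "degree f > 0"
  shows "\<exists>P\<in>weighted_squares ((\<lambda>t. [:t:]) ` T) {p \<in> poly_over E. degree p < degree f}. poly P \<theta> = s"
  using assms(1)
proof induction
  case zero
  thus ?case by (intro bexI[of _ 0]) (auto intro: weighted_squares.zero)
next
  case (add s t x)
  then obtain P where P: "P \<in> weighted_squares ((\<lambda>t. [:t:]) ` T) {p \<in> poly_over E. degree p < degree f}"
    "poly P \<theta> = s" by blast
  from add(3) obtain g where g: "g \<in> poly_over E" "x = poly g \<theta>" by auto
  obtain q r where qr: "q \<in> poly_over E" "r \<in> poly_over E" "g = q * f + r" "r = 0 \<or> degree r < degree f"
    using poly_over_division[OF E f(1) _ g(1)] f(3) by fastforce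
  have "x = poly r \<theta>" using qr(3) f g(2) by simp
  thus ?case using P add(2) qr(2,4) f(3)
    using weighted_squares.add[OF P(1), of "[:t:]" r]
    by (intro bexI[of _ "P + [:t:] * (r * r)"]) auto
qed

context
  fixes T L E :: "'a::field set"
  assumes T_mult: "\<And>t t'. t \<in> T \<Longrightarrow> t' \<in> T \<Longrightarrow> t * t' \<in> T"
    and T_one: "1 \<in> T"
    and L: "is_subfield L" "\<And>p. p \<in> poly_over L \<Longrightarrow> degree p > 0 \<Longrightarrow> \<exists>x\<in>L. poly p x = 0"
    and E: "real_extension T L E"
    and maximal: "\<And>E'. real_extension T L E' \<Longrightarrow> E \<subseteq> E' \<Longrightarrow> E' = E"
begin

private lemma sf: "is_subfield E" and TE: "T \<subseteq> E" and EL: "E \<subseteq> L"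
  and m1: "- 1 \<notin> weighted_squares T E"
  using E by (auto simp: real_extension_def)

private lemma sr: "is_subring E" by (rule subfield_subring[OF sf])

private lemma mult_closed:
  "s \<in> weighted_squares T E \<Longrightarrow> s' \<in> weighted_squares T E \<Longrightarrow> s * s' \<in> weighted_squares T E"
  by (rule weighted_squares_mult[OF _ _ sr T_mult])

private lemma square_in: "x \<in> E \<Longrightarrow> 1 * (x * x) \<in> weighted_squares T E"
  by (rule weighted_squares_single[OF T_one])

private lemma minus_one_in_extension:
  assumes "\<theta> \<in> L" "\<theta> \<notin> E" "g \<in> poly_over E" "g \<noteq> 0" "poly g \<theta> = 0"
  shows "- 1 \<in> weighted_squares T ((\<lambda>p. poly p \<theta>) ` poly_over E)" (is "_ \<in> weighted_squares T ?E'")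
proof (rule ccontr)
  assume c: "\<not> ?thesis"
  obtain f where "min_poly_over E \<theta> f" using min_poly_over_exists assms by blast
  hence "is_subfield ?E'" by (rule is_subfield_simple_extension[OF sf])
  moreover have "T \<subseteq> ?E'" using TE subset_simple_extension[OF sr] by blast
  moreover have "?E' \<subseteq> L"
    using poly_in_subring[OF subfield_subring[OF L(1)]] assms(1) poly_over_mono[OF EL] by blast
  ultimately have "?E' = E" using c maximal subset_simple_extension[OF sr]
    by (auto simp: real_extension_def)
  thus False using mem_simple_extension[OF sr, of \<theta>] assms(2) by simp
qed

text \<open>If \<open>\<sigma>\<close> is a square root of \<open>a\<close> outside \<open>E\<close>, then \<open>-1 = u + a * v + w * \<sigma>\<close> with weighted sums
  of squares \<open>u\<close> and \<open>v\<close>.  This forces \<open>w = 0\<close>, and \<open>- a = (1 + u) * v * (1 / v)\<^sup>2\<close> is a weighted sum of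
  squares.\<close>

private lemma square_if_neg_not_in:
  assumes a: "a \<in> E" "- a \<notin> weighted_squares T E"
  shows "\<exists>y\<in>E. a = y * y"
proof -
  define f where "f = [:- a, 0, 1:]"
  have fE: "f \<in> poly_over E" unfolding f_def by (intro poly_over_closed subring_closed sr a)
  have df: "degree f = 2" by (simp add: f_def)
  obtain \<sigma> where \<sigma>: "\<sigma> \<in> L" "poly f \<sigma> = 0" using L(2)[of f] fE poly_over_mono[OF EL] df by auto
  have \<sigma>2: "\<sigma> * \<sigma> = a" using \<sigma>(2) by (simp add: f_def algebra_simps)
  show ?thesis
  proof (cases "\<sigma> \<in> E")
    case True
    thus ?thesis using \<sigma>2 by auto
  next
    case False
    have "f \<noteq> 0" using df by auto
    have "- 1 \<in> weighted_squares T ((\<lambda>p. poly p \<sigma>) ` poly_over E)"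
      using minus_one_in_extension \<sigma> False fE \<open>f \<noteq> 0\<close> by blast
    moreover have "\<exists>u v w. u \<in> weighted_squares T E \<and> v \<in> weighted_squares T E \<and> w \<in> E \<and> s = u + a * v + w * \<sigma>"
      if "s \<in> weighted_squares T ((\<lambda>p. poly p \<sigma>) ` poly_over E)" for s
      using that
    proof induction
      case zero
      show ?case using weighted_squares.zero subring_zero[OF sr]
        by (intro exI[of _ 0]) auto
    next
      case (add s t x)
      then obtain u v w where uvw: "u \<in> weighted_squares T E" "v \<in> weighted_squares T E" "w \<in> E" "s = u + a * v + w * \<sigma>"
        by blast
      obtain g where g: "g \<in> poly_over E" "x = poly g \<sigma>" using add by auto
      obtain q r where qr: "q \<in> poly_over E" "r \<in> poly_over E" "g = q * f + r" "r = 0 \<or> degree r < degree f"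
        using poly_over_division[OF sf fE \<open>f \<noteq> 0\<close> g(1)] by blast
      have "degree r \<le> 1" using qr(4) df by auto
      then obtain b c where bc: "r = [:b, c:]"
        by (rule degree_le_one_cases)
      have bcE: "b \<in> E" "c \<in> E" using coeff_poly_over[OF qr(2), of 0] coeff_poly_over[OF qr(2), of 1] by (auto simp: bc)
      have x: "x = b + c * \<sigma>" using g(2) qr(3) \<sigma>(2) by (simp add: bc)
      have tE: "t \<in> E" using add TE by auto
      have "s + t * (x * x) = (u + t * (b * b)) + a * (v + t * (c * c)) + (w + 2 * t * b * c) * \<sigma>"
        unfolding uvw(4) x \<sigma>2[symmetric] by (simp add: algebra_simps)
      moreover have "w + 2 * t * b * c \<in> E"
        using uvw(3) tE bcE subring_of_nat[OF sr, of 2] by (auto intro!: subring_add[OF sr] subring_mult[OF sr])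
      ultimately show ?case
        using weighted_squares.add[OF uvw(1) add(2) bcE(1)] weighted_squares.add[OF uvw(2) add(2) bcE(2)] by blast
    qed
    ultimately obtain u v w where uvw: "u \<in> weighted_squares T E" "v \<in> weighted_squares T E" "w \<in> E"
      "- 1 = u + a * v + w * \<sigma>" by blast
    note uvE = weighted_squares_subset[OF uvw(1) sr TE] weighted_squares_subset[OF uvw(2) sr TE]
    have "w = 0"
    proof (rule ccontr)
      assume "w \<noteq> 0"
      hence "\<sigma> = (- 1 - u - a * v) / w" using uvw(4) by (simp add: field_simps)
      moreover have "(- 1 - u - a * v) / w \<in> E" by (intro subfield_closed sf uvE uvw a)
      ultimately show False using False by simp
    qed
    hence eq: "- 1 = u + a * v" using uvw(4) by simp
    have "v \<noteq> 0" using eq uvw(1) m1 by auto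
    have "- a = (1 * (1 * 1) + u) * v * (1 * (inverse v * inverse v))"
    proof -
      have "a * v = - 1 - u" using eq by (simp add: eq_diff_eq add.commute)
      hence "- a * v = 1 + u" by simp
      hence "- a = (1 + u) / v" using \<open>v \<noteq> 0\<close> by (metis nonzero_eq_divide_eq)
      thus ?thesis using \<open>v \<noteq> 0\<close> by (simp only: divide_inverse) simp
    qed
    also have "\<dots> \<in> weighted_squares T E"
      by (intro mult_closed weighted_squares_sum square_in uvw(1,2) subfield_inverse[OF sf] subring_one[OF sr] uvE)
    finally show ?thesis using a(2) by simp
  qed
qed

private lemma pos_square_cases: "x \<in> E \<Longrightarrow> \<exists>y\<in>E. x = y * y \<or> x = - (y * y)"
proof (cases "- x \<in> weighted_squares T E")
  case True
  assume x: "x \<in> E"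
  show ?thesis
  proof (cases "x = 0")
    case True
    thus ?thesis using subring_zero[OF sr] by (intro bexI[of _ 0]) auto
  next
    case False
    have "x \<notin> weighted_squares T E"
    proof
      assume "x \<in> weighted_squares T E"
      hence "x * (- x) * (1 * (inverse x * inverse x)) \<in> weighted_squares T E"
        using True x by (intro mult_closed square_in subfield_inverse[OF sf])
      moreover have "x * (- x) * (1 * (inverse x * inverse x)) = - 1"
        using False by (simp add: field_simps)
      ultimately show False using m1 by simp
    qed
    then obtain y where "y \<in> E" "- x = y * y"
      using square_if_neg_not_in[of "- x"] subring_uminus[OF sr x] by auto
    thus ?thesis by (intro bexI[of _ y]) (auto simp: minus_equation_iff[of x])
  qed
next
  case False
  assume "x \<in> E"
  thus ?thesis using square_if_neg_not_in[OF _ False] by blast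
qed

private lemma weighted_squares_eq_squares: "s \<in> weighted_squares T E \<Longrightarrow> \<exists>y\<in>E. s = y * y"
proof -
  assume s: "s \<in> weighted_squares T E"
  hence sE: "s \<in> E" using weighted_squares_subset sr TE by blast
  show ?thesis
  proof (cases "s = 0")
    case True
    thus ?thesis using subring_zero[OF sr] by (intro bexI[of _ 0]) auto
  next
    case False
    have "- s \<notin> weighted_squares T E"
    proof
      assume "- s \<in> weighted_squares T E"
      hence "(- s) * s * (1 * (inverse s * inverse s)) \<in> weighted_squares T E"
        using s sE by (intro mult_closed square_in subfield_inverse[OF sf])
      moreover have "(- s) * s * (1 * (inverse s * inverse s)) = - 1"
        using False by (simp add: field_simps)
      ultimately show False using m1 by simp
    qed
    thus ?thesis using square_if_neg_not_in sE by blast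
  qed
qed

lemma ordered_subfield_if_maximal: "ordered_subfield E"
proof
  show "is_subfield E" by (rule sf)
  show "\<exists>z\<in>E. x * x + y * y = z * z" if "x \<in> E" "y \<in> E" for x y
    using weighted_squares_eq_squares[OF weighted_squares_sum[OF weighted_squares_single[OF T_one that(1)]
      weighted_squares_single[OF T_one that(2)]]] by simp
  show "x * x \<noteq> - 1" if "x \<in> E" for x
    using weighted_squares_single[OF T_one that] m1 by auto
qed (rule pos_square_cases)

lemma nonneg_if_weight: "t \<in> T \<Longrightarrow> nonneg_in E t"
  using weighted_squares_single[of t T 1 E] subring_one[OF sr] weighted_squares_eq_squares
  unfolding nonneg_in_def by auto

text \<open>Suppose that \<open>f\<close> changes its sign without having a root, and that polynomials of smaller degree
  do not do this.  Then \<open>f\<close> is, up to a constant, the minimal polynomial of a root \<open>\<theta>\<close> outside \<open>E\<close>,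
  and by maximality \<open>-1\<close> is a weighted sum of squares in \<open>E[\<theta>]\<close>.  So \<open>1 + P = h * f\<close> where \<open>P\<close> is a
  weighted sum of squares of polynomials of degree less than that of \<open>f\<close>.  The left-hand side is
  positive on \<open>E\<close>, hence \<open>h\<close> changes its sign where \<open>f\<close> does; but the degree of \<open>h\<close> is smaller than
  that of \<open>f\<close>, so \<open>h\<close> has a root in \<open>E\<close>, where \<open>1 + P\<close> would vanish.\<close>

lemma real_closed_subfield_if_maximal: "real_closed_subfield E"
proof -
  interpret ordered_subfield E by (rule ordered_subfield_if_maximal)
  have ws: "nonneg s" if "s \<in> weighted_squares T E" for s
    using weighted_squares_eq_squares[OF that] by (simp add: nonneg_in_def)
  have "\<exists>c. pos (c - a) \<and> pos (b - c) \<and> poly f c = 0"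
    if "f \<in> poly_over E" "a \<in> E" "b \<in> E" "pos (b - a)" "pos (- (poly f a * poly f b))" for f a b
    using that
  proof (induction "degree f" arbitrary: f rule: less_induct)
    case less
    note pE = poly_in_subring[OF sr]
    show ?case
    proof (rule ccontr)
      assume no: "\<not> ?thesis"
      have f0: "f \<noteq> 0" using less.prems(5) not_pos_zero by auto
      have smaller: False if "g \<in> poly_over E" "h \<in> poly_over E" "g * h = f" "degree g < degree f" "degree h < degree f" for g h
      proof -
        have "pos (- (poly g a * poly g b)) \<or> pos (- (poly h a * poly h b))"
          using less.prems(5,2,3) that(1-3) by (intro opposite_signs_factor) (auto intro: pE)
        thus False using less.hyps[OF that(4,1) less.prems(2-4)] less.hyps[OF that(5,2) less.prems(2-4)] no that(3) by auto
      qed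
      have dpos: "degree f > 0"
      proof (rule ccontr)
        assume "\<not> degree f > 0"
        then obtain c where c: "f = [:c:]" using degree_eq_zeroE by blast
        have "c \<in> E" using coeff_poly_over[OF less.prems(1), of 0] c by simp
        thus False using less.prems(5) c pos_square[of c] not_pos_both[of "c * c"] f0 by auto
      qed
      then obtain \<theta> where \<theta>: "\<theta> \<in> L" "poly f \<theta> = 0"
        using L(2)[of f] less.prems(1) poly_over_mono[OF EL] by auto
      then obtain m where m: "min_poly_over E \<theta> m" using min_poly_over_exists[OF less.prems(1) f0] by blast
      then obtain k where k: "k \<in> poly_over E" "f = k * m" using min_poly_over_dvd[OF sf m less.prems(1) \<theta>(2)] by blast
      have mE: "m \<in> poly_over E" "m \<noteq> 0" "poly m \<theta> = 0" using m by (auto simp: min_poly_over_def)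
      have "degree m > 0"
      proof (rule ccontr)
        assume "\<not> degree m > 0"
        then obtain c where "m = [:c:]" using degree_eq_zeroE by blast
        thus False using mE by auto
      qed
      moreover have dkm: "degree f = degree k + degree m" using k(2) f0 by (auto intro: degree_mult_eq)
      ultimately have "degree k = 0" using smaller[OF k(1) mE(1)] k(2) by auto
      hence dm: "degree m = degree f" using dkm by simp
      show False
      proof (cases "\<theta> \<in> E")
        case True
        have lin: "[:- \<theta>, 1:] \<in> poly_over E" by (intro poly_over_closed closed True sr)
        hence "degree f \<le> 1" using m dm unfolding min_poly_over_def by force
        hence "degree f = 1" using dpos by simp
        then obtain c0 c1 where c: "f = [:c0, c1:]"
          by (metis degree_le_one_cases order_refl)
        hence f_eq: "poly f x = c1 * (x - \<theta>)" for x using \<theta>(2) by (simp add: algebra_simps add_eq_0_iff2)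
        have c1: "c1 \<in> E" "c1 \<noteq> 0" using coeff_poly_over[OF less.prems(1), of 1] c \<open>degree f = 1\<close> by auto
        have "poly f a * poly f b = c1 * c1 * ((a - \<theta>) * (b - \<theta>))" unfolding f_eq by (simp add: algebra_simps)
        hence "pos (c1 * c1 * (- ((a - \<theta>) * (b - \<theta>))))" using less.prems(5) by simp
        hence pp: "pos (- ((a - \<theta>) * (b - \<theta>)))" using pos_mult_cancel pos_square c1 by blast
        hence "a \<noteq> \<theta>" using not_pos_zero by auto
        hence "pos (\<theta> - a) \<or> pos (a - \<theta>)"
          using trichotomy[of "\<theta> - a"] True less.prems(2) closed(4) by auto
        thus False
        proof
          assume "pos (\<theta> - a)"
          moreover have "pos ((\<theta> - a) * (b - \<theta>))" using pp by (simp add: algebra_simps)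
          ultimately have "pos (b - \<theta>)" using pos_mult_cancel by blast
          thus False using no \<open>pos (\<theta> - a)\<close> \<theta>(2) by blast
        next
          assume A: "pos (a - \<theta>)"
          have "pos (b - \<theta>)" using pos_add[OF A less.prems(4)] by simp
          thus False using pos_mult[OF A] pp not_pos_both by blast
        qed
      next
        case False
        obtain P where P: "P \<in> weighted_squares ((\<lambda>t. [:t:]) ` T) {p \<in> poly_over E. degree p < degree f}"
          "poly P \<theta> = - 1"
          using weighted_squares_simple_extension[OF minus_one_in_extension[OF \<theta>(1) False less.prems(1) f0 \<theta>(2)] sf less.prems(1) \<theta>(2) dpos] by blast
        note Pp = weighted_squares_poly(1)[OF P(1)] weighted_squares_poly(2)[OF P(1) sr TE] ws[OF weighted_squares_poly(3)[OF P(1) sr]]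
        have "1 + P \<in> poly_over E" by (intro poly_over_closed sr Pp)
        moreover have "poly (1 + P) \<theta> = 0" using P(2) by simp
        ultimately obtain h where h: "h \<in> poly_over E" "1 + P = h * m" using min_poly_over_dvd[OF sf m] by blast
        have P1: "pos (poly (1 + P) x)" if "x \<in> E" for x
          using pos_add_nonneg[OF pos_one Pp(3)[OF that]] by simp
        have "1 + P \<noteq> 0" using P1[of 0] closed(1) not_pos_zero by (metis poly_0)
        hence "degree (1 + P) = degree h + degree m" using h(2) by (auto intro: degree_mult_eq)
        moreover have "degree (1 + P) \<le> 2 * (degree f - 1)" using Pp(1) by (intro degree_add_le) auto
        ultimately have dh: "degree h < degree f" using dm dpos by linarith
        obtain k0 where k0: "k = [:k0:]" using \<open>degree k = 0\<close> degree_eq_zeroE by blast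
        have "pos (poly (1 + P) a * poly (1 + P) b)" using P1 less.prems(2,3) pos_mult by blast
        moreover have "pos (- (poly (k * m) a * poly (k * m) b))" using less.prems(5) k(2) by simp
        ultimately have "pos (poly (1 + P) a * poly (1 + P) b * (- (poly (k * m) a * poly (k * m) b)))" by (rule pos_mult)
        moreover have "poly (1 + P) a * poly (1 + P) b * (- (poly (k * m) a * poly (k * m) b)) =
           (k0 * poly m a * poly m b) * (k0 * poly m a * poly m b) * (- (poly h a * poly h b))"
          unfolding h(2) k0 by (simp add: algebra_simps)
        moreover have "k0 * poly m a * poly m b \<in> E" using coeff_poly_over[OF k(1), of 0] k0 mE(1) less.prems
          by (auto intro!: closed pE)
        ultimately have "pos (- (poly h a * poly h b))"
          using pos_square[of "k0 * poly m a * poly m b"] pos_mult_cancel not_pos_zero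
          by (metis mult_zero_left)
        then obtain c where "pos (c - a)" "poly h c = 0"
          using less.hyps[OF dh h(1) less.prems(2-4)] by blast
        moreover from this have "c \<in> E" using pos_mem[of "c - a"] less.prems(2) closed(3)[of "c - a" a] by auto
        ultimately show False using P1[of c] h(2) not_pos_zero by (metis mult_zero_left poly_mult)
      qed
    qed
  qed
  thus ?thesis by unfold_locales
qed

end

section \<open>Bounds, cuts and derivatives\<close>

lemma poly_over_root_factor:
  assumes "is_subfield E" "p \<in> poly_over E" "c \<in> E" "poly p c = 0"
  obtains k where "k \<in> poly_over E" "p = [:- c, 1:] * k"
proof -
  have lin: "[:- c, 1:] \<in> poly_over E"
    by (intro poly_over_closed subring_closed subfield_subring assms)
  obtain q r where qr: "q \<in> poly_over E" "p = q * [:- c, 1:] + r" "r = 0 \<or> degree r < degree [:- c, 1:]"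
    using poly_over_division[OF assms(1) lin _ assms(2)] by force
  have "degree r = 0" using qr(3) by auto
  then obtain d where "r = [:d:]" using degree_eq_zeroE by blast
  hence "r = 0" using qr(2) assms(4) by simp
  thus ?thesis using that qr by (simp add: mult.commute)
qed

lemma poly_over_pcompose:
  assumes "is_subring S" "p \<in> poly_over S" "q \<in> poly_over S"
  shows "pcompose p q \<in> poly_over S"
  using assms(2)
proof (induction p)
  case (pCons a p)
  have "a \<in> S" "p \<in> poly_over S"
    using pCons.prems by (auto simp: poly_over_def coeff_pCons split: nat.splits)
  thus ?case using pCons.IH assms(1,3) by (auto simp: pcompose_pCons intro!: poly_over_closed)
qed (simp add: poly_over_0 assms(1))

lemma poly_over_reflect:
  "is_subring S \<Longrightarrow> p \<in> poly_over S \<Longrightarrow> pcompose p [:0, - 1:] \<in> poly_over S"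
  by (intro poly_over_pcompose poly_over_pCons poly_over_0 subring_zero subring_uminus subring_one)

context ordered_subfield
begin

lemma pos_if_not_nonneg_diff: "\<not> nonneg (x - y) \<Longrightarrow> x \<in> E \<Longrightarrow> y \<in> E \<Longrightarrow> pos (y - x)"
  using not_nonneg_iff[OF closed(4), of x y] by simp

lemma upper_bound_of_two:
  assumes "u \<in> S" "v \<in> S" "S \<subseteq> E"
  obtains w where "w \<in> S" "nonneg (w - u)" "nonneg (w - v)"
proof (cases "nonneg (v - u)")
  case True
  thus ?thesis using that[of v] assms by (simp add: nonneg_iff)
next
  case False
  hence "nonneg (u - v)" using not_nonneg_iff[of "v - u"] assms closed(4) by (auto simp: nonneg_iff)
  thus ?thesis using that[of u] assms by (simp add: nonneg_iff)
qed

lemma finite_least: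
  assumes "finite Z" "Z \<noteq> {}" "Z \<subseteq> E"
  shows "\<exists>e\<in>Z. \<forall>x\<in>Z. nonneg (x - e)"
  using assms
proof (induction rule: finite_ne_induct)
  case (singleton x)
  thus ?case by (simp add: nonneg_iff)
next
  case (insert x F)
  then obtain e where e: "e \<in> F" "\<forall>y\<in>F. nonneg (y - e)" by auto
  show ?case
  proof (cases "nonneg (x - e)")
    case True
    thus ?thesis using e by (intro bexI[of _ e]) auto
  next
    case False
    hence ex: "nonneg (e - x)" using not_nonneg_iff[of "x - e"] insert.prems e(1) closed(4) by (auto simp: nonneg_iff)
    have "nonneg (y - x)" if "y \<in> F" for y
      using nonneg_add[OF bspec[OF e(2) that] ex] by simp
    thus ?thesis by (intro bexI[of _ x]) (auto simp: nonneg_iff)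
  qed
qed

lemma finite_greatest:
  assumes "finite Z" "Z \<noteq> {}" "Z \<subseteq> E"
  shows "\<exists>e\<in>Z. \<forall>x\<in>Z. nonneg (e - x)"
proof -
  have "\<exists>e\<in>uminus ` Z. \<forall>x\<in>uminus ` Z. nonneg (x - e)"
    using assms by (intro finite_least) (auto intro: closed(5))
  thus ?thesis by auto
qed

lemma pos_or_neg_cases: "x \<in> E \<Longrightarrow> x \<noteq> 0 \<Longrightarrow> pos x \<or> pos (- x)"
  using trichotomy by blast

lemma pderiv_nonzero:
  assumes "p \<in> poly_over E" "degree p > 0" shows "pderiv p \<noteq> 0"
proof
  assume "pderiv p = 0"
  hence "of_nat (Suc (degree p - 1)) * lead_coeff p = 0"
    using coeff_pderiv[of p "degree p - 1"] assms(2) by simp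
  moreover have "of_nat (Suc (degree p - 1)) \<noteq> (0::'a)" using pos_of_nat not_pos_zero by metis
  ultimately show False using assms(2) by auto
qed

lemma degree_pderiv_less: "degree p > 0 \<Longrightarrow> degree (pderiv (p :: 'a poly)) < degree p"
  by (rule le_less_trans[OF degree_le[of "degree p - 1"]]) (auto simp: coeff_pderiv coeff_eq_0)

text \<open>The bound is found inside the ring of coefficients; this is used for rings that are not cofinal
  in \<open>E\<close>.\<close>

lemma monic_bound:
  assumes "is_subring S" "S \<subseteq> E" 
  shows "p \<in> poly_over S \<Longrightarrow> lead_coeff p = 1 \<Longrightarrow> degree p > 0 \<Longrightarrow> c \<in> S \<Longrightarrow>
    \<exists>B\<in>S. \<forall>x. nonneg (x - B) \<longrightarrow> pos (poly p x - c)"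
proof (induction p arbitrary: c)
  case (pCons a q)
  have aq: "a \<in> S" "q \<in> poly_over S"
    using pCons.prems(1) by (auto simp: poly_over_def coeff_pCons split: nat.splits)
  have "q \<noteq> 0" using pCons.prems(3) by auto
  have lq: "lead_coeff q = 1" using pCons.prems(2) \<open>q \<noteq> 0\<close> by simp
  have c1: "c - a + 1 \<in> S" by (intro subring_closed assms aq pCons.prems)
  show ?case
  proof (cases "degree q = 0")
    case True
    hence "q = [:1:]" using lq by (metis degree_eq_zeroE lead_coeff_pCons(2) pCons_0_0)
    hence "pos (poly (pCons a q) x - c)" if "nonneg (x - (c - a + 1))" for x
      using pos_add_nonneg[OF pos_one that] by (simp add: algebra_simps)
    thus ?thesis using c1 by blast
  next
    case False
    then obtain B1 where B1: "B1 \<in> S" "\<forall>x. nonneg (x - B1) \<longrightarrow> pos (poly q x - 1)"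
      using pCons.IH[OF aq(2) lq _ subring_one[OF assms(1)]] by auto
    obtain B2 where B2: "B2 \<in> S" "nonneg (B2 - (c - a + 1))" "nonneg (B2 - 1)"
      using upper_bound_of_two[OF c1 subring_one[OF assms(1)] assms(2)] .
    obtain B where B: "B \<in> S" "nonneg (B - B1)" "nonneg (B - B2)"
      using upper_bound_of_two[OF B1(1) B2(1) assms(2)] .
    have "pos (poly (pCons a q) x - c)" if x: "nonneg (x - B)" for x
    proof -
      have "nonneg (x - B1)" using nonneg_add[OF x B(2)] by simp
      hence q1: "pos (poly q x - 1)" using B1 by blast
      have x2: "nonneg (x - B2)" using nonneg_add[OF x B(3)] by simp
      have "nonneg (x - 1)" using nonneg_add[OF x2 B2(3)] by simp
      from pos_add_nonneg[OF pos_one this] have "pos x" by simp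
      hence A: "pos (x * (poly q x - 1))" using q1 by (rule pos_mult)
      have "nonneg (x - (c - a + 1))" using nonneg_add[OF x2 B2(2)] by (simp add: algebra_simps)
      from pos_add_nonneg[OF pos_one this] have "pos (x - (c - a))" by (simp add: algebra_simps)
      from pos_add[OF A this] show ?thesis by (simp add: algebra_simps)
    qed
    thus ?thesis using B(1) by blast
  qed
qed simp

lemma algebraic_bound:
  assumes N: "is_subfield N" "N \<subseteq> E" and y: "y \<in> E" and p: "p \<in> poly_over N" "p \<noteq> 0" "poly p y = 0"
  obtains B where "B \<in> N" "pos (B - y)"
proof -
  define q where "q = smult (inverse (lead_coeff p)) p"
  have q: "q \<in> poly_over N" "lead_coeff q = 1" "poly q y = 0"
    using p by (auto simp: q_def intro!: poly_over_smult subfield_subring N subfield_inverse coeff_poly_over)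
  have "degree q > 0"
  proof (rule ccontr)
    assume "\<not> degree q > 0"
    then obtain d where "q = [:d:]" using degree_eq_zeroE by blast
    thus False using q by auto
  qed
  then obtain B where B: "B \<in> N" "\<forall>x. nonneg (x - B) \<longrightarrow> pos (poly q x - 0)"
    using monic_bound[OF subfield_subring[OF N(1)] N(2) q(1,2)] subfield_closed(1)[OF N(1)] by blast
  have "\<not> nonneg (y - B)" using B(2) q(3) not_pos_zero by auto
  hence "pos (B - y)" using not_nonneg_iff[of "y - B"] y B(1) N(2) closed(4) by auto
  thus ?thesis using that B by blast
qed

lemma bounded_mult:
  assumes "pos (C - u)" "pos (C + u)" "pos (B - v)" "pos (B + v)"
  shows "pos (C * B - u * v)" "pos (C * B + u * v)"
proof -
  have "pos ((C - u) * (B + v) + (C + u) * (B - v))"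
    by (rule pos_add[OF pos_mult[OF assms(1,4)] pos_mult[OF assms(2,3)]])
  hence "pos (2 * (C * B - u * v))" by (simp add: algebra_simps)
  thus "pos (C * B - u * v)" using pos_mult_cancel pos_two by blast
  have "pos ((C - u) * (B - v) + (C + u) * (B + v))"
    by (rule pos_add[OF pos_mult[OF assms(1,3)] pos_mult[OF assms(2,4)]])
  hence "pos (2 * (C * B + u * v))" by (simp add: algebra_simps)
  thus "pos (C * B + u * v)" using pos_mult_cancel pos_two by blast
qed

lemma bounded_simple_extension:
  assumes N: "is_subring N" "N \<subseteq> E" and B: "B \<in> N" "pos (B - r)" "pos (B + r)"
  shows "g \<in> poly_over N \<Longrightarrow> \<exists>C\<in>N. pos (C - poly g r) \<and> pos (C + poly g r)"
proof (induction g)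
  case 0
  show ?case using pos_one subring_one[OF N(1)] by (intro bexI[of _ 1]) auto
next
  case (pCons a q)
  have aq: "a \<in> N" "q \<in> poly_over N"
    using pCons.prems by (auto simp: poly_over_def coeff_pCons split: nat.splits)
  then obtain C where C: "C \<in> N" "pos (C - poly q r)" "pos (C + poly q r)" using pCons.IH by auto
  obtain w where w: "w \<in> N" "nonneg (w - a)" "nonneg (w - (- a))"
    using upper_bound_of_two[OF aq(1) subring_uminus[OF N(1) aq(1)] N(2)] .
  note b = bounded_mult[OF B(2,3) C(2,3)]
  have "pos (w + B * C - (a + r * poly q r))"
    using pos_add_nonneg[OF b(1) w(2)] by (simp add: algebra_simps)
  moreover have "pos (w + B * C + (a + r * poly q r))"
    using pos_add_nonneg[OF b(2) w(3)] by (simp add: algebra_simps)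
  ultimately show ?case using w(1) C(1) B(1) N(1)
    by (intro bexI[of _ "w + B * C"]) (auto intro: subring_closed)
qed

text \<open>The inverse of \<open>u\<close> lies in \<open>N[r]\<close> as well and is therefore bounded by an element of \<open>N\<close>.  So \<open>N\<close>
  need not be dense near \<open>r\<close>, but an element of \<open>N\<close> different from \<open>r\<close> is separated from \<open>r\<close> by another
  element of \<open>N\<close>.\<close>

lemma algebraic_positive_lower_bound:
  assumes N: "is_subfield N" "N \<subseteq> E" and r: "r \<in> E" and p: "p \<in> poly_over N" "p \<noteq> 0" "poly p r = 0"
    and u: "u \<in> (\<lambda>g. poly g r) ` poly_over N" "pos u"
  obtains e where "e \<in> N" "pos e" "pos (u - e)"
proof -
  note R = subfield_subring[OF N(1)]
  obtain f where f: "min_poly_over N r f" using min_poly_over_exists p by blast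
  have "inverse u \<in> (\<lambda>g. poly g r) ` poly_over N"
    by (rule subfield_inverse[OF is_subfield_simple_extension[OF N(1) f] u(1)])
  then obtain g where g: "g \<in> poly_over N" "inverse u = poly g r" by auto
  obtain B1 where B1: "B1 \<in> N" "pos (B1 - r)" using algebraic_bound[OF N r p] .
  have "- r \<in> E" using r by (rule closed(5))
  moreover have "pcompose p [:0, -1:] \<in> poly_over N" "pcompose p [:0, -1:] \<noteq> 0"
    "poly (pcompose p [:0, -1:]) (- r) = 0"
    using p poly_over_reflect[OF R] by (auto simp: poly_pcompose pcompose_eq_0_iff)
  ultimately obtain B2 where B2: "B2 \<in> N" "pos (B2 - (- r))" using algebraic_bound[OF N] by blast
  obtain B where B: "B \<in> N" "nonneg (B - B1)" "nonneg (B - B2)" using upper_bound_of_two[OF B1(1) B2(1) N(2)] .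
  have "pos (B - r)" "pos (B + r)" using pos_add_nonneg[OF B1(2) B(2)] pos_add_nonneg[OF B2(2) B(3)]
    by (simp_all add: algebra_simps)
  then obtain C where C: "C \<in> N" "pos (C - inverse u)"
    using bounded_simple_extension[OF R N(2) B(1) _ _ g(1)] g(2) by auto
  have u0: "u \<noteq> 0" using u(2) not_pos_zero by auto
  have Cp: "pos C" using pos_add[OF C(2) pos_inverse[OF u(2)]] by simp
  hence C0: "C \<noteq> 0" using not_pos_zero by auto
  have "u - inverse C = (C - inverse u) * (u * inverse C)" using u0 C0 by (simp add: field_simps)
  moreover have "pos ((C - inverse u) * (u * inverse C))" by (intro pos_mult C(2) u(2) pos_inverse Cp)
  ultimately show ?thesis using that[of "inverse C"] C(1) Cp pos_inverse subfield_inverse[OF N(1)] by auto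
qed

text \<open>The elements of \<open>Z\<close> below \<open>r\<close> are passed one after the other; for the next one, \<open>z\<close>, a positive
  \<open>e \<in> N\<close> below \<open>r - z\<close> gives the element \<open>z + e\<close>.\<close>

lemma isolating_lower:
  assumes N: "is_subfield N" "N \<subseteq> E" and r: "r \<in> E" and p: "p \<in> poly_over N" "p \<noteq> 0" "poly p r = 0"
    and Z: "finite Z" "Z \<subseteq> N"
  shows "\<exists>a\<in>N. pos (r - a) \<and> (\<forall>z\<in>Z. pos (r - z) \<longrightarrow> pos (a - z))"
  using Z
proof (induction)
  case empty
  note R = subfield_subring[OF N(1)]
  have "- r \<in> E" using r by (rule closed(5))
  moreover have "pcompose p [:0, -1:] \<in> poly_over N" "pcompose p [:0, -1:] \<noteq> 0"
    "poly (pcompose p [:0, -1:]) (- r) = 0"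
    using p poly_over_reflect[OF R] by (auto simp: poly_pcompose pcompose_eq_0_iff)
  ultimately obtain B2 where B2: "B2 \<in> N" "pos (B2 - (- r))" using algebraic_bound[OF N] by blast
  thus ?case using subring_uminus[OF R] by (intro bexI[of _ "- B2"]) (auto simp: add.commute)
next
  case (insert z Z)
  then obtain a where a: "a \<in> N" "pos (r - a)" "\<forall>z\<in>Z. pos (r - z) \<longrightarrow> pos (a - z)" by auto
  show ?case
  proof (cases "pos (r - z)")
    case False
    thus ?thesis using a by (intro bexI[of _ a]) auto
  next
    case True
    note R = subfield_subring[OF N(1)]
    have zN: "z \<in> N" using insert.prems by simp
    have "r - z \<in> (\<lambda>g. poly g r) ` poly_over N"
      using zN by (intro image_eqI[of _ _ "[:- z, 1:]"])
        (auto intro!: poly_over_pCons poly_over_0 subring_uminus subring_one R)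
    then obtain e where e: "e \<in> N" "pos e" "pos (r - z - e)"
      using algebraic_positive_lower_bound[OF N r p] True by blast
    have ze: "z + e \<in> N" by (intro subring_add R zN e)
    obtain w where w: "w \<in> N" "nonneg (w - a)" "nonneg (w - (z + e))" "w = a \<or> w = z + e"
    proof (cases "nonneg (z + e - a)")
      case True
      thus ?thesis using that[of "z + e"] ze by (simp add: nonneg_iff)
    next
      case False
      hence "nonneg (a - (z + e))"
        using pos_if_not_nonneg_diff[of "z + e" a] ze a(1) N(2) by (auto simp: nonneg_iff)
      thus ?thesis using that[of a] a(1) by (simp add: nonneg_iff)
    qed
    have "pos (r - w)" using w(4) a(2) e(3) by (auto simp: diff_diff_eq)
    moreover have "pos (w - z)" using pos_add_nonneg[OF e(2) w(3)] by (simp add: algebra_simps)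
    moreover have "pos (w - y)" if "y \<in> Z" "pos (r - y)" for y
      using pos_add_nonneg[of "a - y", OF _ w(2)] a(3) that by auto
    ultimately show ?thesis using w(1) by (intro bexI[of _ w]) auto
  qed
qed

lemma isolating_upper:
  assumes N: "is_subfield N" "N \<subseteq> E" and r: "r \<in> E" and p: "p \<in> poly_over N" "p \<noteq> 0" "poly p r = 0"
    and Z: "finite Z" "Z \<subseteq> N"
  shows "\<exists>b\<in>N. pos (b - r) \<and> (\<forall>z\<in>Z. pos (z - r) \<longrightarrow> pos (z - b))"
proof -
  note R = subfield_subring[OF N(1)]
  have "pcompose p [:0, -1:] \<in> poly_over N" "pcompose p [:0, -1:] \<noteq> 0"
    "poly (pcompose p [:0, -1:]) (- r) = 0"
    using p poly_over_reflect[OF R] by (auto simp: poly_pcompose pcompose_eq_0_iff)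
  moreover have "finite (uminus ` Z)" "uminus ` Z \<subseteq> N" using Z subring_uminus[OF R] by auto
  ultimately obtain a where a: "a \<in> N" "pos (- r - a)" "\<forall>z\<in>uminus ` Z. pos (- r - z) \<longrightarrow> pos (a - z)"
    using isolating_lower[OF N closed(5)[OF r]] by blast
  have "- r - a = - a - r" by simp
  with a have "pos (- a - r)" "\<forall>z\<in>Z. pos (z - r) \<longrightarrow> pos (z - - a)"
    by (auto simp: add.commute)
  thus ?thesis using subring_uminus[OF R a(1)] by blast
qed

text \<open>The midpoint of the greatest element of \<open>Z\<close> below \<open>r\<close> and the least one above \<open>r\<close>.\<close>

lemma same_cut_point:
  assumes N: "is_subfield N" "N \<subseteq> E" and r: "r \<in> E" "r \<notin> N" and Z: "finite Z" "Z \<subseteq> N"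
  obtains q where "q \<in> N" "\<And>z. z \<in> Z \<Longrightarrow> q \<noteq> z" "\<And>z. z \<in> Z \<Longrightarrow> pos (r - z) \<longleftrightarrow> pos (q - z)"
proof -
  note R = subfield_subring[OF N(1)]
  define L where "L = {z \<in> Z. pos (r - z)}"
  define U where "U = {z \<in> Z. pos (z - r)}"
  have fin: "finite L" "finite U" and sub: "L \<subseteq> E" "U \<subseteq> E" using Z N(2) by (auto simp: L_def U_def)
  have LU: "z \<in> L \<or> z \<in> U" if "z \<in> Z" for z
    using trichotomy[of "r - z"] that r Z N(2) closed(4)[of r z] by (auto simp: L_def U_def)
  have "\<exists>q\<in>N. (\<forall>z\<in>L. pos (q - z)) \<and> (\<forall>z\<in>U. pos (z - q))"
  proof (cases "L = {}"; cases "U = {}")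
    assume "L = {}" "U = {}"
    thus ?thesis using subring_zero[OF R] by (intro bexI[of _ 0]) simp_all
  next
    assume "L \<noteq> {}" "U = {}"
    then obtain l where l: "l \<in> L" "\<forall>x\<in>L. nonneg (l - x)"
      using finite_greatest[OF fin(1) _ sub(1)] by blast
    have "pos (l + 1 - z)" if "z \<in> L" for z
      using pos_add_nonneg[OF pos_one bspec[OF l(2) that]] by (simp add: algebra_simps)
    moreover have "l + 1 \<in> N" using l(1) Z subring_add[OF R _ subring_one[OF R]] by (auto simp: L_def)
    ultimately show ?thesis using \<open>U = {}\<close> by blast
  next
    assume "L = {}" "U \<noteq> {}"
    then obtain l where l: "l \<in> U" "\<forall>x\<in>U. nonneg (x - l)" using finite_least[OF fin(2) _ sub(2)] by blast
    have "pos (z - (l - 1))" if "z \<in> U" for z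
      using pos_add_nonneg[OF pos_one bspec[OF l(2) that]] by (simp add: algebra_simps)
    moreover have "l - 1 \<in> N" using l(1) Z subring_diff[OF R _ subring_one[OF R]] by (auto simp: U_def)
    ultimately show ?thesis using \<open>L = {}\<close> by blast
  next
    assume "L \<noteq> {}" "U \<noteq> {}"
    obtain l where l: "l \<in> L" "\<forall>x\<in>L. nonneg (l - x)" using finite_greatest[OF fin(1) \<open>L \<noteq> {}\<close> sub(1)] by blast
    obtain u where u: "u \<in> U" "\<forall>x\<in>U. nonneg (x - u)" using finite_least[OF fin(2) \<open>U \<noteq> {}\<close> sub(2)] by blast
    define q where "q = (l + u) / 2"
    have two: "2 \<noteq> (0::'a)" using pos_two not_pos_zero by metis
    have "pos (u - l)" using pos_diff_trans[of r l u] l(1) u(1) by (auto simp: L_def U_def)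
    hence h: "pos ((u - l) / 2)" by (rule pos_divide[OF _ pos_two])
    have ql: "q - l = (u - l) / 2" "u - q = (u - l) / 2" using two by (auto simp: q_def field_simps)
    have "pos (q - z)" if "z \<in> L" for z
      using pos_add_nonneg[OF h bspec[OF l(2) that]] unfolding ql(1)[symmetric] by simp
    moreover have "pos (z - q)" if "z \<in> U" for z
      using pos_add_nonneg[OF h bspec[OF u(2) that]] unfolding ql(2)[symmetric] by (simp add: algebra_simps)
    moreover have "q \<in> N" unfolding q_def using l(1) u(1) Z subring_of_nat[OF R, of 2]
      by (auto simp: L_def U_def intro!: subfield_divide[OF N(1)] subring_add[OF R])
    ultimately show ?thesis by blast
  qed
  then obtain q where q: "q \<in> N" "\<forall>z\<in>L. pos (q - z)" "\<forall>z\<in>U. pos (z - q)" by blast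
  have Un: "\<not> pos (r - z)" if "z \<in> U" for z using that not_pos_both[of "z - r"] by (auto simp: U_def)
  have qn: "\<not> pos (q - z)" if "z \<in> U" for z using that q(3) not_pos_both[of "z - q"] by auto
  show ?thesis
  proof (rule that[OF q(1)])
    fix z assume z: "z \<in> Z"
    show "q \<noteq> z" using LU[OF z] q(2,3) not_pos_zero by auto
    show "pos (r - z) \<longleftrightarrow> pos (q - z)" using LU[OF z] q(2) Un qn by (auto simp: L_def)
  qed
qed

end

context real_closed_subfield
begin

lemma no_root_same_sign:
  assumes "p \<in> poly_over E" "a \<in> E" "b \<in> E" "poly p a \<noteq> 0" "poly p b \<noteq> 0"
    and no_root: "\<And>c. c \<in> E \<Longrightarrow> pos (c - a) \<and> pos (b - c) \<or> pos (c - b) \<and> pos (a - c) \<Longrightarrow> poly p c \<noteq> 0"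
  shows "pos (poly p a * poly p b)"
proof (rule ccontr)
  assume "\<not> pos (poly p a * poly p b)"
  moreover have ab: "poly p a * poly p b \<in> E" "poly p a \<in> E" "poly p b \<in> E"
    using assms by (auto intro!: closed(6) poly_in_subring subring)
  ultimately have neg: "pos (- (poly p a * poly p b))" using trichotomy[of "poly p a * poly p b"] assms(4,5) by auto
  have mem: "c \<in> E" if "pos (c - x)" "x \<in> E" for c x
    using pos_mem[OF that(1)] that(2) closed(3)[of "c - x" x] by auto
  have "a \<noteq> b" using neg not_pos_both[OF pos_square] assms(4) ab by auto
  hence "pos (b - a) \<or> pos (a - b)" using trichotomy[of "b - a"] assms(2,3) closed(4) by auto
  thus False
  proof
    assume "pos (b - a)"
    thus False using intermediate_value[OF assms(1,2,3) _ neg] no_root mem assms(2) by blast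
  next
    assume "pos (a - b)"
    thus False using intermediate_value[OF assms(1,3,2)] neg no_root mem assms(3) by (metis mult.commute)
  qed
qed

text \<open>Write \<open>h = (x - c) * k\<close>; then \<open>k(c) = h'(c) > 0\<close>.  If \<open>h(b)\<close> were not positive, \<open>k\<close> would have a first
  root \<open>e\<close> right of \<open>c\<close>.  Write \<open>k = (x - e) * l\<close>.  From \<open>h'(e) > 0\<close> follows \<open>l(e) > 0\<close>, and \<open>k(c) > 0\<close>
  means \<open>l(c) < 0\<close>; so \<open>l\<close>, and with it \<open>k\<close>, has a root before \<open>e\<close>.\<close>

lemma pos_right_of_root:
  assumes h: "h \<in> poly_over E" and cb: "c \<in> E" "b \<in> E" "pos (b - c)" and root: "poly h c = 0"
    and deriv: "\<And>x. nonneg (x - c) \<Longrightarrow> nonneg (b - x) \<Longrightarrow> pos (poly (pderiv h) x)"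
  shows "pos (poly h b)"
proof (rule ccontr)
  assume neg: "\<not> pos (poly h b)"
  obtain k where k: "k \<in> poly_over E" "h = [:- c, 1:] * k"
    using poly_over_root_factor[OF subfield h cb(1) root] .
  have mem: "x \<in> E" if "pos (x - c)" for x
    using pos_mem[OF that] cb(1) closed(3)[of "x - c" c] by auto
  note pE = poly_in_subring[OF subring]
  have dh: "poly (pderiv h) x = poly k x + (x - c) * poly (pderiv k) x" for x
    unfolding k(2) pderiv_mult by (simp add: pderiv_pCons algebra_simps)
  have kc: "pos (poly k c)" using deriv[of c] dh[of c] cb(3) by (simp add: nonneg_iff)
  have "poly h b = (b - c) * poly k b" by (simp add: k(2) algebra_simps)
  hence kb: "\<not> pos (poly k b)" using neg pos_mult[OF cb(3)] by metis
  define Z where "Z = {x. pos (x - c) \<and> nonneg (b - x) \<and> poly k x = 0}"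
  have "k \<noteq> 0" using kc not_pos_zero by auto
  hence finZ: "finite Z" using poly_roots_finite[of k] by (auto simp: Z_def intro: finite_subset)
  have "Z \<noteq> {}"
  proof (cases "poly k b = 0")
    case True
    hence "b \<in> Z" using cb(3) by (simp add: Z_def nonneg_iff)
    thus ?thesis by auto
  next
    case False
    hence "pos (- poly k b)" using kb trichotomy[of "poly k b"] pE[OF k(1) cb(2)] by auto
    from pos_mult[OF kc this] have "pos (- (poly k c * poly k b))" by simp
    then obtain x where "pos (x - c)" "pos (b - x)" "poly k x = 0"
      using intermediate_value[OF k(1) cb] by blast
    hence "x \<in> Z" by (simp add: Z_def nonneg_iff)
    thus ?thesis by auto
  qed
  moreover have "Z \<subseteq> E" using mem by (auto simp: Z_def)
  ultimately obtain e where e: "e \<in> Z" "\<forall>x\<in>Z. nonneg (x - e)" using finite_least[OF finZ] by blast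
  have eE: "e \<in> E" and ec: "pos (e - c)" and be: "nonneg (b - e)" and ke: "poly k e = 0"
    using e(1) mem by (auto simp: Z_def)
  obtain l where l: "l \<in> poly_over E" "k = [:- e, 1:] * l"
    using poly_over_root_factor[OF subfield k(1) eE ke] .
  have dk: "poly (pderiv k) x = poly l x + (x - e) * poly (pderiv l) x" for x
    unfolding l(2) pderiv_mult by (simp add: pderiv_pCons algebra_simps)
  have "pos (poly (pderiv h) e)" using deriv[of e] ec be by (simp add: nonneg_iff)
  hence "pos ((e - c) * poly l e)" by (simp add: dh ke dk)
  hence le: "pos (poly l e)" using pos_mult_cancel ec by blast
  have "poly k c = (e - c) * (- poly l c)" by (simp add: l(2) algebra_simps)
  hence "pos (- poly l c)" using kc ec pos_mult_cancel by metis
  from pos_mult[OF this le] have "pos (- (poly l c * poly l e))" by simp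
  then obtain d where d: "pos (d - c)" "pos (e - d)" "poly l d = 0"
    using intermediate_value[OF l(1) cb(1) eE ec] by blast
  have "nonneg (b - d)" using nonneg_add[of "e - d" "b - e"] d(2) be by (simp add: nonneg_iff)
  hence "d \<in> Z" using d by (simp add: Z_def l(2))
  hence "nonneg (d - e)" using e(2) by blast
  thus False using d(2) not_pos_both[of "e - d"] not_pos_zero by (auto simp: nonneg_iff)
qed

lemma strictly_increasing:
  assumes p: "p \<in> poly_over E" and ab: "a \<in> E" "b \<in> E" "pos (b - a)"
    and deriv: "\<And>x. nonneg (x - a) \<Longrightarrow> nonneg (b - x) \<Longrightarrow> pos (poly (pderiv p) x)"
  shows "pos (poly p b - poly p a)"
proof -
  have "p - [:poly p a:] \<in> poly_over E"
    by (intro poly_over_closed subring p poly_in_subring ab)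
  moreover have "pderiv (p - [:poly p a:]) = pderiv p" by (simp add: pderiv_diff pderiv_pCons)
  ultimately have "pos (poly (p - [:poly p a:]) b)"
    using pos_right_of_root[of "p - [:poly p a:]" a b] ab deriv by auto
  thus ?thesis by simp
qed

text \<open>If the derivative has constant sign, then \<open>g\<close> is monotone and its values lie between those at
  the ends.  Thus the finitely many signs of the derivatives at two points certify the absence of
  roots in between, in any real closed field that contains the coefficients and the two points.\<close>

lemma same_sign_if_derivatives:
  assumes ab: "a \<in> E" "b \<in> E" "pos (b - a)"
  shows "g \<in> poly_over E \<Longrightarrow> g \<noteq> 0 \<Longrightarrow>
    (\<And>k. (pderiv ^^ k) g \<noteq> 0 \<Longrightarrow> pos (poly ((pderiv ^^ k) g) a * poly ((pderiv ^^ k) g) b)) \<Longrightarrow>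
    nonneg (x - a) \<Longrightarrow> nonneg (b - x) \<Longrightarrow> pos (poly g a * poly g x)"
proof (induction "degree g" arbitrary: g x rule: less_induct)
  case less
  note pE = poly_in_subring[OF subring]
  have mem: "x \<in> E" if "nonneg (x - a)" for x
    using nonneg_mem[OF that] ab(1) closed(3)[of "x - a" a] by auto
  show ?case
  proof (cases "degree g = 0")
    case True
    then obtain c where "g = [:c:]" using degree_eq_zeroE by blast
    thus ?thesis using less.prems(1,2) pos_square[of c] by (auto dest: coeff_poly_over[of _ _ 0])
  next
    case False
    have dE: "pderiv g \<in> poly_over E" by (rule poly_over_pderiv[OF subring less.prems(1)])
    have d: "pos (poly (pderiv g) a * poly (pderiv g) y)" if "nonneg (y - a)" "nonneg (b - y)" for y
    proof (rule less.hyps)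
      show "degree (pderiv g) < degree g" "pderiv g \<noteq> 0"
        using False degree_pderiv_less pderiv_nonzero less.prems(1) by auto
      show "pos (poly ((pderiv ^^ k) (pderiv g)) a * poly ((pderiv ^^ k) (pderiv g)) b)"
        if "(pderiv ^^ k) (pderiv g) \<noteq> 0" for k
        using less.prems(3)[of "Suc k"] that by (simp add: funpow_swap1)
    qed (use that dE in auto)
    have inc: "pos (poly g a * poly g y)"
      if g: "g \<in> poly_over E" "pos (poly g a * poly g b)" "\<And>x. nonneg (x - a) \<Longrightarrow> nonneg (b - x) \<Longrightarrow> pos (poly (pderiv g) x)"
        and y: "nonneg (y - a)" "nonneg (b - y)" for g y
    proof -
      consider "y = a" | "y = b" | "pos (y - a)" "pos (b - y)" using y by (auto simp: nonneg_iff)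
      thus ?thesis
      proof cases
        case 3
        have yE: "y \<in> E" using mem y by blast
        have 1: "pos (poly g y - poly g a)"
        proof (rule strictly_increasing[OF g(1) ab(1) yE 3(1)])
          fix x assume "nonneg (x - a)" "nonneg (y - x)"
          thus "pos (poly (pderiv g) x)" using g(3) nonneg_add[of "y - x" "b - y"] y(2) by simp
        qed
        have 2: "pos (poly g b - poly g y)"
        proof (rule strictly_increasing[OF g(1) yE ab(2) 3(2)])
          fix x assume "nonneg (x - y)" "nonneg (b - x)"
          thus "pos (poly (pderiv g) x)" using g(3) nonneg_add[of "x - y" "y - a"] y(1) by simp
        qed
        have "poly g a \<noteq> 0" using g(2) not_pos_zero by auto
        hence "pos (poly g a) \<or> pos (- poly g a)" using pos_or_neg_cases pE g(1) ab(1) by blast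
        thus ?thesis
        proof
          assume A: "pos (poly g a)"
          thus ?thesis using pos_mult[OF A] pos_add[OF 1 A] by simp
        next
          assume A: "pos (- poly g a)"
          have "pos (- poly g b)" using g(2) pos_mult_cancel[OF _ A, of "- poly g b"] by simp
          from pos_mult[OF A pos_add[OF 2 this]] show ?thesis by simp
        qed
      next
        case 1
        have "poly g a \<noteq> 0" using g(2) not_pos_zero by auto
        thus ?thesis unfolding 1 by (intro pos_square pE[OF g(1) ab(1)])
      next
        case 2
        thus ?thesis using g(2) by simp
      qed
    qed
    have gab: "pos (poly g a * poly g b)" using less.prems(3)[of 0] less.prems(2) by simp
    have da: "poly (pderiv g) a \<in> E" "poly (pderiv g) a \<noteq> 0"
      using pE[OF dE ab(1)] d[of a] ab(3) not_pos_zero by (auto simp: nonneg_iff)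
    hence "pos (poly (pderiv g) a) \<or> pos (- poly (pderiv g) a)" by (rule pos_or_neg_cases)
    thus ?thesis
    proof
      assume A: "pos (poly (pderiv g) a)"
      show ?thesis by (rule inc[OF less.prems(1) gab pos_mult_cancel[OF d A] less.prems(4,5)])
    next
      assume A: "pos (- poly (pderiv g) a)"
      have "pos (poly (pderiv (- g)) y)" if "nonneg (y - a)" "nonneg (b - y)" for y
        using pos_mult_cancel[OF _ A, of "- poly (pderiv g) y"] d[OF that] by (simp add: pderiv_minus)
      moreover have "pos (poly (- g) a * poly (- g) b)" using gab by simp
      ultimately have "pos (poly (- g) a * poly (- g) x)"
        using inc[OF poly_over_uminus[OF subring less.prems(1)] _ _ less.prems(4,5)] by blast
      thus ?thesis by simp
    qed
  qed
qed

text \<open>A monic polynomial of odd degree is positive far to the right and negative far to the left.\<close>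

lemma odd_degree_root:
  assumes p: "p \<in> poly_over E" "odd (degree p)"
  shows "\<exists>x\<in>E. poly p x = 0"
proof -
  define q where "q = smult (inverse (lead_coeff p)) p"
  have p0: "p \<noteq> 0" using p(2) by auto
  have q: "q \<in> poly_over E" "lead_coeff q = 1" "degree q = degree p"
    using p p0 by (auto simp: q_def intro!: poly_over_smult subring closed coeff_poly_over)
  define q' where "q' = - pcompose q [:0, - 1:]"
  have q': "q' \<in> poly_over E" unfolding q'_def
    by (intro poly_over_uminus poly_over_pcompose subring q poly_over_closed closed)
  have dq': "degree q' = degree q" by (simp add: q'_def degree_pcompose)
  have "lead_coeff (pcompose q [:0, - 1:]) = lead_coeff q * (- 1) ^ degree q"
    by (subst lead_coeff_comp) auto
  hence lq': "lead_coeff q' = 1" using q(2,3) p(2) by (simp add: q'_def)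
  have dp: "degree p > 0" using p(2) by (auto intro: Nat.gr0I)
  obtain B1 where B1: "B1 \<in> E" "\<forall>x. nonneg (x - B1) \<longrightarrow> pos (poly q x - 0)"
    using monic_bound[OF subring order_refl q(1,2) _ closed(1)] q(3) dp by auto
  obtain B2 where B2: "B2 \<in> E" "\<forall>x. nonneg (x - B2) \<longrightarrow> pos (poly q' x - 0)"
    using monic_bound[OF subring order_refl q' lq' _ closed(1)] q(3) dp dq' by auto
  obtain w0 where w0: "w0 \<in> E" "nonneg (w0 - B1)" "nonneg (w0 - B2)"
    using upper_bound_of_two[OF B1(1) B2(1) order_refl] .
  obtain w where w: "w \<in> E" "nonneg (w - w0)" "nonneg (w - 1)"
    using upper_bound_of_two[OF w0(1) closed(2) order_refl] .
  have "pos (poly q w)" using B1(2) nonneg_add[OF w(2) w0(2)] by simp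
  have "pos (- poly q (- w))" using B2(2) nonneg_add[OF w(2) w0(3)]
    by (simp add: q'_def poly_pcompose)
  from pos_mult[OF this \<open>pos (poly q w)\<close>] have neg: "pos (- (poly q (- w) * poly q w))" by simp
  have "pos w" using pos_add_nonneg[OF pos_one w(3)] by simp
  from pos_add[OF this this] have "pos (w - (- w))" by simp
  then obtain c where c: "pos (c - (- w))" "poly q c = 0"
    using intermediate_value[OF q(1) closed(5)[OF w(1)] w(1) _ neg] by blast
  have "c \<in> E" using pos_mem[OF c(1)] w(1) closed(4)[of "c - - w" w] by auto
  thus ?thesis using c(2) p0 by (auto simp: q_def)
qed

end

section \<open>Homomorphisms with a prescribed kernel\<close>

text \<open>The values outside \<open>S\<close> are arbitrary.\<close>

definition hom_on :: "'a::comm_ring_1 set \<Rightarrow> ('a \<Rightarrow> 'b::comm_ring_1) \<Rightarrow> bool" where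
  "hom_on S f \<longleftrightarrow> f 1 = 1 \<and> (\<forall>x\<in>S. \<forall>y\<in>S. f (x - y) = f x - f y \<and> f (x * y) = f x * f y)"

context
  fixes S :: "'a::comm_ring_1 set" and f :: "'a \<Rightarrow> 'b::comm_ring_1"
  assumes S: "is_subring S" and f: "hom_on S f"
begin

lemma hom_on_one: "f 1 = 1"
  and hom_on_diff: "x \<in> S \<Longrightarrow> y \<in> S \<Longrightarrow> f (x - y) = f x - f y"
  and hom_on_mult: "x \<in> S \<Longrightarrow> y \<in> S \<Longrightarrow> f (x * y) = f x * f y"
  using f by (auto simp: hom_on_def)

lemma hom_on_zero: "f 0 = 0"
  using hom_on_diff[of 1 1] subring_one[OF S] by simp

lemma hom_on_uminus: "x \<in> S \<Longrightarrow> f (- x) = - f x"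
  using hom_on_diff[of 0 x] subring_zero[OF S] hom_on_zero by simp

lemma hom_on_add: "x \<in> S \<Longrightarrow> y \<in> S \<Longrightarrow> f (x + y) = f x + f y"
  using hom_on_diff[of x "- y"] subring_uminus[OF S] hom_on_uminus[of y] by simp

lemma hom_on_power: "x \<in> S \<Longrightarrow> f (x ^ n) = f x ^ n"
  by (induction n) (auto simp: hom_on_one hom_on_mult subring_power[OF S])

lemma hom_on_sum: "(\<And>i. i \<in> I \<Longrightarrow> g i \<in> S) \<Longrightarrow> f (sum g I) = (\<Sum>i\<in>I. f (g i))"
  by (induction I rule: infinite_finite_induct) (auto simp: hom_on_zero hom_on_add subring_sum[OF S])

lemma hom_on_prod: "(\<And>i. i \<in> I \<Longrightarrow> g i \<in> S) \<Longrightarrow> f (prod g I) = (\<Prod>i\<in>I. f (g i))"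
  by (induction I rule: infinite_finite_induct) (auto simp: hom_on_one hom_on_mult subring_prod[OF S])

lemma coeff_map_hom: "coeff (map_poly f p) i = f (coeff p i)"
  by (simp add: coeff_map_poly hom_on_zero)

lemma map_poly_hom_diff: "p \<in> poly_over S \<Longrightarrow> q \<in> poly_over S \<Longrightarrow> map_poly f (p - q) = map_poly f p - map_poly f q"
  by (rule poly_eqI) (simp add: coeff_map_hom hom_on_diff coeff_poly_over)

lemma map_poly_hom_add: "p \<in> poly_over S \<Longrightarrow> q \<in> poly_over S \<Longrightarrow> map_poly f (p + q) = map_poly f p + map_poly f q"
  by (rule poly_eqI) (simp add: coeff_map_hom hom_on_add coeff_poly_over)

lemma map_poly_hom_mult: "p \<in> poly_over S \<Longrightarrow> q \<in> poly_over S \<Longrightarrow> map_poly f (p * q) = map_poly f p * map_poly f q"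
  by (rule poly_eqI)
    (simp add: coeff_map_hom coeff_mult hom_on_sum hom_on_mult coeff_poly_over subring_mult[OF S])

lemma map_poly_hom_smult: "c \<in> S \<Longrightarrow> p \<in> poly_over S \<Longrightarrow> map_poly f (smult c p) = smult (f c) (map_poly f p)"
  by (rule poly_eqI) (simp add: coeff_map_hom hom_on_mult coeff_poly_over)

lemma map_poly_hom_one: "map_poly f 1 = 1"
  by (simp add: hom_on_one)

lemma map_poly_hom_const: "map_poly f [:c:] = [:f c:]"
  by (rule poly_eqI) (simp add: coeff_map_hom coeff_pCons hom_on_zero split: nat.split)

lemma hom_on_map_poly: "hom_on (poly_over S) (map_poly f)"
  by (simp add: hom_on_def map_poly_hom_one map_poly_hom_diff map_poly_hom_mult)

lemma hom_on_poly: "p \<in> poly_over S \<Longrightarrow> x \<in> S \<Longrightarrow> f (poly p x) = poly (map_poly f p) (f x)"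
proof (induction p)
  case (pCons a p)
  have "a \<in> S" "p \<in> poly_over S"
    using pCons.prems by (auto simp: poly_over_def coeff_pCons split: nat.splits)
  thus ?case using pCons.prems(2) pCons.IH pCons.hyps
    by (simp add: hom_on_add hom_on_mult poly_in_subring[OF S] subring_mult[OF S] map_poly_pCons hom_on_zero)
qed (simp add: hom_on_zero)

lemma map_poly_hom_over: "p \<in> poly_over S \<Longrightarrow> (\<And>x. x \<in> S \<Longrightarrow> f x \<in> S') \<Longrightarrow> map_poly f p \<in> poly_over S'"
  by (auto simp: poly_over_def coeff_map_hom)

lemma is_subring_hom_image: "is_subring (f ` S)"
  unfolding is_subring_def
proof (intro conjI ballI)
  show "1 \<in> f ` S" using subring_one[OF S] by (intro image_eqI[of _ _ 1]) (simp_all add: hom_on_one)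
  fix x y assume "x \<in> f ` S" "y \<in> f ` S"
  then obtain a b where "x = f a" "y = f b" "a \<in> S" "b \<in> S" by auto
  thus "x - y \<in> f ` S" "x * y \<in> f ` S"
    using subring_diff[OF S] subring_mult[OF S] hom_on_diff[symmetric] hom_on_mult[symmetric] by auto
qed

end

lemma hom_on_subset: "hom_on S f \<Longrightarrow> S' \<subseteq> S \<Longrightarrow> hom_on S' f"
  by (auto simp: hom_on_def)

locale prime_ideal_in =
  fixes B p :: "'a::comm_ring_1 set"
  assumes B: "is_subring B" and subset: "p \<subseteq> B" and zero: "0 \<in> p" and one: "1 \<notin> p"
    and diff: "x \<in> p \<Longrightarrow> y \<in> p \<Longrightarrow> x - y \<in> p"
    and mult: "x \<in> B \<Longrightarrow> y \<in> p \<Longrightarrow> x * y \<in> p"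
    and prime: "x \<in> B \<Longrightarrow> y \<in> B \<Longrightarrow> x * y \<in> p \<Longrightarrow> x \<in> p \<or> y \<in> p"
begin

lemma add: "x \<in> p \<Longrightarrow> y \<in> p \<Longrightarrow> x + y \<in> p"
  using diff[of x "- y"] diff[of 0 y] zero by simp

lemma sum: "(\<And>i. i \<in> I \<Longrightarrow> f i \<in> p) \<Longrightarrow> sum f I \<in> p"
  by (induction I rule: infinite_finite_induct) (auto simp: zero intro: add)

lemma power: "x \<in> B \<Longrightarrow> x ^ n \<in> p \<Longrightarrow> x \<in> p"
proof (induction n)
  case (Suc n)
  thus ?case using prime[of x "x ^ n"] subring_power[OF B] by auto
qed (simp add: one)

lemma poly_in_ideal: "q \<in> poly_over p \<Longrightarrow> a \<in> B \<Longrightarrow> poly q a \<in> p"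
  unfolding poly_altdef
  using mult[OF subring_power[OF B]] by (intro sum) (simp add: poly_over_def mult.commute)

lemma diff_iff: "x - y \<in> p \<Longrightarrow> x \<in> p \<longleftrightarrow> y \<in> p"
  using add[of "x - y" y] diff[of x "x - y"] by auto

text \<open>Among the polynomials over \<open>C\<close> that do not vanish modulo \<open>p\<close> but take a value in \<open>p\<close> at \<open>a\<close>, let \<open>g\<close> have
  least degree modulo \<open>p\<close>, and send \<open>a\<close> to a root \<open>\<omega>\<close> of the image of \<open>g\<close>.  Pseudo-division by \<open>g\<close> shows
  that the image of \<open>Q\<close> vanishes at \<open>\<omega>\<close> if \<open>Q(a) \<in> p\<close>.  For the converse one divides by a polynomial
  \<open>h\<close> of least degree whose image vanishes at \<open>\<omega>\<close>: as \<open>h\<close> divides \<open>g\<close> modulo \<open>p\<close>, and \<open>p\<close> is prime,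
  minimality of \<open>g\<close> yields \<open>h(a) \<in> p\<close>.\<close>

lemma extend_partial_hom:
  fixes f :: "'a \<Rightarrow> 'w::alg_closed_field"
  assumes C: "is_subring C" "C \<subseteq> B" and f: "hom_on C f" and ker: "\<And>x. x \<in> C \<Longrightarrow> f x = 0 \<longleftrightarrow> x \<in> p"
    and a: "a \<in> B" and P: "P \<in> poly_over C" "map_poly f P \<noteq> 0" "poly P a \<in> p"
  obtains C' f' where "is_subring C'" "C \<subseteq> C'" "a \<in> C'" "C' \<subseteq> B" "hom_on C' f'"
    "\<And>x. x \<in> C \<Longrightarrow> f' x = f x" "\<And>x. x \<in> C' \<Longrightarrow> f' x = 0 \<longleftrightarrow> x \<in> p"
proof -
  note CB = poly_over_mono[OF C(2)]
  note hom = map_poly_hom_diff[OF C(1) f] map_poly_hom_add[OF C(1) f] map_poly_hom_mult[OF C(1) f]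
    map_poly_hom_smult[OF C(1) f]
  have map_eq: "smult (f d) (map_poly f Q) = map_poly f q * map_poly f g + map_poly f r"
    if "smult d Q = q * g + r" "d \<in> C" "Q \<in> poly_over C" "q \<in> poly_over C" "g \<in> poly_over C" "r \<in> poly_over C"
    for d Q q g r
  proof -
    have "map_poly f (smult d Q) = map_poly f (q * g + r)" by (simp only: that(1))
    thus ?thesis by (simp only: hom that(2-) poly_over_mult[OF C(1) that(4,5)])
  qed
  have polyB: "poly Q a \<in> B" if "Q \<in> poly_over C" for Q
    using poly_in_subring[OF B _ a] CB that by blast
  have zero_map: "poly Q a \<in> p" if "Q \<in> poly_over C" "map_poly f Q = 0" for Q
  proof -
    have "coeff Q i \<in> p" for i
      using that ker[OF coeff_poly_over[OF that(1)], of i] coeff_map_hom[OF C(1) f, of Q i] by simp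
    thus ?thesis using poly_in_ideal[OF _ a] by (simp add: poly_over_def)
  qed
  \<comment> \<open>The coefficients above the degree of the image lie in \<open>p\<close>; cutting them off makes the
    leading coefficient a nonzero divisor.\<close>
  have cut: "\<exists>Q'\<in>poly_over C. map_poly f Q' = map_poly f Q \<and> degree Q' = degree (map_poly f Q)"
    if "Q \<in> poly_over C" for Q
  proof -
    define Q' where "Q' = poly_cutoff (Suc (degree (map_poly f Q))) Q"
    have cf: "coeff Q' i = (if i \<le> degree (map_poly f Q) then coeff Q i else 0)" for i
      by (simp add: Q'_def coeff_poly_cutoff)
    have "Q' \<in> poly_over C" using that subring_zero[OF C(1)] by (auto simp: poly_over_def cf)
    moreover have eq: "map_poly f Q' = map_poly f Q"
      by (rule poly_eqI) (simp add: coeff_map_hom[OF C(1) f] cf hom_on_zero[OF C(1) f],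
          metis coeff_map_hom[OF C(1) f] coeff_eq_0 not_le)
    moreover have "degree Q' \<le> degree (map_poly f Q)" by (rule degree_le) (simp add: cf)
    moreover have "degree (map_poly f Q') \<le> degree Q'" by (rule map_poly_degree_leq)
    ultimately show ?thesis by (intro bexI[of _ Q']) auto
  qed
  have choose_min: "\<exists>g. g \<in> poly_over C \<and> map_poly f g \<noteq> 0 \<and> R g \<and> degree g = degree (map_poly f g) \<and>
      (\<forall>Q\<in>poly_over C. map_poly f Q \<noteq> 0 \<longrightarrow> R Q \<longrightarrow> degree g \<le> degree (map_poly f Q))"
    if ex: "Q0 \<in> poly_over C" "map_poly f Q0 \<noteq> 0" "R Q0"
      and R: "\<And>Q Q'. Q \<in> poly_over C \<Longrightarrow> Q' \<in> poly_over C \<Longrightarrow> map_poly f Q' = map_poly f Q \<Longrightarrow> R Q \<Longrightarrow> R Q'" for R Q0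
  proof -
    let ?P = "\<lambda>Q. Q \<in> poly_over C \<and> map_poly f Q \<noteq> 0 \<and> R Q"
    let ?g = "arg_min (\<lambda>Q. degree (map_poly f Q)) ?P"
    have g: "?P ?g" "\<And>Q. ?P Q \<Longrightarrow> degree (map_poly f ?g) \<le> degree (map_poly f Q)"
      using arg_min_nat_lemma[of ?P Q0 "\<lambda>Q. degree (map_poly f Q)"] ex by auto
    obtain g' where g': "g' \<in> poly_over C" "map_poly f g' = map_poly f ?g" "degree g' = degree (map_poly f ?g)"
      using cut g(1) by blast
    have "R g'" using R[of ?g g'] g(1) g' by blast
    thus ?thesis using g g' by (intro exI[of _ g']) auto
  qed
  have divide: "\<exists>c k q r. c \<in> C \<and> c \<notin> p \<and> q \<in> poly_over C \<and> r \<in> poly_over C \<and>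
      smult (c ^ k) Q = q * g + r \<and> (map_poly f r = 0 \<or> degree (map_poly f r) < degree g)"
    if g: "g \<in> poly_over C" "map_poly f g \<noteq> 0" "degree g = degree (map_poly f g)" and Q: "Q \<in> poly_over C" for g Q
  proof -
    have "g \<noteq> 0" using g(2) by auto
    then obtain k q r where kqr: "q \<in> poly_over C" "r \<in> poly_over C"
      "smult (lead_coeff g ^ k) Q = q * g + r" "r = 0 \<or> degree r < degree g"
      using poly_over_pseudo_division[OF C(1) g(1) _ Q] by blast
    have lc: "lead_coeff g \<in> C" using coeff_poly_over[OF g(1)] .
    have "f (lead_coeff g) = lead_coeff (map_poly f g)" using g(3) coeff_map_hom[OF C(1) f] by simp
    hence "f (lead_coeff g) \<noteq> 0" using g(2) by simp
    hence "lead_coeff g \<notin> p" using ker[OF lc] by simp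
    moreover have "map_poly f r = 0 \<or> degree (map_poly f r) < degree g"
      using kqr(4) map_poly_degree_leq[of f r] by (auto dest: le_less_trans)
    ultimately show ?thesis using kqr lc by blast
  qed
  have power_notin: "c ^ k \<in> C" "c ^ k \<in> B" "f (c ^ k) \<noteq> 0" "c ^ k \<notin> p" if "c \<in> C" "c \<notin> p" for c k
    using that C subring_power[OF C(1)] ker power by blast+
  obtain g where g: "g \<in> poly_over C" "map_poly f g \<noteq> 0" "poly g a \<in> p" "degree g = degree (map_poly f g)"
    "\<And>Q. Q \<in> poly_over C \<Longrightarrow> map_poly f Q \<noteq> 0 \<Longrightarrow> poly Q a \<in> p \<Longrightarrow> degree g \<le> degree (map_poly f Q)"
  proof -
    have "\<exists>g. g \<in> poly_over C \<and> map_poly f g \<noteq> 0 \<and> poly g a \<in> p \<and> degree g = degree (map_poly f g) \<and>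
      (\<forall>Q\<in>poly_over C. map_poly f Q \<noteq> 0 \<longrightarrow> poly Q a \<in> p \<longrightarrow> degree g \<le> degree (map_poly f Q))"
    proof (rule choose_min[where R = "\<lambda>Q. poly Q a \<in> p", OF P])
      fix Q Q' assume Q: "Q \<in> poly_over C" "Q' \<in> poly_over C" "map_poly f Q' = map_poly f Q" "poly Q a \<in> p"
      hence "poly (Q' - Q) a \<in> p" by (intro zero_map poly_over_diff[OF C(1)]) (simp_all add: hom)
      thus "poly Q' a \<in> p" using diff_iff[of "poly Q' a" "poly Q a"] Q(4) by simp
    qed
    thus ?thesis using that by blast
  qed
  have "degree g > 0"
  proof (rule ccontr)
    assume "\<not> degree g > 0"
    then obtain c where c: "g = [:c:]" using degree_eq_zeroE by blast
    have "c \<in> C" using coeff_poly_over[OF g(1), of 0] c by simp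
    moreover have "c \<in> p" using g(3) c by simp
    ultimately have "f c = 0" using ker by simp
    thus False using g(2) c map_poly_hom_const[OF C(1) f, of c] by simp
  qed
  then obtain \<omega> where \<omega>: "poly (map_poly f g) \<omega> = 0"
    using alg_closed_imp_poly_has_root[of "map_poly f g"] g(4) by auto
  have vanish: "poly (map_poly f Q) \<omega> = 0" if Q: "Q \<in> poly_over C" "poly Q a \<in> p" for Q
  proof -
    obtain c k q r where d: "c \<in> C" "c \<notin> p" "q \<in> poly_over C" "r \<in> poly_over C"
      "smult (c ^ k) Q = q * g + r" "map_poly f r = 0 \<or> degree (map_poly f r) < degree g"
      using divide[OF g(1,2,4) Q(1)] by blast
    have "c ^ k * poly Q a = poly q a * poly g a + poly r a"
      using arg_cong[OF d(5), of "\<lambda>q. poly q a"] by simp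
    hence "poly r a = c ^ k * poly Q a - poly q a * poly g a" by simp
    hence "poly r a \<in> p" using mult power_notin(2)[OF d(1,2)] Q(2) polyB[OF d(3)] g(3) by (auto intro!: diff)
    hence r0: "map_poly f r = 0" using g(5)[OF d(4)] d(6) by fastforce
    have "smult (f (c ^ k)) (map_poly f Q) = map_poly f q * map_poly f g + map_poly f r"
      by (rule map_eq[OF d(5) power_notin(1)[OF d(1,2)] Q(1) d(3) g(1) d(4)])
    from arg_cong[OF this, of "\<lambda>q. poly q \<omega>"] show ?thesis
      using r0 \<omega> power_notin(3)[OF d(1,2), of k] by simp
  qed
  obtain h where h: "h \<in> poly_over C" "map_poly f h \<noteq> 0" "poly (map_poly f h) \<omega> = 0" "degree h = degree (map_poly f h)"
    "\<And>Q. Q \<in> poly_over C \<Longrightarrow> map_poly f Q \<noteq> 0 \<Longrightarrow> poly (map_poly f Q) \<omega> = 0 \<Longrightarrow> degree h \<le> degree (map_poly f Q)"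
  proof -
    have "\<exists>g. g \<in> poly_over C \<and> map_poly f g \<noteq> 0 \<and> poly (map_poly f g) \<omega> = 0 \<and> degree g = degree (map_poly f g) \<and>
      (\<forall>Q\<in>poly_over C. map_poly f Q \<noteq> 0 \<longrightarrow> poly (map_poly f Q) \<omega> = 0 \<longrightarrow> degree g \<le> degree (map_poly f Q))"
      by (rule choose_min[where R = "\<lambda>Q. poly (map_poly f Q) \<omega> = 0", OF g(1,2) \<omega>]) simp
    thus ?thesis using that by blast
  qed
  have remainder: "poly (map_poly f s) \<omega> = 0 \<and> map_poly f s = 0"
    if "Q \<in> poly_over C" "poly (map_poly f Q) \<omega> = 0" "c \<in> C" "c \<notin> p" "q \<in> poly_over C" "s \<in> poly_over C"
      "smult (c ^ k) Q = q * h + s" "map_poly f s = 0 \<or> degree (map_poly f s) < degree h" for Q q s c k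
  proof -
    have "smult (f (c ^ k)) (map_poly f Q) = map_poly f q * map_poly f h + map_poly f s"
      by (rule map_eq[OF that(7) power_notin(1)[OF that(3,4)] that(1,5) h(1) that(6)])
    from arg_cong[OF this, of "\<lambda>q. poly q \<omega>"] have "poly (map_poly f s) \<omega> = 0"
      using h(3) that(2) by simp
    thus ?thesis using h(5)[OF that(6)] that(8) by fastforce
  qed
  have hp: "poly h a \<in> p"
  proof (rule ccontr)
    assume hn: "poly h a \<notin> p"
    obtain c k q s where d: "c \<in> C" "c \<notin> p" "q \<in> poly_over C" "s \<in> poly_over C"
      "smult (c ^ k) g = q * h + s" "map_poly f s = 0 \<or> degree (map_poly f s) < degree h"
      using divide[OF h(1,2,4) g(1)] by blast
    have s0: "map_poly f s = 0" using remainder[OF g(1) \<omega> d] by simp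
    have "c ^ k * poly g a = poly q a * poly h a + poly s a"
      using arg_cong[OF d(5), of "\<lambda>q. poly q a"] by simp
    hence "poly q a * poly h a = c ^ k * poly g a - poly s a" by simp
    hence "poly q a * poly h a \<in> p"
      using mult[OF power_notin(2)[OF d(1,2)] g(3)] zero_map[OF d(4) s0] by (auto intro!: diff)
    hence qp: "poly q a \<in> p" using prime polyB d(3) h(1) hn by blast
    have eq: "smult (f (c ^ k)) (map_poly f g) = map_poly f q * map_poly f h"
      using map_eq[OF d(5) power_notin(1)[OF d(1,2)] g(1) d(3) h(1) d(4)] s0 by simp
    hence q0: "map_poly f q \<noteq> 0" using g(2) power_notin(3)[OF d(1,2), of k] by auto
    have "degree (map_poly f g) = degree (map_poly f q) + degree (map_poly f h)"
      using arg_cong[OF eq, of degree] power_notin(3)[OF d(1,2), of k] q0 h(2) by (simp add: degree_mult_eq)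
    moreover have "degree (map_poly f h) > 0"
    proof (rule ccontr)
      assume "\<not> degree (map_poly f h) > 0"
      then obtain c where "map_poly f h = [:c:]" using degree_eq_zeroE by blast
      thus False using h(2,3) by auto
    qed
    ultimately show False using g(5)[OF d(3) q0 qp] g(4) by simp
  qed
  have vanish_conv: "poly Q a \<in> p" if Q: "Q \<in> poly_over C" "poly (map_poly f Q) \<omega> = 0" for Q
  proof -
    obtain c k q s where d: "c \<in> C" "c \<notin> p" "q \<in> poly_over C" "s \<in> poly_over C"
      "smult (c ^ k) Q = q * h + s" "map_poly f s = 0 \<or> degree (map_poly f s) < degree h"
      using divide[OF h(1,2,4) Q(1)] by blast
    have s0: "map_poly f s = 0" using remainder[OF Q d] by simp
    have "c ^ k * poly Q a = poly q a * poly h a + poly s a"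
      using arg_cong[OF d(5), of "\<lambda>q. poly q a"] by simp
    hence "c ^ k * poly Q a \<in> p"
      using mult[OF polyB[OF d(3)] hp] zero_map[OF d(4) s0] by (auto intro!: add)
    thus ?thesis using prime[OF power_notin(2)[OF d(1,2)] polyB[OF Q(1)]] power_notin(4)[OF d(1,2)] by blast
  qed
  define C' where "C' = (\<lambda>q. poly q a) ` poly_over C"
  define f' where "f' x = poly (map_poly f (SOME Q. Q \<in> poly_over C \<and> x = poly Q a)) \<omega>" for x
  have f'_eq: "f' (poly Q a) = poly (map_poly f Q) \<omega>" if "Q \<in> poly_over C" for Q
  proof -
    define Q' where "Q' = (SOME Q'. Q' \<in> poly_over C \<and> poly Q a = poly Q' a)"
    have Q': "Q' \<in> poly_over C \<and> poly Q a = poly Q' a"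
      unfolding Q'_def by (rule someI[of _ Q]) (use that in auto)
    hence "poly (map_poly f (Q - Q')) \<omega> = 0"
      using that zero by (intro vanish poly_over_diff[OF C(1)]) auto
    thus ?thesis using Q' that unfolding f'_def Q'_def[symmetric] by (simp add: hom)
  qed
  show ?thesis
  proof (rule that[of C' f'])
    show "is_subring C'" unfolding C'_def by (rule is_subring_simple_extension[OF C(1)])
    show "C \<subseteq> C'" unfolding C'_def by (rule subset_simple_extension[OF C(1)])
    show "a \<in> C'" unfolding C'_def by (rule mem_simple_extension[OF C(1)])
    show "C' \<subseteq> B" unfolding C'_def using polyB by auto
    show "f' x = f x" if "x \<in> C" for x
      using f'_eq[of "[:x:]"] that poly_over_pCons[OF C(1)] poly_over_0[OF C(1)]
      by (simp add: map_poly_hom_const[OF C(1) f])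
    show "f' x = 0 \<longleftrightarrow> x \<in> p" if "x \<in> C'" for x
      using that vanish vanish_conv by (auto simp: C'_def f'_eq)
    show "hom_on C' f'"
      unfolding hom_on_def
    proof (intro conjI ballI)
      show "f' 1 = 1" using f'_eq[OF poly_over_1[OF C(1)]] hom_on_one[OF C(1) f] by simp
      fix x y assume "x \<in> C'" "y \<in> C'"
      then obtain Q Q' where Q: "Q \<in> poly_over C" "Q' \<in> poly_over C" "x = poly Q a" "y = poly Q' a"
        by (auto simp: C'_def)
      show "f' (x - y) = f' x - f' y"
        using f'_eq[OF poly_over_diff[OF C(1) Q(1,2)]] Q by (simp add: f'_eq hom)
      show "f' (x * y) = f' x * f' y"
        using f'_eq[OF poly_over_mult[OF C(1) Q(1,2)]] Q by (simp add: f'_eq hom)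
    qed
  qed
qed

text \<open>A maximal subring that meets \<open>p\<close> only in \<open>0\<close> does the service of a transcendence basis of the
  residue field: adjoining any further \<open>a\<close> produces a nonzero element of \<open>p\<close>, which is a
  polynomial relation for \<open>a\<close> modulo \<open>p\<close>.\<close>

lemma maximal_transcendental_subring:
  assumes "is_subring D0" "D0 \<subseteq> B" "D0 \<inter> p = {0}"
  obtains D where "is_subring D" "D \<subseteq> B" "D \<inter> p = {0}"
    "\<And>a. a \<in> B \<Longrightarrow> \<exists>P\<in>poly_over D. P \<noteq> 0 \<and> poly P a \<in> p"
proof -
  let ?A = "{D. is_subring D \<and> D \<subseteq> B \<and> D \<inter> p = {0}}"
  have "\<exists>M\<in>?A. \<forall>D\<in>?A. M \<subseteq> D \<longrightarrow> D = M"
  proof (rule subset_Zorn_nonempty)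
    show "?A \<noteq> {}" using assms by blast
    fix C assume C: "C \<noteq> {}" "subset.chain ?A C"
    hence sub: "is_subring D \<and> D \<subseteq> B \<and> D \<inter> p = {0}" if "D \<in> C" for D
      using that by (auto simp: subset_chain_def)
    have "is_subring (\<Union>C)" using is_subring_Union_chain[OF C] sub by blast
    moreover have "\<Union>C \<subseteq> B" "\<Union>C \<inter> p = {0}" using sub C(1) by blast+
    ultimately show "\<Union>C \<in> ?A" by simp
  qed
  then obtain M where M: "is_subring M" "M \<subseteq> B" "M \<inter> p = {0}"
    and max: "\<And>D. is_subring D \<Longrightarrow> D \<subseteq> B \<Longrightarrow> D \<inter> p = {0} \<Longrightarrow> M \<subseteq> D \<Longrightarrow> D = M"
    by (smt (verit, ccfv_SIG) mem_Collect_eq)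
  show ?thesis
  proof (rule that[OF M])
    fix a assume a: "a \<in> B"
    show "\<exists>P\<in>poly_over M. P \<noteq> 0 \<and> poly P a \<in> p"
    proof (cases "a \<in> M")
      case True
      have "(1::'a) \<noteq> 0" using one zero by auto
      thus ?thesis using True M(1) zero
        by (intro bexI[of _ "[:- a, 1:]"]) (auto intro!: poly_over_pCons poly_over_0 subring_uminus subring_one)
    next
      case False
      let ?D = "(\<lambda>q. poly q a) ` poly_over M"
      have "?D \<noteq> M" using mem_simple_extension[OF M(1), of a] False by metis
      moreover have "?D \<subseteq> B"
        using poly_in_subring[OF B _ a] poly_over_mono[OF M(2)] by (blast intro: subsetD)
      hence "?D \<inter> p = {0} \<Longrightarrow> ?D = M"
        by (rule max[OF is_subring_simple_extension[OF M(1)] _ _ subset_simple_extension[OF M(1)]])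
      ultimately have "?D \<inter> p \<noteq> {0}" by blast
      moreover have "0 \<in> ?D \<inter> p" using zero subring_zero[OF is_subring_simple_extension[OF M(1)]] by simp
      ultimately obtain x where "x \<in> ?D" "x \<in> p" "x \<noteq> 0" by blast
      then obtain P where "P \<in> poly_over M" "poly P a \<in> p" "poly P a \<noteq> 0" by blast
      moreover from this have "P \<noteq> 0" by auto
      ultimately show ?thesis by blast
    qed
  qed
qed

text \<open>The embedding \<open>\<iota>\<close> of the ring itself has the right kernel on a maximal subring \<open>D\<close> that meets \<open>p\<close>
  only in \<open>0\<close>.  A maximal extension of \<open>\<iota>\<close> from \<open>D\<close> is defined on all of \<open>B\<close>, since every element of
  \<open>B\<close> is algebraic over \<open>D\<close> modulo \<open>p\<close>.\<close>

theorem hom_with_kernel: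
  fixes \<iota> :: "'a \<Rightarrow> 'w::alg_closed_field"
  assumes \<iota>: "hom_on UNIV \<iota>" "\<And>x. \<iota> x = 0 \<Longrightarrow> x = 0"
    and D0: "is_subring D0" "D0 \<subseteq> B" "D0 \<inter> p = {0}"
  obtains \<phi> :: "'a \<Rightarrow> 'w" where "hom_on B \<phi>" "\<And>x. x \<in> B \<Longrightarrow> \<phi> x = 0 \<longleftrightarrow> x \<in> p"
proof -
  obtain D where D: "is_subring D" "D \<subseteq> B" "D \<inter> p = {0}"
    and alg: "\<And>a. a \<in> B \<Longrightarrow> \<exists>P\<in>poly_over D. P \<noteq> 0 \<and> poly P a \<in> p"
    using maximal_transcendental_subring[OF D0] by blast
  \<comment> \<open>Partial homomorphisms are ordered by inclusion of their graphs.\<close>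
  define graph where "graph C f = (\<lambda>x. (x, f x)) ` C" for C and f :: "'a \<Rightarrow> 'w"
  define good where "good C f \<longleftrightarrow> is_subring C \<and> D \<subseteq> C \<and> C \<subseteq> B \<and> hom_on C f \<and> (\<forall>x\<in>D. f x = \<iota> x) \<and>
    (\<forall>x\<in>C. f x = 0 \<longleftrightarrow> x \<in> p)" for C and f :: "'a \<Rightarrow> 'w"
  let ?A = "{graph C f | C f. good C f}"
  have inG: "(x, y) \<in> graph C f \<longleftrightarrow> x \<in> C \<and> y = f x" for x y C f
    by (auto simp: graph_def)
  have "\<exists>M\<in>?A. \<forall>G\<in>?A. M \<subseteq> G \<longrightarrow> G = M"
  proof (rule subset_Zorn_nonempty)
    have "hom_on D \<iota>" by (rule hom_on_subset[OF \<iota>(1)]) simp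
    moreover have "\<iota> x = 0 \<longleftrightarrow> x \<in> p" if "x \<in> D" for x
      using \<iota>(2) D(3) that zero hom_on_zero[OF is_subring_UNIV \<iota>(1)] by (metis IntI singletonD)
    ultimately have "good D \<iota>" using D by (auto simp: good_def)
    thus "?A \<noteq> {}" by blast
    fix \<C> assume \<C>: "\<C> \<noteq> {}" "subset.chain ?A \<C>"
    have sub: "\<exists>C f. G = graph C f \<and> good C f" if "G \<in> \<C>" for G
      using that \<C>(2) by (auto simp: subset_chain_def)
    define C where "C = Domain (\<Union>\<C>)"
    define f where "f x = (SOME y. (x, y) \<in> \<Union>\<C>)" for x
    have pair: "\<exists>E h. graph E h \<in> \<C> \<and> good E h \<and> x \<in> E \<and> y \<in> E" if xy: "x \<in> C" "y \<in> C" for x y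
    proof -
      obtain G G' where G: "G \<in> \<C>" "x \<in> Domain G" "G' \<in> \<C>" "y \<in> Domain G'"
        using xy unfolding C_def by blast
      obtain Z where Z: "Z \<in> \<C>" "G \<subseteq> Z" "G' \<subseteq> Z" using chain_upper_bound[OF \<C>(2) G(1,3)] .
      obtain E h where "Z = graph E h" "good E h" using sub[OF Z(1)] by blast
      moreover from this have "x \<in> E" "y \<in> E" using Z G inG by (auto elim!: DomainE)
      ultimately show ?thesis using Z(1) by blast
    qed
    have f_eq: "f x = h x" if Eh: "graph E h \<in> \<C>" "x \<in> E" for E h x
    proof -
      have "(x, h x) \<in> \<Union>\<C>" using Eh inG by blast
      hence "(x, f x) \<in> \<Union>\<C>" unfolding f_def by (rule someI)
      then obtain G where G: "G \<in> \<C>" "(x, f x) \<in> G" by blast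
      obtain Z where Z: "Z \<in> \<C>" "G \<subseteq> Z" "graph E h \<subseteq> Z" using chain_upper_bound[OF \<C>(2) G(1) Eh(1)] .
      obtain E' h' where "Z = graph E' h'" using sub[OF Z(1)] by blast
      moreover have "(x, f x) \<in> Z" "(x, h x) \<in> Z" using G(2) Z Eh(2) inG by blast+
      ultimately show ?thesis using inG by simp
    qed
    have CI: "E \<subseteq> C" if "graph E h \<in> \<C>" for E h
      using that inG unfolding C_def by (auto intro!: DomainI)
    have "good C f"
      unfolding good_def
    proof (intro conjI)
      obtain E h where E: "graph E h \<in> \<C>" "good E h" using sub \<C>(1) by blast
      show "D \<subseteq> C" using CI[OF E(1)] E(2) by (auto simp: good_def)
      show "\<forall>x\<in>D. f x = \<iota> x" using f_eq[OF E(1)] E(2) by (auto simp: good_def)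
      show "C \<subseteq> B" "\<forall>x\<in>C. f x = 0 \<longleftrightarrow> x \<in> p"
        using pair f_eq unfolding good_def by (blast, metis)
      have 1: "f 1 = 1" "1 \<in> C"
        using f_eq[OF E(1)] CI[OF E(1)] E(2) subring_one[of E] by (auto simp: good_def hom_on_def)
      have 2: "x - y \<in> C \<and> x * y \<in> C \<and> f (x - y) = f x - f y \<and> f (x * y) = f x * f y" if xy: "x \<in> C" "y \<in> C" for x y
      proof -
        obtain E h where E: "graph E h \<in> \<C>" "good E h" "x \<in> E" "y \<in> E" using pair[OF xy] by blast
        have EE: "is_subring E" "hom_on E h" using E(2) by (auto simp: good_def)
        have "x - y \<in> E" "x * y \<in> E" using EE E subring_diff subring_mult by blast+
        thus ?thesis using CI[OF E(1)] f_eq[OF E(1)] E EE by (auto simp: hom_on_def)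
      qed
      show "is_subring C" "hom_on C f" using 1 2 by (auto simp: is_subring_def hom_on_def)
    qed
    moreover have "\<Union>\<C> = graph C f"
    proof (rule Set.set_eqI)
      fix z :: "'a \<times> 'w"
      obtain x y where z: "z = (x, y)" by fastforce
      have "(x, y) \<in> \<Union>\<C> \<longleftrightarrow> x \<in> C \<and> y = f x"
      proof
        assume "(x, y) \<in> \<Union>\<C>"
        then obtain G where G: "G \<in> \<C>" "(x, y) \<in> G" by blast
        obtain E h where E: "G = graph E h" using sub[OF G(1)] by blast
        thus "x \<in> C \<and> y = f x" using G f_eq[of E h x] CI[of E h] inG[of x y E h] by auto
      next
        assume xy: "x \<in> C \<and> y = f x"
        then obtain E h where "graph E h \<in> \<C>" "x \<in> E" using pair by blast
        thus "(x, y) \<in> \<Union>\<C>" using f_eq[of E h x] inG[of x y E h] xy by blast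
      qed
      thus "z \<in> \<Union>\<C> \<longleftrightarrow> z \<in> graph C f" by (simp add: z inG)
    qed
    ultimately show "\<Union>\<C> \<in> ?A" by blast
  qed
  then obtain G where G: "G \<in> ?A" "\<forall>G'\<in>?A. G \<subseteq> G' \<longrightarrow> G' = G" by (elim bexE)
  from G(1) obtain C f where GCf: "G = graph C f" and Cf: "good C f" by (elim CollectE exE conjE)
  have max: "graph C' f' = graph C f" if "good C' f'" "graph C f \<subseteq> graph C' f'" for C' f'
    using G(2) that GCf by (metis (mono_tags, lifting) mem_Collect_eq)
  have C: "is_subring C" "D \<subseteq> C" "C \<subseteq> B" "hom_on C f" "\<And>x. x \<in> D \<Longrightarrow> f x = \<iota> x" "\<And>x. x \<in> C \<Longrightarrow> f x = 0 \<longleftrightarrow> x \<in> p"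
    using Cf by (auto simp: good_def)
  have "a \<in> C" if a: "a \<in> B" for a
  proof -
    obtain P where P: "P \<in> poly_over D" "P \<noteq> 0" "poly P a \<in> p" using alg[OF a] by blast
    have "f (lead_coeff P) \<noteq> 0"
      using C(5)[OF coeff_poly_over[OF P(1)]] \<iota>(2) P(2) by (metis leading_coeff_0_iff)
    hence "map_poly f P \<noteq> 0" using coeff_map_hom[OF C(1,4)] by (metis coeff_0)
    then obtain C' f' where C': "is_subring C'" "C \<subseteq> C'" "a \<in> C'" "C' \<subseteq> B" "hom_on C' f'"
      "\<And>x. x \<in> C \<Longrightarrow> f' x = f x" "\<And>x. x \<in> C' \<Longrightarrow> f' x = 0 \<longleftrightarrow> x \<in> p"
      using extend_partial_hom[OF C(1,3,4,6) a subsetD[OF poly_over_mono[OF C(2)] P(1)] _ P(3)] by metis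
    hence "good C' f'" using C by (auto simp: good_def)
    moreover have "graph C f \<subseteq> graph C' f'" using C'(2,6) by (auto simp: graph_def)
    ultimately have "graph C' f' = graph C f" by (rule max)
    thus "a \<in> C" using C'(3) inG[of a "f' a"] by auto
  qed
  hence "C = B" using C(3) by blast
  thus ?thesis using that C by blast
qed

end

section \<open>Algebraic elements of a field\<close>

definition algebraic_over :: "'a::field set \<Rightarrow> 'a set" where
  "algebraic_over F = {x. \<exists>p\<in>poly_over F. p \<noteq> 0 \<and> poly p x = 0}"

lemma type_ring_simps [simp]:
  "carrier (ring_of_type_algebra :: 'a::comm_ring_1 ring) = UNIV"
  "x \<otimes>\<^bsub>ring_of_type_algebra\<^esub> y = x * (y :: 'a)"
  "x \<oplus>\<^bsub>ring_of_type_algebra\<^esub> y = x + (y :: 'a)"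
  "\<one>\<^bsub>ring_of_type_algebra\<^esub> = (1 :: 'a)"
  "\<zero>\<^bsub>ring_of_type_algebra\<^esub> = (0 :: 'a)"
  by (simp_all add: ring_of_type_algebra_def)

lemma type_ring_uminus [simp]: "\<ominus>\<^bsub>ring_of_type_algebra\<^esub> x = - (x :: 'a::comm_ring_1)"
proof -
  interpret ring "ring_of_type_algebra :: 'a ring" by (rule ring_from_type_algebra)
  show ?thesis by (rule minus_equality) simp_all
qed

lemma type_ring_power [simp]: "x [^]\<^bsub>ring_of_type_algebra\<^esub> (n::nat) = (x :: 'a::comm_ring_1) ^ n"
proof -
  interpret cring "ring_of_type_algebra :: 'a ring" by (rule cring_from_type_algebra)
  show ?thesis by (induction n) (simp_all add: mult.commute)
qed

lemma type_ring_inv: "(x :: 'a::field) \<noteq> 0 \<Longrightarrow> inv\<^bsub>ring_of_type_algebra\<^esub> x = inverse x"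
proof -
  assume x: "x \<noteq> 0"
  interpret field "ring_of_type_algebra :: 'a ring" by (rule field_from_type_algebra)
  show ?thesis by (rule comm_inv_char) (use x in simp_all)
qed

lemma subring_type_ring_iff: "subring S (ring_of_type_algebra :: 'a::comm_ring_1 ring) \<longleftrightarrow> is_subring S"
proof
  assume "subring S (ring_of_type_algebra :: 'a ring)"
  from subringE[OF this] show "is_subring S"
    by (auto simp: is_subring_def) (metis ab_group_add_class.ab_diff_conv_add_uminus)
next
  interpret ring "ring_of_type_algebra :: 'a ring" by (rule ring_from_type_algebra)
  assume "is_subring S"
  thus "subring S (ring_of_type_algebra :: 'a ring)"
    by (intro subringI) (auto intro: subring_closed)
qed

lemma subfield_type_ring_iff: "subfield S (ring_of_type_algebra :: 'a::field ring) \<longleftrightarrow> is_subfield S"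
proof -
  interpret field "ring_of_type_algebra :: 'a ring" by (rule field_from_type_algebra)
  show ?thesis
  proof
    assume S: "subfield S ring_of_type_algebra"
    have sr: "is_subring S" using subfieldE(1)[OF S] subring_type_ring_iff by blast
    have "inverse x \<in> S" if "x \<in> S" for x
    proof (cases "x = 0")
      case False
      hence "inv\<^bsub>ring_of_type_algebra\<^esub> x \<in> S" using subfield_m_inv(1)[OF S] that by auto
      thus ?thesis using type_ring_inv[OF False] by simp
    qed (use that in simp)
    thus "is_subfield S" using sr by (simp add: is_subfield_def)
  next
    assume S: "is_subfield S"
    show "subfield S ring_of_type_algebra"
    proof (rule subfieldI')
      show "subring S ring_of_type_algebra" using S subring_type_ring_iff subfield_subring by blast
      show "inv\<^bsub>ring_of_type_algebra\<^esub> x \<in> S" if "x \<in> S - {\<zero>\<^bsub>ring_of_type_algebra\<^esub>}" for x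
        using that S type_ring_inv[of x] by (auto intro: subfield_inverse)
    qed
  qed
qed

lemma type_ring_eval: "ring.eval (ring_of_type_algebra :: 'a::field ring) p x = poly (Poly (rev p)) x"
proof -
  interpret field "ring_of_type_algebra :: 'a ring" by (rule field_from_type_algebra)
  show ?thesis
    by (induction p) (auto simp: Poly_append poly_monom)
qed

text \<open>Lists of coefficients start with the leading one, hence the reversals.\<close>

lemma algebraic_type_ring_iff:
  assumes F: "is_subfield (F :: 'a::field set)"
  shows "(ring.algebraic (ring_of_type_algebra :: 'a ring) over F) x \<longleftrightarrow> x \<in> algebraic_over F"
proof -
  interpret field "ring_of_type_algebra :: 'a ring" by (rule field_from_type_algebra)
  have sF: "subring F ring_of_type_algebra" using F subring_type_ring_iff subfield_subring by blast
  show ?thesis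
  proof
    assume "(algebraic over F) x"
    then obtain p where p: "p \<in> carrier (F[X]\<^bsub>ring_of_type_algebra\<^esub>)" "p \<noteq> []" "eval p x = 0"
      using algebraicE[OF sF] by auto
    have set: "set p \<subseteq> F" "hd p \<noteq> 0" using p(1,2) by (auto simp: univ_poly_def polynomial_def)
    have "Polynomial.coeff (Poly (rev p)) i \<in> F" for i
      using set(1) subring_zero[OF subfield_subring[OF F]]
      by (auto simp: nth_default_def rev_nth subset_iff)
    moreover have "Poly (rev p) \<noteq> 0"
    proof
      assume "Poly (rev p) = 0"
      hence "Polynomial.coeff (Poly (rev p)) (length p - 1) = 0" by simp
      thus False using set(2) p(2) by (simp add: nth_default_def rev_nth hd_conv_nth)
    qed
    ultimately show "x \<in> algebraic_over F" using p(3) unfolding type_ring_eval algebraic_over_def poly_over_def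
      by blast
  next
    assume "x \<in> algebraic_over F"
    then obtain p where p: "p \<in> poly_over F" "p \<noteq> 0" "poly p x = 0" by (auto simp: algebraic_over_def)
    have "set (coeffs p) \<subseteq> F" using p(1) by (auto simp: poly_over_def coeffs_def)
    hence "rev (coeffs p) \<in> carrier (F[X]\<^bsub>ring_of_type_algebra\<^esub>)"
      using p(2) by (auto simp: univ_poly_def polynomial_def hd_rev last_coeffs_eq_coeff_degree)
    thus "(algebraic over F) x"
      using algebraicI[of "rev (coeffs p)" F x] p(2,3) unfolding type_ring_eval by simp
  qed
qed

lemma is_subfield_algebraic_over: "is_subfield F \<Longrightarrow> is_subfield (algebraic_over (F :: 'a::field set))"
proof -
  assume F: "is_subfield F"
  interpret field "ring_of_type_algebra :: 'a ring" by (rule field_from_type_algebra)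
  have "subfield F ring_of_type_algebra" using F subfield_type_ring_iff by blast
  from subfield_of_algebraics[OF this] show ?thesis
    unfolding algebraic_type_ring_iff[OF F] subfield_type_ring_iff by simp
qed

lemma subset_algebraic_over: "is_subfield F \<Longrightarrow> F \<subseteq> algebraic_over F"
proof
  fix x assume F: "is_subfield F" "x \<in> F"
  have "[:- x, 1:] \<in> poly_over F"
    using F subfield_subring[OF F(1)] by (intro poly_over_pCons poly_over_0 subring_uminus subring_one)
  thus "x \<in> algebraic_over F" by (auto simp: algebraic_over_def intro!: bexI[of _ "[:- x, 1:]"])
qed

text \<open>The coefficients of \<open>p\<close> generate a finite extension of \<open>F\<close>, over which \<open>\<theta>\<close> is algebraic; degrees of
  finite extensions multiply.\<close>

lemma algebraic_over_closed_under_roots: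
  assumes F: "is_subfield (F :: 'a::field set)" and p: "p \<in> poly_over (algebraic_over F)" "p \<noteq> 0" "poly p \<theta> = 0"
  shows "\<theta> \<in> algebraic_over F"
proof -
  interpret field "ring_of_type_algebra :: 'a ring" by (rule field_from_type_algebra)
  have sF: "subfield F ring_of_type_algebra" using F subfield_type_ring_iff by blast
  define cs where "cs = coeffs p"
  have cs: "\<And>x. x \<in> set cs \<Longrightarrow> (algebraic over F) x"
    using p(1) unfolding algebraic_type_ring_iff[OF F] by (auto simp: cs_def poly_over_def coeffs_def split: if_splits)
  define F' where "F' = finite_extension F cs"
  have sF': "subfield F' ring_of_type_algebra"
    unfolding F'_def by (rule finite_extension_is_subfield[OF sF]) (auto intro: cs)
  have csF': "set cs \<subseteq> F'"
    unfolding F'_def by (rule finite_extension_mem[OF subfieldE(1)[OF sF]]) simp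
  have F': "is_subfield F'" using sF' subfield_type_ring_iff by blast
  have "Polynomial.coeff p i \<in> F'" for i
  proof (cases "i \<le> Polynomial.degree p")
    case True
    thus ?thesis using csF' coeff_in_coeffs[OF p(2) True] by (auto simp: cs_def)
  next
    case False
    thus ?thesis using subring_zero[OF subfield_subring[OF F']] by (simp add: coeff_eq_0)
  qed
  hence "p \<in> poly_over F'" by (simp add: poly_over_def)
  hence "(algebraic over F') \<theta>"
    unfolding algebraic_type_ring_iff[OF F'] using p(2,3) by (auto simp: algebraic_over_def)
  hence "finite_dimension F' (simple_extension F' \<theta>)"
    using finite_dimension_simple_extension[OF sF'] by simp
  moreover have "finite_dimension F F'"
    unfolding F'_def by (rule finite_extension_finite_dimension(1)[OF sF]) (auto intro: cs)
  ultimately have "finite_dimension F (simple_extension F' \<theta>)"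
    using telescopic_base_dim(1)[OF sF sF'] by blast
  moreover have "subring (simple_extension F' \<theta>) ring_of_type_algebra"
    by (rule simple_extension_is_subring[OF subfieldE(1)[OF sF']]) simp
  moreover have "\<theta> \<in> simple_extension F' \<theta>"
    by (rule simple_extension_mem[OF subfieldE(1)[OF sF']]) simp
  ultimately have "(algebraic over F) \<theta>" using finite_dimension_imp_algebraic[OF sF] by blast
  thus ?thesis using algebraic_type_ring_iff[OF F] by simp
qed

section \<open>Polynomials in several variables\<close>

text \<open>Evaluation that also changes the coefficients, along a map that need be a homomorphism only on
  the ring from which the coefficients of \<open>f\<close> are taken.\<close>

definition insertion :: "('a::zero \<Rightarrow> 's::comm_ring_1) \<Rightarrow> ('n::finite \<Rightarrow> 's) \<Rightarrow> ('n, 'a) mpoly \<Rightarrow> 's" where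
  "insertion c x f = (\<Sum>m\<in>Poly_Mapping.keys f. c (Poly_Mapping.lookup f m) * (\<Prod>i\<in>UNIV. x i ^ Poly_Mapping.lookup m i))"

abbreviation mono_val :: "('n::finite \<Rightarrow> 's::comm_ring_1) \<Rightarrow> ('n \<Rightarrow>\<^sub>0 nat) \<Rightarrow> 's" where
  "mono_val x m \<equiv> (\<Prod>i\<in>UNIV. x i ^ Poly_Mapping.lookup m i)"

lemma mono_val_add: "mono_val x (m + m') = mono_val x m * mono_val x m'"
  by (simp add: lookup_add power_add prod.distrib)

lemma mpoly_eq_sum_single: "f = (\<Sum>m\<in>Poly_Mapping.keys f. Poly_Mapping.single m (Poly_Mapping.lookup f m))"
  by (rule poly_mapping_eqI) (simp add: lookup_sum lookup_single when_def in_keys_iff sum.delta)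

lemma single_in_polys_over: "a \<in> N \<Longrightarrow> 0 \<in> N \<Longrightarrow> Poly_Mapping.single m a \<in> polys_over N"
  by (auto simp: polys_over_def lookup_single when_def)

lemma lookup_polys_over: "f \<in> polys_over N \<Longrightarrow> Poly_Mapping.lookup f m \<in> N"
  by (simp add: polys_over_def)

lemma polys_over_diff: "is_subring N \<Longrightarrow> f \<in> polys_over N \<Longrightarrow> g \<in> polys_over N \<Longrightarrow> f - g \<in> polys_over N"
  by (auto simp: polys_over_def lookup_minus intro: subring_diff)

lemma polys_over_add: "is_subring N \<Longrightarrow> f \<in> polys_over N \<Longrightarrow> g \<in> polys_over N \<Longrightarrow> f + g \<in> polys_over N"
  by (auto simp: polys_over_def lookup_add intro: subring_add)

lemma polys_over_sum:
  "is_subring N \<Longrightarrow> (\<And>i. i \<in> I \<Longrightarrow> f i \<in> polys_over N) \<Longrightarrow> (\<Sum>i\<in>I. f i) \<in> polys_over N"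
proof (induction I rule: infinite_finite_induct)
  case (insert i I)
  thus ?case by (simp add: polys_over_add)
qed (auto simp: polys_over_def subring_zero)

lemma mpoly_mult_eq_sum:
  fixes f g :: "('n, 'a::comm_ring_1) mpoly"
  shows "f * g = (\<Sum>m\<in>Poly_Mapping.keys f. \<Sum>m'\<in>Poly_Mapping.keys g.
    Poly_Mapping.single (m + m') (Poly_Mapping.lookup f m * Poly_Mapping.lookup g m'))"
  by (subst mpoly_eq_sum_single[of f], subst mpoly_eq_sum_single[of g])
    (simp add: sum_product mult_single)

lemma is_subring_polys_over:
  assumes N: "is_subring (N :: 'a::comm_ring_1 set)" shows "is_subring (polys_over N :: ('n, 'a) mpoly set)"
  unfolding is_subring_def
proof (intro conjI ballI)
  show "1 \<in> (polys_over N :: ('n, 'a) mpoly set)"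
    using single_in_polys_over[OF subring_one[OF N] subring_zero[OF N], of 0] by simp
  fix f g :: "('n, 'a) mpoly" assume fg: "f \<in> polys_over N" "g \<in> polys_over N"
  show "f - g \<in> polys_over N" by (rule polys_over_diff[OF N fg])
  show "f * g \<in> polys_over N"
    unfolding mpoly_mult_eq_sum[of f g]
    by (intro polys_over_sum N single_in_polys_over subring_mult subring_zero lookup_polys_over fg)
qed

lemma polys_over_UNIV [simp]: "polys_over UNIV = UNIV"
  by (simp add: polys_over_def)

lemma polys_over_mono: "N \<subseteq> N' \<Longrightarrow> polys_over N \<subseteq> polys_over N'"
  by (auto simp: polys_over_def)

lemma Const_in_polys_over: "c \<in> N \<Longrightarrow> 0 \<in> N \<Longrightarrow> Const c \<in> polys_over N"
  unfolding Const_def by (rule single_in_polys_over)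

lemma Var_in_polys_over: "is_subring N \<Longrightarrow> Var i \<in> polys_over N"
  unfolding Var_def by (intro single_in_polys_over subring_one subring_zero)

lemma Const_simps [simp]:
  "Const (0::'a::zero) = 0" "Const (1::'b::comm_ring_1) = 1"
  by (simp_all add: Const_def)

lemma hom_on_Const: "hom_on UNIV (Const :: 'a::comm_ring_1 \<Rightarrow> ('n, 'a) mpoly)"
  by (simp add: hom_on_def Const_def single_diff mult_single)

lemma Const_eq_iff [simp]: "Const a = Const b \<longleftrightarrow> a = b"
  by (metis Const_def lookup_single_eq)

lemma Const_eq_0_iff [simp]: "Const a = 0 \<longleftrightarrow> a = 0"
  using Const_eq_iff[of a 0] by simp

lemma Const_uminus: "Const (- a) = - Const (a :: 'a::comm_ring_1)"
  by (simp add: Const_def single_uminus)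

lemma Const_in_polys_over_iff: "0 \<in> N \<Longrightarrow> Const c \<in> polys_over N \<longleftrightarrow> c \<in> N"
  using lookup_polys_over[of "Const c" N 0] Const_in_polys_over[of c N] by (auto simp: Const_def)

lemma Var_power: "Var i ^ k = Poly_Mapping.single (Poly_Mapping.single i k) (1::'a::comm_ring_1)"
  by (induction k) (simp_all add: Var_def mult_single single_add[symmetric])

lemma prod_single:
  "(\<Prod>i\<in>A. Poly_Mapping.single (e i) (1::'a::comm_ring_1)) = Poly_Mapping.single (\<Sum>i\<in>A. e i :: 'm::comm_monoid_add) 1"
  by (induction A rule: infinite_finite_induct) (simp_all add: mult_single)

lemma sum_single_lookup: "(\<Sum>i\<in>UNIV. Poly_Mapping.single i (Poly_Mapping.lookup m i)) = (m :: 'n::finite \<Rightarrow>\<^sub>0 nat)"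
  by (rule poly_mapping_eqI) (simp add: lookup_sum lookup_single when_def sum.delta)

lemma mono_val_Var: "mono_val Var m = Poly_Mapping.single m (1::'a::comm_ring_1)"
  by (simp add: Var_power prod_single sum_single_lookup)

lemma single_eq_Const_mult: "Poly_Mapping.single m a = Const a * mono_val Var m"
  by (simp only: mono_val_Var) (simp add: Const_def mult_single)

lemma mpoly_eq_sum_Const:
  "f = (\<Sum>m\<in>Poly_Mapping.keys f. Const (Poly_Mapping.lookup f m) * mono_val Var m)"
  unfolding single_eq_Const_mult[symmetric] by (rule mpoly_eq_sum_single)

context
  fixes N :: "'a::comm_ring_1 set" and c :: "'a \<Rightarrow> 's::comm_ring_1" and x :: "'n::finite \<Rightarrow> 's"
  assumes N: "is_subring N" and c: "hom_on N c"
begin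

private lemma insertion_superset:
  "finite K \<Longrightarrow> Poly_Mapping.keys f \<subseteq> K \<Longrightarrow>
     insertion c x f = (\<Sum>m\<in>K. c (Poly_Mapping.lookup f m) * mono_val x m)"
  unfolding insertion_def
  by (rule sum.mono_neutral_left) (auto simp: in_keys_iff hom_on_zero[OF N c])

lemma insertion_diff:
  assumes "f \<in> polys_over N" "g \<in> polys_over N"
  shows "insertion c x (f - g) = insertion c x f - insertion c x g"
proof -
  let ?K = "Poly_Mapping.keys f \<union> Poly_Mapping.keys g"
  have "Poly_Mapping.keys (f - g) \<subseteq> ?K" by (rule keys_diff)
  thus ?thesis
    using assms by (subst (1 2 3) insertion_superset[of ?K])
      (auto simp: lookup_minus hom_on_diff[OF N c] lookup_polys_over left_diff_distrib sum_subtractf)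
qed

lemma insertion_add:
  assumes "f \<in> polys_over N" "g \<in> polys_over N"
  shows "insertion c x (f + g) = insertion c x f + insertion c x g"
proof -
  let ?K = "Poly_Mapping.keys f \<union> Poly_Mapping.keys g"
  have "Poly_Mapping.keys (f + g) \<subseteq> ?K" by (rule keys_add)
  thus ?thesis
    using assms by (subst (1 2 3) insertion_superset[of ?K])
      (auto simp: lookup_add hom_on_add[OF N c] lookup_polys_over distrib_right sum.distrib)
qed

lemma insertion_zero: "insertion c x 0 = 0"
  by (simp add: insertion_def)

lemma insertion_sum:
  "(\<And>i. i \<in> I \<Longrightarrow> f i \<in> polys_over N) \<Longrightarrow> insertion c x (\<Sum>i\<in>I. f i) = (\<Sum>i\<in>I. insertion c x (f i))"
  by (induction I rule: infinite_finite_induct)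
    (auto simp: insertion_zero insertion_add polys_over_sum[OF N])

lemma insertion_single: "insertion c x (Poly_Mapping.single m a) = c a * mono_val x m"
  by (simp add: insertion_def hom_on_zero[OF N c])

lemma insertion_mult:
  assumes "f \<in> polys_over N" "g \<in> polys_over N"
  shows "insertion c x (f * g) = insertion c x f * insertion c x g"
proof -
  have s: "Poly_Mapping.single (m + m') (Poly_Mapping.lookup f m * Poly_Mapping.lookup g m') \<in> polys_over N" for m m'
    by (intro single_in_polys_over subring_mult N lookup_polys_over assms subring_zero)
  have "insertion c x (f * g) = (\<Sum>m\<in>Poly_Mapping.keys f. \<Sum>m'\<in>Poly_Mapping.keys g.
    c (Poly_Mapping.lookup f m) * mono_val x m * (c (Poly_Mapping.lookup g m') * mono_val x m'))"
    unfolding mpoly_mult_eq_sum[of f g] using s assms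
    by (subst insertion_sum, intro polys_over_sum N s, intro sum.cong refl, subst insertion_sum)
      (auto simp: insertion_single hom_on_mult[OF N c] lookup_polys_over mono_val_add mult_ac
        simp del: prod.distrib intro!: sum.cong)
  thus ?thesis by (simp add: insertion_def sum_product)
qed

lemma hom_on_insertion: "hom_on (polys_over N) (insertion c x)"
proof -
  have "insertion c x 1 = 1"
    using insertion_single[of 0 1] by (simp add: hom_on_one[OF N c])
  thus ?thesis by (simp add: hom_on_def insertion_diff insertion_mult)
qed

lemma insertion_Const: "insertion c x (Const a) = c a"
  unfolding Const_def by (simp add: insertion_single)

end

lemma hom_on_eq_insertion:
  fixes \<phi> :: "('n::finite, 'a::comm_ring_1) mpoly \<Rightarrow> 's::comm_ring_1"
  assumes N: "is_subring N" and \<phi>: "hom_on (polys_over N) \<phi>" and f: "f \<in> polys_over N"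
  shows "\<phi> f = insertion (\<phi> \<circ> Const) (\<phi> \<circ> Var) f"
proof -
  note S = is_subring_polys_over[OF N]
  have m: "mono_val Var m \<in> polys_over N" for m :: "'n \<Rightarrow>\<^sub>0 nat"
    by (intro subring_prod subring_power S Var_in_polys_over N)
  have C: "Const (Poly_Mapping.lookup f m) \<in> polys_over N" for m
    by (intro Const_in_polys_over lookup_polys_over f subring_zero N)
  have "\<phi> f = (\<Sum>m\<in>Poly_Mapping.keys f. \<phi> (Const (Poly_Mapping.lookup f m) * mono_val Var m))"
    by (subst mpoly_eq_sum_Const[of f], rule hom_on_sum[OF S \<phi>]) (intro subring_mult S m C)
  also have "\<dots> = insertion (\<phi> \<circ> Const) (\<phi> \<circ> Var) f"
    unfolding insertion_def
    by (intro sum.cong refl) (simp add: hom_on_mult[OF S \<phi> C m] hom_on_prod[OF S \<phi>] hom_on_power[OF S \<phi>]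
        subring_power[OF S] Var_in_polys_over[OF N])
  finally show ?thesis .
qed

type_synonym 'a mpoly_closure = "((nat \<Rightarrow>\<^sub>0 nat) \<Rightarrow>\<^sub>0 'a) fract alg_closure"

text \<open>Renaming the variables to natural numbers leads to monomials with a compatible linear order, so
  that leading terms show that there are no zero divisors and a fraction field exists.\<close>

lemma mpoly_embedding:
  "\<exists>\<iota> :: ('n::finite, 'a::field) mpoly \<Rightarrow> 'a mpoly_closure. hom_on UNIV \<iota> \<and> (\<forall>f. \<iota> f = 0 \<longrightarrow> f = 0)"
proof -
  obtain idx :: "'n \<Rightarrow> nat" where idx: "inj idx"
    using finite_imp_inj_to_nat_seg[of "UNIV :: 'n set"] by auto
  define \<kappa> :: "('n, 'a) mpoly \<Rightarrow> (nat \<Rightarrow>\<^sub>0 nat) \<Rightarrow>\<^sub>0 'a" where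
    "\<kappa> = insertion (Poly_Mapping.single 0) (\<lambda>i. Poly_Mapping.single (Poly_Mapping.single (idx i) 1) 1)"
  have c: "hom_on UNIV (Poly_Mapping.single 0 :: 'a \<Rightarrow> (nat \<Rightarrow>\<^sub>0 nat) \<Rightarrow>\<^sub>0 'a)"
    by (simp add: hom_on_def single_diff mult_single)
  have \<kappa>: "hom_on UNIV \<kappa>" using hom_on_insertion[OF is_subring_UNIV c] by (simp add: \<kappa>_def)
  define e where "e m = (\<Sum>i\<in>UNIV. Poly_Mapping.single (idx i) (Poly_Mapping.lookup m i))" for m :: "'n \<Rightarrow>\<^sub>0 nat"
  have lookup_e: "Poly_Mapping.lookup (e m) (idx i) = Poly_Mapping.lookup m i" for m i
    using idx by (simp add: e_def lookup_sum lookup_single when_def inj_eq sum.delta)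
  have inj_e: "e m = e m' \<longleftrightarrow> m = m'" for m m'
    by (metis lookup_e poly_mapping_eqI)
  have pow: "(Poly_Mapping.single (Poly_Mapping.single j 1) (1::'a)) ^ k = Poly_Mapping.single (Poly_Mapping.single j k) 1"
    for j k :: nat
    by (induction k) (simp_all add: mult_single single_add[symmetric])
  have "\<kappa> f = (\<Sum>m\<in>Poly_Mapping.keys f. Poly_Mapping.single (e m) (Poly_Mapping.lookup f m))" for f
    unfolding \<kappa>_def insertion_def pow prod_single e_def by (simp add: mult_single)
  hence lookup_\<kappa>: "Poly_Mapping.lookup (\<kappa> f) (e m) = Poly_Mapping.lookup f m" for f m
    by (simp add: lookup_sum lookup_single when_def inj_e in_keys_iff sum.delta)
  have ker: "f = 0" if "\<kappa> f = 0" for f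
    by (rule poly_mapping_eqI) (metis lookup_\<kappa> that lookup_zero)
  define \<iota> where "\<iota> f = to_ac (Fract (\<kappa> f) 1)" for f
  have "hom_on UNIV \<iota>"
    using \<kappa> by (auto simp: hom_on_def \<iota>_def to_ac_diff[symmetric] to_ac_mult[symmetric] One_fract_def[symmetric]
        simp del: to_ac_diff to_ac_mult)
  moreover have "\<iota> f = 0 \<longrightarrow> f = 0" for f
    using ker by (auto simp: \<iota>_def eq_fract Zero_fract_def)
  ultimately show ?thesis by blast
qed

section \<open>Prime cones and their real closures\<close>

context
  fixes B \<alpha> :: "'b::comm_ring_1 set"
  assumes B: "is_subring B" and \<alpha>: "prime_cone B \<alpha>"
begin

lemma prime_cone_subset: "\<alpha> \<subseteq> B"
  and prime_cone_add: "f \<in> \<alpha> \<Longrightarrow> g \<in> \<alpha> \<Longrightarrow> f + g \<in> \<alpha>"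
  and prime_cone_mult: "f \<in> \<alpha> \<Longrightarrow> g \<in> \<alpha> \<Longrightarrow> f * g \<in> \<alpha>"
  and prime_cone_square: "f \<in> B \<Longrightarrow> f * f \<in> \<alpha>"
  and prime_cone_minus_one: "- 1 \<notin> \<alpha>"
  and prime_cone_prime: "f \<in> B \<Longrightarrow> g \<in> B \<Longrightarrow> f * g \<in> \<alpha> \<Longrightarrow> f \<in> \<alpha> \<or> - g \<in> \<alpha>"
  using \<alpha> by (auto simp: prime_cone_def)

lemma prime_cone_total: "f \<in> B \<Longrightarrow> f \<in> \<alpha> \<or> - f \<in> \<alpha>"
  using prime_cone_prime[of f f] prime_cone_square by blast

lemma prime_cone_zero: "0 \<in> \<alpha>"
  using prime_cone_square[OF subring_zero[OF B]] by simp

lemma prime_cone_one: "1 \<in> \<alpha>"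
  using prime_cone_square[OF subring_one[OF B]] by simp

lemma supp_iff: "f \<in> supp \<alpha> \<longleftrightarrow> f \<in> \<alpha> \<and> - f \<in> \<alpha>"
  by (force simp: supp_def)

lemma supp_mult:
  assumes "x \<in> B" "y \<in> supp \<alpha>" shows "x * y \<in> supp \<alpha>"
proof -
  have "y \<in> \<alpha>" "- y \<in> \<alpha>" using assms(2) by (auto simp: supp_iff)
  thus ?thesis
    using prime_cone_total[OF assms(1)] prime_cone_mult[of x y] prime_cone_mult[of x "- y"]
      prime_cone_mult[of "- x" y] prime_cone_mult[of "- x" "- y"]
    by (auto simp: supp_iff)
qed

text \<open>If \<open>x * y\<close> is in the support, then the primality condition applies to all four products
  \<open>(\<plusminus>x) * (\<plusminus>y)\<close>.\<close>

lemma prime_ideal_supp: "prime_ideal_in B (supp \<alpha>)"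
proof
  show "is_subring B" by (rule B)
  show "supp \<alpha> \<subseteq> B" using prime_cone_subset by (auto simp: supp_iff)
  show "0 \<in> supp \<alpha>" using prime_cone_zero by (simp add: supp_iff)
  show "1 \<notin> supp \<alpha>" using prime_cone_minus_one by (simp add: supp_iff)
  show "x - y \<in> supp \<alpha>" if "x \<in> supp \<alpha>" "y \<in> supp \<alpha>" for x y
    using that prime_cone_add[of x "- y"] prime_cone_add[of y "- x"] by (simp add: supp_iff)
  show "x * y \<in> supp \<alpha>" if "x \<in> B" "y \<in> supp \<alpha>" for x y by (rule supp_mult[OF that])
  show "x \<in> supp \<alpha> \<or> y \<in> supp \<alpha>" if "x \<in> B" "y \<in> B" "x * y \<in> supp \<alpha>" for x y
    using that(3) prime_cone_prime[of x y] prime_cone_prime[of x "- y"] prime_cone_prime[of "- x" y]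
      prime_cone_prime[of "- x" "- y"] subring_uminus[OF B] that(1,2)
    by (auto simp: supp_iff)
qed

lemma of_int_supp: "of_int n \<in> supp \<alpha> \<Longrightarrow> n = 0"
proof (rule ccontr)
  assume n: "of_int n \<in> supp \<alpha>" "n \<noteq> 0"
  have nat: "of_nat k \<in> \<alpha>" for k
    by (induction k) (auto intro: prime_cone_zero prime_cone_add prime_cone_one)
  obtain k where "\<bar>n\<bar> = int (Suc k)" using n(2) by (metis abs_of_nat gr0_implies_Suc zabs_def zero_less_abs_iff zero_less_imp_eq_int)
  hence "n = int (Suc k) \<or> n = - int (Suc k)" by linarith
  hence "- of_nat (Suc k) \<in> \<alpha>" using n(1) by (auto simp: supp_iff)
  hence "- of_nat (Suc k) + of_nat k \<in> \<alpha>" using nat by (rule prime_cone_add)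
  thus False using prime_cone_minus_one by simp
qed

text \<open>After mapping the residue ring into an algebraically closed field, take the image of the cone as
  weights.  In the field of fractions, \<open>-1\<close> is not a weighted sum of squares, since clearing
  denominators would put a square \<open>b * b\<close> into the support without \<open>b\<close> being there.  Everything
  takes place among the elements that are algebraic over these fractions.\<close>

theorem real_closure_of_prime_cone:
  fixes \<iota> :: "'b \<Rightarrow> 'w::alg_closed_field"
  assumes \<iota>: "hom_on UNIV \<iota>" "\<And>x. \<iota> x = 0 \<Longrightarrow> x = 0"
  obtains \<phi> :: "'b \<Rightarrow> 'w" and E where "hom_on B \<phi>" "real_closed_subfield E" "\<phi> ` B \<subseteq> E"
    "\<And>f. f \<in> B \<Longrightarrow> f \<in> \<alpha> \<longleftrightarrow> nonneg_in E (\<phi> f)" "E \<subseteq> algebraic_over (fractions (\<phi> ` B))"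
proof -
  interpret prime_ideal_in B "supp \<alpha>" by (rule prime_ideal_supp)
  have "is_subring (range of_int :: 'b set)"
    unfolding is_subring_def
  proof (intro conjI ballI)
    show "1 \<in> range (of_int :: int \<Rightarrow> 'b)" by (rule range_eqI[of _ _ 1]) simp
    fix x y :: 'b assume "x \<in> range of_int" "y \<in> range of_int"
    then obtain a b where "x = of_int a" "y = of_int b" by (elim rangeE)
    thus "x - y \<in> range of_int" "x * y \<in> range of_int"
      using range_eqI[of "x - y" of_int "a - b"] range_eqI[of "x * y" of_int "a * b"] by simp_all
  qed
  moreover have "of_int n \<in> B" for n
    by (cases n rule: int_cases2) (simp_all add: subring_of_nat[OF B] subring_uminus[OF B])
  hence "range of_int \<subseteq> B" by auto
  moreover have "range of_int \<inter> supp \<alpha> = {0}"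
  proof (intro equalityI subsetI)
    fix x :: 'b assume "x \<in> range of_int \<inter> supp \<alpha>"
    then obtain n where n: "x = of_int n" "of_int n \<in> supp \<alpha>" by blast
    thus "x \<in> {0}" using of_int_supp[OF n(2)] by simp
  next
    fix x :: 'b assume "x \<in> {0}"
    thus "x \<in> range of_int \<inter> supp \<alpha>" using zero range_eqI[of 0 of_int 0] by simp
  qed
  ultimately obtain \<phi> :: "'b \<Rightarrow> 'w" where \<phi>: "hom_on B \<phi>" "\<And>x. x \<in> B \<Longrightarrow> \<phi> x = 0 \<longleftrightarrow> x \<in> supp \<alpha>"
    using hom_with_kernel[OF \<iota>] by blast
  define T where "T = \<phi> ` \<alpha>"
  define F where "F = fractions (\<phi> ` B)"
  define L where "L = algebraic_over F"
  have img: "is_subring (\<phi> ` B)" by (rule is_subring_hom_image[OF B \<phi>(1)])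
  have F: "is_subfield F" unfolding F_def by (rule is_subfield_fractions[OF img])
  have sub: "\<alpha> \<subseteq> B" by (rule prime_cone_subset)
  have T_mult: "t * t' \<in> T" if "t \<in> T" "t' \<in> T" for t t'
  proof -
    obtain u v where "u \<in> \<alpha>" "v \<in> \<alpha>" "t = \<phi> u" "t' = \<phi> v" using \<open>t \<in> T\<close> \<open>t' \<in> T\<close> by (auto simp: T_def)
    moreover from this have "u \<in> B" "v \<in> B" using sub by auto
    ultimately have "t * t' = \<phi> (u * v)" "u * v \<in> \<alpha>"
      using prime_cone_mult hom_on_mult[OF B \<phi>(1)] by simp_all
    thus ?thesis unfolding T_def by blast
  qed
  have T_one: "1 \<in> T" unfolding T_def using prime_cone_one hom_on_one[OF B \<phi>(1)] by force
  have L: "is_subfield L" unfolding L_def by (rule is_subfield_algebraic_over[OF F])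
  have L_root: "\<exists>x\<in>L. poly p x = 0" if p: "p \<in> poly_over L" "degree p > 0" for p
  proof -
    obtain x where "poly p x = 0" using alg_closed_imp_poly_has_root[OF p(2)] by blast
    moreover from this have "x \<in> L"
      using p algebraic_over_closed_under_roots[OF F] unfolding L_def by fastforce
    ultimately show ?thesis by blast
  qed
  \<comment> \<open>Weighted sums of squares of fractions have a square as common denominator.\<close>
  have frac: "\<exists>c\<in>\<alpha>. \<exists>b\<in>B. \<phi> b \<noteq> 0 \<and> s * (\<phi> b * \<phi> b) = \<phi> c" if "s \<in> weighted_squares T F" for s
    using that
  proof induction
    case zero
    show ?case using prime_cone_zero subring_one[OF B] hom_on_one[OF B \<phi>(1)] hom_on_zero[OF B \<phi>(1)]
      by (intro bexI[of _ 0] bexI[of _ 1]) auto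
  next
    case (add s t x)
    then obtain c b where cb: "c \<in> \<alpha>" "b \<in> B" "\<phi> b \<noteq> 0" "s * (\<phi> b * \<phi> b) = \<phi> c" by blast
    obtain t' where t': "t' \<in> \<alpha>" "t = \<phi> t'" using add by (auto simp: T_def)
    obtain u v where uv: "u \<in> B" "v \<in> B" "x = \<phi> u / \<phi> v" using add by (auto simp: F_def fractions_def)
    show ?case
    proof (cases "\<phi> v = 0")
      case True
      thus ?thesis using cb uv by auto
    next
      case False
      have m: "b * v \<in> B" "t' \<in> B" "c \<in> B" using cb uv t' sub subring_mult[OF B] by auto
      have "c * (v * v) + t' * ((u * b) * (u * b)) \<in> \<alpha>"
        using cb uv t' by (intro prime_cone_add prime_cone_mult prime_cone_square subring_mult[OF B])
      moreover have "\<phi> (c * (v * v) + t' * ((u * b) * (u * b))) = \<phi> c * (\<phi> v * \<phi> v) + \<phi> t' * ((\<phi> u * \<phi> b) * (\<phi> u * \<phi> b))"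
        using cb uv t' m by (simp add: hom_on_add[OF B \<phi>(1)] hom_on_mult[OF B \<phi>(1)] subring_mult[OF B])
      moreover have "\<dots> = (s + t * (x * x)) * (\<phi> (b * v) * \<phi> (b * v))"
      proof -
        have "\<phi> u = x * \<phi> v" using False uv(3) by simp
        thus ?thesis using cb(2) uv(2) t'(2)
          by (simp add: hom_on_mult[OF B \<phi>(1)] cb(4)[symmetric] algebra_simps)
      qed
      moreover have "\<phi> (b * v) \<noteq> 0" using False cb uv by (simp add: hom_on_mult[OF B \<phi>(1)])
      ultimately show ?thesis using m(1) by metis
    qed
  qed
  have "real_extension T L F"
    unfolding real_extension_def
  proof (intro conjI F)
    show "T \<subseteq> F" using subset_fractions[OF img] sub by (auto simp: T_def F_def)
    show "F \<subseteq> L" unfolding L_def by (rule subset_algebraic_over[OF F])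
    show "- 1 \<notin> weighted_squares T F"
    proof
      assume "- 1 \<in> weighted_squares T F"
      then obtain c b where cb: "c \<in> \<alpha>" "b \<in> B" "\<phi> b \<noteq> 0" "- 1 * (\<phi> b * \<phi> b) = \<phi> c" using frac by blast
      have cB: "c \<in> B" "b * b \<in> B" using cb(1,2) sub subring_mult[OF B] by auto
      have "\<phi> (c + b * b) = 0"
        using cb(2) cb(4)[symmetric] by (simp add: hom_on_add[OF B \<phi>(1) cB] hom_on_mult[OF B \<phi>(1)])
      hence "c + b * b \<in> supp \<alpha>" using \<phi>(2)[of "c + b * b"] subring_add[OF B cB] by simp
      hence "- (c + b * b) + c \<in> \<alpha>" using cb(1) by (intro prime_cone_add) (auto simp: supp_iff)
      hence "b * b \<in> supp \<alpha>" using prime_cone_square[OF cb(2)] by (simp add: supp_iff)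
      hence "b \<in> supp \<alpha>" using prime[OF cb(2,2)] by blast
      thus False using \<phi>(2)[OF cb(2)] cb(3) by simp
    qed
  qed
  then obtain E where E: "real_extension T L E" "F \<subseteq> E" and max: "\<And>E'. real_extension T L E' \<Longrightarrow> E \<subseteq> E' \<Longrightarrow> E' = E"
    using maximal_real_extension by blast
  have rc: "real_closed_subfield E"
    by (rule real_closed_subfield_if_maximal[OF T_mult T_one L L_root E(1) max])
  interpret real_closed_subfield E by (rule rc)
  have nn: "nonneg (\<phi> f)" if "f \<in> \<alpha>" for f
    using that by (intro nonneg_if_weight[OF T_mult T_one L L_root E(1) max]) (auto simp: T_def)
  show ?thesis
  proof (rule that[OF \<phi>(1) rc])
    show "\<phi> ` B \<subseteq> E" using subset_fractions[OF img] E(2) F_def by blast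
    show "f \<in> \<alpha> \<longleftrightarrow> nonneg (\<phi> f)" if f: "f \<in> B" for f
    proof
      assume n: "nonneg (\<phi> f)"
      show "f \<in> \<alpha>"
      proof (rule ccontr)
        assume "f \<notin> \<alpha>"
        hence "nonneg (- \<phi> f)" using prime_cone_total[OF f] nn[of "- f"] hom_on_uminus[OF B \<phi>(1) f] by auto
        hence "\<phi> f = 0" using nonneg_antisym n by blast
        thus False using \<phi>(2)[OF f] \<open>f \<notin> \<alpha>\<close> by (simp add: supp_iff)
      qed
    qed (rule nn)
    show "E \<subseteq> algebraic_over (fractions (\<phi> ` B))" using E(1) by (simp add: real_extension_def L_def F_def)
  qed
qed

end

section \<open>The real closed field at a prime cone\<close>

abbreviation type_ring :: "'a::comm_ring_1 ring" where
  "type_ring \<equiv> ring_of_type_algebra"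

abbreviation sub_ring :: "'a::comm_ring_1 set \<Rightarrow> 'a ring" where
  "sub_ring S \<equiv> type_ring\<lparr>carrier := S\<rparr>"

lemma ring_hom_sub_ring_sum:
  assumes S: "is_subring S" and K: "cring K" and h: "h \<in> ring_hom (sub_ring S) K"
  shows "finite A \<Longrightarrow> (\<And>i. i \<in> A \<Longrightarrow> g i \<in> S) \<Longrightarrow> h (\<Sum>i\<in>A. g i) = (\<Oplus>\<^bsub>K\<^esub>i\<in>A. h (g i))"
    and "finite A \<Longrightarrow> (\<And>i. i \<in> A \<Longrightarrow> g i \<in> S) \<Longrightarrow> h (\<Prod>i\<in>A. g i) = (\<Otimes>\<^bsub>K\<^esub>i\<in>A. h (g i))"
    and "x \<in> S \<Longrightarrow> h (x ^ n) = h x [^]\<^bsub>K\<^esub> n"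
    and "h 0 = \<zero>\<^bsub>K\<^esub>"
proof -
  interpret K: cring K by (rule K)
  have hK: "x \<in> S \<Longrightarrow> h x \<in> carrier K" for x using ring_hom_memE(1)[OF h, of x] by simp
  have add: "x \<in> S \<Longrightarrow> y \<in> S \<Longrightarrow> h (x + y) = h x \<oplus>\<^bsub>K\<^esub> h y" for x y
    using ring_hom_memE(3)[OF h, of x y] by simp
  have mult: "x \<in> S \<Longrightarrow> y \<in> S \<Longrightarrow> h (x * y) = h x \<otimes>\<^bsub>K\<^esub> h y" for x y
    using ring_hom_memE(2)[OF h, of x y] by simp
  have one: "h 1 = \<one>\<^bsub>K\<^esub>" using ring_hom_memE(4)[OF h] by simp
  have "h 0 \<oplus>\<^bsub>K\<^esub> h 0 = h 0" using add[of 0 0] subring_zero[OF S] by simp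
  thus zero: "h 0 = \<zero>\<^bsub>K\<^esub>" using hK[OF subring_zero[OF S]] by (metis K.add.l_cancel_one' )
  show "finite A \<Longrightarrow> (\<And>i. i \<in> A \<Longrightarrow> g i \<in> S) \<Longrightarrow> h (\<Sum>i\<in>A. g i) = (\<Oplus>\<^bsub>K\<^esub>i\<in>A. h (g i))"
  proof (induction A rule: finite_induct)
    case (insert a A)
    have "sum g A \<in> S" using insert.prems by (intro subring_sum S) auto
    moreover have "(\<lambda>i. h (g i)) \<in> A \<rightarrow> carrier K" "h (g a) \<in> carrier K" using insert.prems hK by auto
    ultimately show ?case using insert by (simp add: add)
  qed (simp add: zero)
  show "finite A \<Longrightarrow> (\<And>i. i \<in> A \<Longrightarrow> g i \<in> S) \<Longrightarrow> h (\<Prod>i\<in>A. g i) = (\<Otimes>\<^bsub>K\<^esub>i\<in>A. h (g i))"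
  proof (induction A rule: finite_induct)
    case (insert a A)
    have "prod g A \<in> S" using insert.prems by (intro subring_prod S) auto
    moreover have "(\<lambda>i. h (g i)) \<in> A \<rightarrow> carrier K" "h (g a) \<in> carrier K" using insert.prems hK by auto
    ultimately show ?case using insert by (simp add: mult)
  qed (simp add: one)
  show "x \<in> S \<Longrightarrow> h (x ^ n) = h x [^]\<^bsub>K\<^esub> n"
    by (induction n) (simp_all add: one mult subring_power[OF S] K.m_comm hK)
qed

lemma clear_denominators:
  assumes S: "is_subring (S :: 'a::field set)"
  shows "p \<in> poly_over (fractions S) \<Longrightarrow> \<exists>d\<in>S. d \<noteq> 0 \<and> smult d p \<in> poly_over S"
proof (induction p)
  case 0
  show ?case using subring_one[OF S] poly_over_0[OF S] by (intro bexI[of _ 1]) auto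
next
  case (pCons a p)
  have ap: "a \<in> fractions S" "p \<in> poly_over (fractions S)"
    using pCons.prems by (auto simp: poly_over_def coeff_pCons split: nat.splits)
  then obtain d where d: "d \<in> S" "d \<noteq> 0" "smult d p \<in> poly_over S" using pCons.IH by blast
  obtain u v where uv: "u \<in> S" "v \<in> S" "a = u / v" using ap(1) by (auto simp: fractions_def)
  show ?case
  proof (cases "v = 0")
    case True
    thus ?thesis using d uv S by (intro bexI[of _ d]) (auto intro: poly_over_pCons subring_zero)
  next
    case False
    have "smult v (smult d p) \<in> poly_over S" by (rule poly_over_smult[OF S uv(2) d(3)])
    moreover have "d * v * a = d * u" using False uv(3) by simp
    ultimately have "smult (d * v) (pCons a p) \<in> poly_over S"
      using subring_mult[OF S d(1) uv(1)] by (auto intro!: poly_over_pCons[OF S] simp: mult_ac)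
    thus ?thesis using d(2) False subring_mult[OF S d(1) uv(2)] by (intro bexI[of _ "d * v"]) auto
  qed
qed

text \<open>An algebraic element is named by preimages of the coefficients of a polynomial that it is a root
  of, together with a number that distinguishes the finitely many roots of this polynomial.\<close>

lemma algebraic_elements_injection:
  fixes \<phi> :: "'b::comm_ring_1 \<Rightarrow> 'w::field"
  assumes \<phi>: "hom_on UNIV \<phi>" and E: "E \<subseteq> algebraic_over (fractions (range \<phi>))"
  obtains \<iota> :: "'w \<Rightarrow> 'b k_elem" where "inj_on \<iota> E"
proof -
  have S: "is_subring (range \<phi>)" by (rule is_subring_hom_image[OF is_subring_UNIV \<phi>])
  have "\<exists>l. Poly (map \<phi> l) \<noteq> 0 \<and> poly (Poly (map \<phi> l)) x = 0" if x: "x \<in> E" for x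
  proof -
    obtain p where p: "p \<in> poly_over (fractions (range \<phi>))" "p \<noteq> 0" "poly p x = 0"
      using x E by (auto simp: algebraic_over_def)
    obtain d where d: "d \<noteq> 0" "smult d p \<in> poly_over (range \<phi>)" using clear_denominators[OF S p(1)] by blast
    define q where "q = smult d p"
    have "set (coeffs q) \<subseteq> range \<phi>"
      using d(2) by (auto simp: q_def[symmetric] poly_over_def coeffs_def image_iff split: if_splits)
    then obtain l where "coeffs q = map \<phi> l" using ex_map_conv[of "coeffs q" \<phi>] by fastforce
    hence "Poly (map \<phi> l) = q" by (metis Poly_coeffs)
    thus ?thesis using p d by (intro exI[of _ l]) (auto simp: q_def)
  qed
  then obtain l where l: "\<And>x. x \<in> E \<Longrightarrow> Poly (map \<phi> (l x)) \<noteq> 0 \<and> poly (Poly (map \<phi> (l x))) x = 0" by metis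
  have "\<exists>g :: 'w \<Rightarrow> nat. inj_on g {x. poly p x = 0}" if "p \<noteq> 0" for p :: "'w poly"
    using finite_imp_inj_to_nat_seg[OF poly_roots_finite[OF that]] by blast
  then obtain g :: "'w poly \<Rightarrow> 'w \<Rightarrow> nat" where g: "\<And>p. p \<noteq> 0 \<Longrightarrow> inj_on (g p) {x. poly p x = 0}" by metis
  have "inj_on (\<lambda>x. (l x, g (Poly (map \<phi> (l x))) x)) E"
  proof (rule inj_onI)
    fix x y assume xy: "x \<in> E" "y \<in> E" "(l x, g (Poly (map \<phi> (l x))) x) = (l y, g (Poly (map \<phi> (l y))) y)"
    thus "x = y" using g[of "Poly (map \<phi> (l x))"] l[of x] l[of y] by (auto dest: inj_onD)
  qed
  thus ?thesis by (rule that)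
qed

lemma residue_eq: "residue \<alpha> f = (\<lambda>s. s + f) ` supp \<alpha>"
  by (auto simp: residue_def a_r_coset_def' )

context
  fixes \<alpha> :: "'b::comm_ring_1 set"
  assumes \<alpha>: "\<alpha> \<in> Spec_r UNIV"
begin

private lemma pc: "prime_cone UNIV \<alpha>" using \<alpha> by (simp add: Spec_r_def)

interpretation P: prime_ideal_in UNIV "supp \<alpha>"
  by (rule prime_ideal_supp[OF is_subring_UNIV pc])

lemma ideal_supp: "ideal (supp \<alpha>) type_ring"
proof (rule idealI)
  have r: "a * x \<in> supp \<alpha>" if "a \<in> supp \<alpha>" for a x
    using P.mult[OF _ that, of x] by (simp add: mult.commute)
  show "ring (type_ring :: 'b ring)" by (rule ring_from_type_algebra)
  then interpret ring "type_ring :: 'b ring" .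
  show "subgroup (supp \<alpha>) (add_monoid type_ring)"
  proof (rule add.subgroupI)
    show "supp \<alpha> \<noteq> {}" using P.zero by auto
    show "\<ominus>\<^bsub>type_ring\<^esub> a \<in> supp \<alpha>" if "a \<in> supp \<alpha>" for a
      using P.diff[OF P.zero that] by simp
  qed (auto intro: P.add)
  show "x \<otimes>\<^bsub>type_ring\<^esub> a \<in> supp \<alpha>" "a \<otimes>\<^bsub>type_ring\<^esub> x \<in> supp \<alpha>" if "a \<in> supp \<alpha>" for a x
    using r[OF that] P.mult[OF _ that] by simp_all
qed

lemma residue_eq_iff: "residue \<alpha> f = residue \<alpha> g \<longleftrightarrow> f - g \<in> supp \<alpha>"
proof
  assume "residue \<alpha> f = residue \<alpha> g"
  moreover have "f \<in> residue \<alpha> f" unfolding residue_eq using P.zero by force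
  ultimately obtain s where "s \<in> supp \<alpha>" "f = s + g" unfolding residue_eq by auto
  thus "f - g \<in> supp \<alpha>" by simp
next
  assume fg: "f - g \<in> supp \<alpha>"
  have sub: "residue \<alpha> f \<subseteq> residue \<alpha> g" if "f - g \<in> supp \<alpha>" for f g
  proof
    fix x assume "x \<in> residue \<alpha> f"
    then obtain s where "s \<in> supp \<alpha>" "x = s + f" unfolding residue_eq by auto
    hence "s + (f - g) \<in> supp \<alpha>" "x = s + (f - g) + g" using P.add that by auto
    thus "x \<in> residue \<alpha> g" unfolding residue_eq by blast
  qed
  have "g - f \<in> supp \<alpha>" using P.diff[OF P.zero fg] by simp
  thus "residue \<alpha> f = residue \<alpha> g" using sub fg by blast
qed

lemma residue_hom: "residue \<alpha> \<in> ring_hom type_ring (residue_ring \<alpha>)"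
  using ideal.rcos_ring_hom[OF ideal_supp] unfolding residue_def residue_ring_def by (simp add: fun_eq_iff)

lemma carrier_residue_ring: "carrier (residue_ring \<alpha>) = range (residue \<alpha>)"
  by (auto simp: residue_ring_def FactRing_def A_RCOSETS_def' residue_def)

text \<open>The real closed field \<open>E\<close> of \<open>real_closure_of_prime_cone\<close> is copied along an injection \<open>\<kappa>\<close>; the
  embedding \<open>j\<close> of the residue ring is induced by \<open>\<kappa> \<circ> \<phi>\<close>, whose kernel is the support.\<close>

lemma real_closure_at_exists:
  fixes \<iota> :: "'b \<Rightarrow> 'w::alg_closed_field"
  assumes \<iota>: "hom_on UNIV \<iota>" "\<And>x. \<iota> x = 0 \<Longrightarrow> x = 0"
  shows "\<exists>Kj :: 'b k_elem ring \<times> ('b set \<Rightarrow> 'b k_elem). is_real_closure_at \<alpha> (fst Kj) (snd Kj)"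
proof -
  obtain \<phi> :: "'b \<Rightarrow> 'w" and E where \<phi>: "hom_on UNIV \<phi>" and E: "real_closed_subfield E" and \<phi>E: "range \<phi> \<subseteq> E"
    and cone: "\<And>f. f \<in> \<alpha> \<longleftrightarrow> nonneg_in E (\<phi> f)" and alg: "E \<subseteq> algebraic_over (fractions (range \<phi>))"
    using real_closure_of_prime_cone[OF is_subring_UNIV pc \<iota>] by (metis UNIV_I)
  obtain \<kappa> :: "'w \<Rightarrow> 'b k_elem" where \<kappa>: "inj_on \<kappa> E" using algebraic_elements_injection[OF \<phi> alg] .
  interpret E: real_closed_subfield E by (rule E)
  interpret W: field "type_ring :: 'w ring" by (rule field_from_type_algebra)
  have sfE: "subfield E type_ring" using E.subfield subfield_type_ring_iff by blast
  interpret EF: field "sub_ring E" using W.subfield_iff(2)[OF sfE] .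
  define K where "K = image_ring \<kappa> (sub_ring E)"
  have \<kappa>': "inj_on \<kappa> (carrier (sub_ring E))" using \<kappa> by simp
  interpret K: field K unfolding K_def by (rule EF.inj_imp_image_ring_is_field[OF \<kappa>'])
  have iso: "\<kappa> \<in> ring_iso (sub_ring E) K" unfolding K_def by (rule inj_imp_image_ring_iso[OF \<kappa>'])
  hence hom: "\<kappa> \<in> ring_hom (sub_ring E) K" by (simp add: ring_iso_def)
  have cK: "carrier K = \<kappa> ` E" using iso by (auto simp: ring_iso_def bij_betw_def)
  have add: "\<kappa> (x + y) = \<kappa> x \<oplus>\<^bsub>K\<^esub> \<kappa> y" and mult: "\<kappa> (x * y) = \<kappa> x \<otimes>\<^bsub>K\<^esub> \<kappa> y" if "x \<in> E" "y \<in> E" for x y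
    using ring_hom_memE(2,3)[OF hom, of x y] that by auto
  have one: "\<kappa> 1 = \<one>\<^bsub>K\<^esub>" using ring_hom_memE(4)[OF hom] by simp
  note hs = ring_hom_sub_ring_sum[OF E.subring K.is_cring hom]
  have zero: "\<kappa> 0 = \<zero>\<^bsub>K\<^esub>" by (rule hs(4))
  have neg: "\<kappa> (- x) = \<ominus>\<^bsub>K\<^esub> \<kappa> x" if "x \<in> E" for x
  proof (rule K.minus_equality[symmetric])
    show "\<kappa> (- x) \<oplus>\<^bsub>K\<^esub> \<kappa> x = \<zero>\<^bsub>K\<^esub>" using add[of "- x" x] that E.closed(5) zero by simp
  qed (use that cK E.closed(5) in auto)
  have inv: "\<kappa> (inverse x) = inv\<^bsub>K\<^esub> \<kappa> x" if "x \<in> E" "x \<noteq> 0" for x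
  proof (rule K.comm_inv_char[symmetric])
    show "\<kappa> x \<otimes>\<^bsub>K\<^esub> \<kappa> (inverse x) = \<one>\<^bsub>K\<^esub>" using mult[of x "inverse x"] that E.closed(11) one by simp
  qed (use that cK E.closed(11) in auto)
  have eq_iff: "\<kappa> x = \<kappa> y \<longleftrightarrow> x = y" if "x \<in> E" "y \<in> E" for x y using \<kappa> that by (auto dest: inj_onD)
  have rcK: "real_closed K"
    unfolding real_closed_def
  proof (intro conjI ballI allI impI)
    show "field K" by (rule K.field_axioms)
    fix x assume "x \<in> carrier K"
    then obtain a where a: "a \<in> E" "x = \<kappa> a" by (auto simp: cK)
    show "\<ominus>\<^bsub>K\<^esub> \<one>\<^bsub>K\<^esub> \<noteq> x \<otimes>\<^bsub>K\<^esub> x"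
      using E.not_square_minus_one[OF a(1)] eq_iff[of "- 1" "a * a"] a E.closed
      by (simp add: neg[symmetric] one[symmetric] mult[symmetric])
    obtain y where y: "y \<in> E" "a = y * y \<or> a = - (y * y)" using E.square_or_minus_square[OF a(1)] by blast
    show "\<exists>y\<in>carrier K. x = y \<otimes>\<^bsub>K\<^esub> y \<or> x = \<ominus>\<^bsub>K\<^esub> (y \<otimes>\<^bsub>K\<^esub> y)"
      using y a by (intro bexI[of _ "\<kappa> y"]) (auto simp: cK mult[symmetric] neg[symmetric] E.closed(6))
    fix y assume "y \<in> carrier K"
    then obtain b where b: "b \<in> E" "y = \<kappa> b" by (auto simp: cK)
    obtain c where c: "c \<in> E" "a * a + b * b = c * c" using E.sum_of_squares[OF a(1) b(1)] by blast
    show "\<exists>z\<in>carrier K. x \<otimes>\<^bsub>K\<^esub> x \<oplus>\<^bsub>K\<^esub> y \<otimes>\<^bsub>K\<^esub> y = z \<otimes>\<^bsub>K\<^esub> z"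
    proof (rule bexI[of _ "\<kappa> c"])
      have "x \<otimes>\<^bsub>K\<^esub> x \<oplus>\<^bsub>K\<^esub> y \<otimes>\<^bsub>K\<^esub> y = \<kappa> (a * a + b * b)"
        using a b by (simp add: add mult E.closed(6))
      thus "x \<otimes>\<^bsub>K\<^esub> x \<oplus>\<^bsub>K\<^esub> y \<otimes>\<^bsub>K\<^esub> y = \<kappa> c \<otimes>\<^bsub>K\<^esub> \<kappa> c" using c by (simp add: mult)
    qed (use c cK in auto)
  next
    fix n :: nat and c assume c: "odd n \<and> c \<in> {..n} \<rightarrow> carrier K \<and> c n \<noteq> \<zero>\<^bsub>K\<^esub>"
    hence "\<forall>k\<in>{..n}. \<exists>a. a \<in> E \<and> c k = \<kappa> a" by (auto simp: cK Pi_iff)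
    then obtain a where a: "\<And>k. k \<le> n \<Longrightarrow> a k \<in> E \<and> c k = \<kappa> (a k)"
      using bchoice[of "{..n}" "\<lambda>k a. a \<in> E \<and> c k = \<kappa> a"] by auto
    define p where "p = (\<Sum>k\<le>n. Polynomial.monom (a k) k)"
    have cf: "Polynomial.coeff p i = (if i \<le> n then a i else 0)" for i
      by (simp add: p_def coeff_sum)
    have an: "a n \<noteq> 0" using c a[of n] zero by auto
    have "p \<in> poly_over E" using a E.closed(1) by (simp add: poly_over_def cf)
    moreover have "Polynomial.degree p = n"
      by (rule antisym) (auto intro!: degree_le le_degree simp: cf an)
    ultimately obtain x where x: "x \<in> E" "poly p x = 0" using E.odd_degree_root c by blast
    have "(\<Oplus>\<^bsub>K\<^esub>k\<in>{..n}. c k \<otimes>\<^bsub>K\<^esub> \<kappa> x [^]\<^bsub>K\<^esub> k) = (\<Oplus>\<^bsub>K\<^esub>k\<in>{..n}. \<kappa> (a k * x ^ k))"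
    proof (rule K.finsum_cong')
      show "(\<lambda>k. \<kappa> (a k * x ^ k)) \<in> {..n} \<rightarrow> carrier K" using a x E.closed(6,7) cK by auto
      show "c k \<otimes>\<^bsub>K\<^esub> \<kappa> x [^]\<^bsub>K\<^esub> k = \<kappa> (a k * x ^ k)" if "k \<in> {..n}" for k
        using a[of k] that x(1) by (simp add: mult hs(3) E.closed(7))
    qed simp
    also have "\<dots> = \<kappa> (\<Sum>k\<le>n. a k * x ^ k)"
      using a x(1) E.closed(6,7) by (intro hs(1)[symmetric]) auto
    also have "(\<Sum>k\<le>n. a k * x ^ k) = poly p x" by (simp add: p_def poly_sum poly_monom)
    finally have "(\<Oplus>\<^bsub>K\<^esub>k\<in>{..n}. c k \<otimes>\<^bsub>K\<^esub> \<kappa> x [^]\<^bsub>K\<^esub> k) = \<zero>\<^bsub>K\<^esub>" using x(2) zero by simp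
    thus "\<exists>x\<in>carrier K. (\<Oplus>\<^bsub>K\<^esub>k\<in>{..n}. c k \<otimes>\<^bsub>K\<^esub> x [^]\<^bsub>K\<^esub> k) = \<zero>\<^bsub>K\<^esub>"
      using x(1) cK by blast
  qed
  define j where "j Z = \<kappa> (\<phi> (SOME f. Z = residue \<alpha> f))" for Z
  have ker: "\<phi> f = 0 \<longleftrightarrow> f \<in> supp \<alpha>" for f
    using cone[of f] cone[of "- f"] hom_on_uminus[OF is_subring_UNIV \<phi>, of f] E.nonneg_antisym
    by (auto simp: supp_iff[OF is_subring_UNIV pc] E.nonneg_iff)
  have j: "j (residue \<alpha> f) = \<kappa> (\<phi> f)" for f
  proof -
    have "residue \<alpha> f = residue \<alpha> (SOME g. residue \<alpha> f = residue \<alpha> g)" by (rule someI) (rule refl)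
    hence "\<phi> (f - (SOME g. residue \<alpha> f = residue \<alpha> g)) = 0" using residue_eq_iff ker by blast
    hence "\<phi> f = \<phi> (SOME g. residue \<alpha> f = residue \<alpha> g)" by (simp add: hom_on_diff[OF is_subring_UNIV \<phi>])
    thus ?thesis by (simp add: j_def)
  qed
  have \<phi>m: "\<phi> f \<in> E" for f using \<phi>E by auto
  have j_img: "j ` carrier (residue_ring \<alpha>) = \<kappa> ` range \<phi>"
    unfolding carrier_residue_ring by (auto simp: j image_iff)
  have jh: "j \<in> ring_hom (residue_ring \<alpha>) K"
  proof (rule ring_hom_memI)
    have 1: "residue \<alpha> (f * g) = residue \<alpha> f \<otimes>\<^bsub>residue_ring \<alpha>\<^esub> residue \<alpha> g"
      "residue \<alpha> (f + g) = residue \<alpha> f \<oplus>\<^bsub>residue_ring \<alpha>\<^esub> residue \<alpha> g" for f g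
      using ring_hom_memE(2,3)[OF residue_hom, of f g] by simp_all
    fix x assume x: "x \<in> carrier (residue_ring \<alpha>)"
    then obtain f where f: "x = residue \<alpha> f" by (auto simp: carrier_residue_ring)
    show "j x \<in> carrier K" using \<phi>m cK by (simp add: f j)
    fix y assume "y \<in> carrier (residue_ring \<alpha>)"
    then obtain g where g: "y = residue \<alpha> g" by (auto simp: carrier_residue_ring)
    show "j (x \<otimes>\<^bsub>residue_ring \<alpha>\<^esub> y) = j x \<otimes>\<^bsub>K\<^esub> j y"
      unfolding f g 1[symmetric] j by (simp add: hom_on_mult[OF is_subring_UNIV \<phi>] mult \<phi>m)
    show "j (x \<oplus>\<^bsub>residue_ring \<alpha>\<^esub> y) = j x \<oplus>\<^bsub>K\<^esub> j y"
      unfolding f g 1[symmetric] j by (simp add: hom_on_add[OF is_subring_UNIV \<phi>] add \<phi>m)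
  next
    have "residue \<alpha> 1 = \<one>\<^bsub>residue_ring \<alpha>\<^esub>" using ring_hom_memE(4)[OF residue_hom] by simp
    thus "j \<one>\<^bsub>residue_ring \<alpha>\<^esub> = \<one>\<^bsub>K\<^esub>"
      using j[of 1] hom_on_one[OF is_subring_UNIV \<phi>] one by simp
  qed
  have "is_real_closure_at \<alpha> K j"
    unfolding is_real_closure_at_def
  proof (intro conjI rcK jh allI ballI)
    show "inj_on j (carrier (residue_ring \<alpha>))"
    proof (rule inj_onI)
      fix x y assume "x \<in> carrier (residue_ring \<alpha>)" "y \<in> carrier (residue_ring \<alpha>)" and jxy: "j x = j y"
      then obtain f g where fg: "x = residue \<alpha> f" "y = residue \<alpha> g" by (auto simp: carrier_residue_ring)
      hence "\<phi> (f - g) = 0" using jxy eq_iff[OF \<phi>m \<phi>m] by (simp add: j hom_on_diff[OF is_subring_UNIV \<phi>])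
      thus "x = y" using ker residue_eq_iff fg by blast
    qed
    show "f \<in> \<alpha> \<longleftrightarrow> (\<exists>y\<in>carrier K. j (residue \<alpha> f) = y \<otimes>\<^bsub>K\<^esub> y)" for f
      unfolding cone nonneg_in_def j cK using eq_iff[OF \<phi>m] by (auto simp: mult[symmetric] E.closed(6))
    fix x assume "x \<in> carrier K"
    then obtain e where e: "e \<in> E" "x = \<kappa> e" by (auto simp: cK)
    define F where "F = fractions (range \<phi>)"
    have img: "is_subring (range \<phi>)" by (rule is_subring_hom_image[OF is_subring_UNIV \<phi>])
    have F: "is_subfield F" unfolding F_def by (rule is_subfield_fractions[OF img])
    have FE: "F \<subseteq> E" using \<phi>m E.closed(12) by (auto simp: F_def fractions_def)
    have "(W.algebraic over F) e" using algebraic_type_ring_iff[OF F] alg e(1) F_def by blast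
    hence "(EF.algebraic over F) e" using W.algebraic_consistent[OF subfieldE(1)[OF sfE]] by simp
    moreover have "subfield F (sub_ring E)"
    proof (rule EF.subfield_iff(1))
      show "field (sub_ring E\<lparr>carrier := F\<rparr>)"
        using W.subfield_iff(2)[of F] F subfield_type_ring_iff by auto
    qed (use FE in simp)
    ultimately have a: "(K.algebraic over (\<kappa> ` F)) (\<kappa> e)"
      using algebraic_hom[OF hom EF.field_axioms K.field_axioms] e(1) by auto
    have "\<kappa> ` F \<subseteq> generate_field K (\<kappa> ` range \<phi>)"
    proof
      fix z assume "z \<in> \<kappa> ` F"
      then obtain u v where uv: "z = \<kappa> (\<phi> u / \<phi> v)" by (auto simp: F_def fractions_def)
      have in1: "\<kappa> (\<phi> w) \<in> generate_field K (\<kappa> ` range \<phi>)" for w by (rule generate_field.incl) auto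
      show "z \<in> generate_field K (\<kappa> ` range \<phi>)"
      proof (cases "\<phi> v = 0")
        case True
        thus ?thesis using in1[of 0] uv by (simp add: hom_on_zero[OF is_subring_UNIV \<phi>])
      next
        case False
        have "\<kappa> (\<phi> v) \<noteq> \<zero>\<^bsub>K\<^esub>" using False eq_iff[OF \<phi>m[of v] E.closed(1)] zero by simp
        hence "inv\<^bsub>K\<^esub> \<kappa> (\<phi> v) \<in> generate_field K (\<kappa> ` range \<phi>)"
          by (intro generate_field.m_inv in1)
        hence "\<kappa> (\<phi> u) \<otimes>\<^bsub>K\<^esub> inv\<^bsub>K\<^esub> \<kappa> (\<phi> v) \<in> generate_field K (\<kappa> ` range \<phi>)"
          by (intro generate_field.eng_mult in1)
        thus ?thesis using uv False by (simp add: divide_inverse mult inv \<phi>m E.closed(11))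
      qed
    qed
    thus "K.algebraic (generate_field K (j ` carrier (residue_ring \<alpha>))) x"
      using K.algebraic_mono[OF _ a] unfolding j_img e(2) over_def by blast
  qed
  thus ?thesis by (intro exI[of _ "(K, j)"]) simp
qed

end

lemma is_real_closure_at_k_model:
  fixes \<alpha> :: "('n::finite, 'a::field) mpoly set"
  assumes "\<alpha> \<in> Spec_r UNIV"
  shows "is_real_closure_at \<alpha> (fst (k_model \<alpha>)) (snd (k_model \<alpha>))"
proof -
  obtain \<iota> :: "('n, 'a) mpoly \<Rightarrow> 'a mpoly_closure" where "hom_on UNIV \<iota>" "\<And>f. \<iota> f = 0 \<Longrightarrow> f = 0"
    using mpoly_embedding by blast
  from real_closure_at_exists[OF assms this] show ?thesis
    unfolding k_model_def by (rule someI_ex)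
qed

context
  fixes \<alpha> :: "('n::finite, 'a::field) mpoly set"
  assumes \<alpha>: "\<alpha> \<in> Spec_r UNIV"
begin

private lemma k: "field (k_field \<alpha>)" "snd (k_model \<alpha>) \<in> ring_hom (residue_ring \<alpha>) (k_field \<alpha>)"
  "inj_on (snd (k_model \<alpha>)) (carrier (residue_ring \<alpha>))"
  using is_real_closure_at_k_model[OF \<alpha>] by (simp_all add: is_real_closure_at_def k_field_def real_closed_def)

lemma value_at_hom: "(\<lambda>f. value_at f \<alpha>) \<in> ring_hom (sub_ring UNIV) (k_field \<alpha>)"
proof -
  have "sub_ring UNIV = (type_ring :: ('n, 'a) mpoly ring)" by (simp add: ring_of_type_algebra_def)
  moreover have "(\<lambda>f. value_at f \<alpha>) = snd (k_model \<alpha>) \<circ> residue \<alpha>"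
    by (simp add: value_at_def fun_eq_iff)
  ultimately show ?thesis using ring_hom_trans[OF residue_hom[OF \<alpha>] k(2)] by metis
qed

lemma value_at_eq_zero_iff: "value_at f \<alpha> = \<zero>\<^bsub>k_field \<alpha>\<^esub> \<longleftrightarrow> f \<in> supp \<alpha>"
proof -
  interpret K: field "k_field \<alpha>" by (rule k(1))
  have "value_at 0 \<alpha> = \<zero>\<^bsub>k_field \<alpha>\<^esub>"
    by (rule ring_hom_sub_ring_sum(4)[OF is_subring_UNIV K.is_cring value_at_hom])
  moreover have "value_at f \<alpha> = value_at 0 \<alpha> \<longleftrightarrow> residue \<alpha> f = residue \<alpha> 0"
    unfolding value_at_def using inj_on_eq_iff[OF k(3)] by (simp add: carrier_residue_ring[OF \<alpha>])
  ultimately show ?thesis using residue_eq_iff[OF \<alpha>, of f 0] by simp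
qed

text \<open>Taking the value at \<open>\<alpha>\<close> is a ring homomorphism, and every polynomial is the result of inserting
  the variables into itself.\<close>

lemma k_eval_values: "k_eval \<alpha> f (\<lambda>i. value_at (Var i) \<alpha>) = value_at f \<alpha>"
proof -
  interpret K: field "k_field \<alpha>" by (rule k(1))
  note hs = ring_hom_sub_ring_sum[OF is_subring_UNIV K.is_cring value_at_hom]
  have c: "value_at g \<alpha> \<in> carrier (k_field \<alpha>)" for g
    using ring_hom_memE(1)[OF value_at_hom, of g] by simp
  have mult: "value_at (g * h) \<alpha> = value_at g \<alpha> \<otimes>\<^bsub>k_field \<alpha>\<^esub> value_at h \<alpha>" for g h
    using ring_hom_memE(2)[OF value_at_hom, of g h] by simp
  have "value_at f \<alpha> = value_at (\<Sum>m\<in>Poly_Mapping.keys f. Const (Poly_Mapping.lookup f m) * mono_val Var m) \<alpha>"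
    using mpoly_eq_sum_Const[of f] by simp
  also have "\<dots> = (\<Oplus>\<^bsub>k_field \<alpha>\<^esub>m\<in>Poly_Mapping.keys f. value_at (Const (Poly_Mapping.lookup f m) * mono_val Var m) \<alpha>)"
    by (rule hs(1)) auto
  also have "\<dots> = k_eval \<alpha> f (\<lambda>i. value_at (Var i) \<alpha>)"
    unfolding k_eval_def
  proof (intro K.finsum_cong' refl)
    fix m
    show "value_at (Const (Poly_Mapping.lookup f m) * mono_val Var m) \<alpha> =
      value_at (Const (Poly_Mapping.lookup f m)) \<alpha> \<otimes>\<^bsub>k_field \<alpha>\<^esub>
        (\<Otimes>\<^bsub>k_field \<alpha>\<^esub>i\<in>UNIV. value_at (Var i) \<alpha> [^]\<^bsub>k_field \<alpha>\<^esub> Poly_Mapping.lookup m i)"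
      by (subst mult, subst hs(2)) (auto simp: hs(3))
  qed (use c in \<open>auto intro!: K.m_closed K.finprod_closed K.nat_pow_closed\<close>)
  finally show ?thesis by simp
qed

lemma mem_tilde_iff: "\<alpha> \<in> tilde F \<longleftrightarrow> F \<subseteq> supp \<alpha>"
  using \<alpha> by (auto simp: tilde_def k_eval_values value_at_eq_zero_iff)

end

section \<open>Nonzero values of nonzero polynomials\<close>

text \<open>Take \<open>w i\<close> to be the power of \<open>t\<close> whose exponent is the number of the variable \<open>i\<close>.  Two monomials
  get the same weight only if \<open>t\<close> is a root of a certain nonzero integer polynomial, so all but
  finitely many \<open>t\<close> will do.\<close>

lemma separating_weights:
  assumes "finite (K :: ('n::finite \<Rightarrow>\<^sub>0 nat) set)"
  shows "\<exists>w :: 'n \<Rightarrow> nat. inj_on (\<lambda>m. \<Sum>i\<in>UNIV. Poly_Mapping.lookup m i * w i) K"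
proof -
  obtain idx :: "'n \<Rightarrow> nat" where idx: "inj idx"
    using finite_imp_inj_to_nat_seg[of "UNIV :: 'n set"] by auto
  define q :: "('n \<Rightarrow>\<^sub>0 nat) \<times> ('n \<Rightarrow>\<^sub>0 nat) \<Rightarrow> int poly" where
    "q mm = (\<Sum>i\<in>UNIV. monom (int (Poly_Mapping.lookup (fst mm) i) - int (Poly_Mapping.lookup (snd mm) i)) (idx i))" for mm
  have q: "q (m, m') \<noteq> 0" if "m \<noteq> m'" for m m'
  proof
    assume z: "q (m, m') = 0"
    have "coeff (q (m, m')) (idx i) = int (Poly_Mapping.lookup m i) - int (Poly_Mapping.lookup m' i)" for i
      using idx by (simp add: q_def coeff_sum inj_eq)
    hence "Poly_Mapping.lookup m i = Poly_Mapping.lookup m' i" for i using z by simp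
    thus False using that by (simp add: poly_mapping_eqI)
  qed
  define D where "D = {mm \<in> K \<times> K. fst mm \<noteq> snd mm}"
  have "finite D" using assms by (simp add: D_def)
  hence "(\<Prod>mm\<in>D. q mm) \<noteq> 0" using q by (auto simp: D_def)
  hence "finite {x. poly (\<Prod>mm\<in>D. q mm) x = 0}" by (rule poly_roots_finite)
  moreover have "infinite (range int)" by (simp add: finite_image_iff)
  ultimately obtain t :: nat where t: "poly (\<Prod>mm\<in>D. q mm) (int t) \<noteq> 0"
    by (metis (mono_tags, lifting) finite_subset image_subsetI mem_Collect_eq)
  have "inj_on (\<lambda>m. \<Sum>i\<in>UNIV. Poly_Mapping.lookup m i * t ^ idx i) K"
  proof (rule inj_onI, rule ccontr)
    fix m m' assume m: "m \<in> K" "m' \<in> K" "m \<noteq> m'"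
      and eq: "(\<Sum>i\<in>UNIV. Poly_Mapping.lookup m i * t ^ idx i) = (\<Sum>i\<in>UNIV. Poly_Mapping.lookup m' i * t ^ idx i)"
    have "poly (q (m, m')) (int t) =
      int (\<Sum>i\<in>UNIV. Poly_Mapping.lookup m i * t ^ idx i) - int (\<Sum>i\<in>UNIV. Poly_Mapping.lookup m' i * t ^ idx i)"
      by (simp add: q_def poly_sum poly_monom left_diff_distrib sum_subtractf)
    hence "poly (q (m, m')) (int t) = 0" using eq by simp
    moreover have "(m, m') \<in> D" using m by (simp add: D_def)
    ultimately show False using t \<open>finite D\<close> by (auto simp: poly_prod)
  qed
  thus ?thesis by (rule exI[of _ "\<lambda>i. t ^ idx i"])
qed

text \<open>Substituting \<open>t\<close> to the power \<open>w i\<close> for the variable \<open>i\<close>, with weights that separate the monomials of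
  \<open>f\<close>, gives a nonzero polynomial in \<open>t\<close>.\<close>

lemma nonzero_mpoly_eval:
  fixes f :: "('n::finite, 'a::field_char_0) mpoly"
  assumes "f \<noteq> 0" shows "\<exists>x. eval_at f x \<noteq> 0"
proof -
  obtain w :: "'n \<Rightarrow> nat" where w: "inj_on (\<lambda>m. \<Sum>i\<in>UNIV. Poly_Mapping.lookup m i * w i) (Poly_Mapping.keys f)"
    using separating_weights[of "Poly_Mapping.keys f"] by auto
  define e where "e m = (\<Sum>i\<in>UNIV. Poly_Mapping.lookup m i * w i)" for m
  define p where "p = (\<Sum>m\<in>Poly_Mapping.keys f. monom (Poly_Mapping.lookup f m) (e m))"
  obtain m0 where m0: "m0 \<in> Poly_Mapping.keys f" using assms by (metis ex_in_conv keys_eq_empty)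
  have "coeff p (e m0) = (\<Sum>m\<in>Poly_Mapping.keys f. if m = m0 then Poly_Mapping.lookup f m else 0)"
    unfolding p_def coeff_sum using inj_onD[OF w] m0 by (intro sum.cong) (auto simp: e_def)
  also have "\<dots> \<noteq> 0" using m0 by (simp add: in_keys_iff)
  finally have "p \<noteq> 0" by auto
  moreover have "infinite (UNIV :: 'a set)" by (rule infinite_UNIV_char_0)
  ultimately obtain t where t: "poly p t \<noteq> 0"
    using poly_roots_finite[of p] by (metis (mono_tags, lifting) UNIV_eq_I mem_Collect_eq)
  have "eval_at f (\<lambda>i. t ^ w i) = poly p t"
    unfolding eval_at_def p_def poly_sum poly_monom e_def
    by (intro sum.cong refl) (simp add: power_sum power_mult[symmetric] mult.commute)
  thus ?thesis using t by metis
qed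

lemma mpoly_mult_eq_0_iff: "f * g = 0 \<longleftrightarrow> f = 0 \<or> g = (0 :: ('n::finite, 'a::field) mpoly)"
proof -
  obtain \<iota> :: "('n, 'a) mpoly \<Rightarrow> 'a mpoly_closure" where \<iota>: "hom_on UNIV \<iota>" "\<And>f. \<iota> f = 0 \<Longrightarrow> f = 0"
    using mpoly_embedding by blast
  have "\<iota> f * \<iota> g = 0" if "f * g = 0"
    using hom_on_mult[OF is_subring_UNIV \<iota>(1), of f g] hom_on_zero[OF is_subring_UNIV \<iota>(1)] that by simp
  thus ?thesis using \<iota>(2) by auto
qed

section \<open>Transcendental arithmetical points and discrete orderings\<close>

lemma discretely_ordered_subring_is_subring:
  "discretely_ordered_subring M \<Longrightarrow> is_subring M"
  by (simp add: discretely_ordered_subring_def subring_type_ring_iff)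

text \<open>A nonzero \<open>f \<in> M[X]\<close> in the support would put \<open>\<alpha>\<close> on the tilde of the proper algebraic set where \<open>f\<close>
  vanishes.  The ordering compares \<open>f\<close> and \<open>g\<close> by means of \<open>g - f\<close>.\<close>

theorem transcendental_point_restriction:
  fixes M :: "'a::linordered_field set" and \<alpha> :: "('n::finite, 'a) mpoly set"
  assumes M: "is_subring M" and \<alpha>: "transcendental_arithmetical_point M \<alpha>"
  shows "supp (restrict_cone M \<alpha>) = {0}" and "is_discrete_positive_cone M (restrict_cone M \<alpha>)"
proof -
  let ?A = "polys_over M :: ('n, 'a) mpoly set"
  let ?\<alpha> = "restrict_cone M \<alpha>"
  have \<alpha>S: "\<alpha> \<in> Spec_r UNIV" and pc: "prime_cone ?A ?\<alpha>" and nonneg: "Const ` {c \<in> M. 0 \<le> c} \<subseteq> ?\<alpha>"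
    and supp0: "Const ` {c \<in> M. 0 \<le> c} \<inter> supp ?\<alpha> = {0}"
    and discr: "\<And>f. f \<in> ?A \<Longrightarrow> f \<in> ?\<alpha> \<Longrightarrow> f \<notin> supp ?\<alpha> \<Longrightarrow> f - 1 \<in> ?\<alpha>"
    and trans: "\<And>F. F \<subseteq> ?A \<Longrightarrow> zero_set F \<subset> UNIV \<Longrightarrow> \<alpha> \<notin> tilde F"
    using \<alpha> by (auto simp: transcendental_arithmetical_point_def arithmetical_point_def M_discrete_prime_cone_def Spec_r_def)
  note A = is_subring_polys_over[OF M, where 'n = 'n]
  note supp_iff' = supp_iff[OF A pc]
  have "f = 0" if "f \<in> supp ?\<alpha>" for f
  proof (rule ccontr)
    assume "f \<noteq> 0"
    then obtain x where "eval_at f x \<noteq> 0" using nonzero_mpoly_eval by blast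
    hence "zero_set {f} \<subset> UNIV" by (auto simp: zero_set_def)
    moreover have "{f} \<subseteq> ?A" "{f} \<subseteq> supp \<alpha>"
      using that by (auto simp: supp_iff' restrict_cone_def supp_iff[OF is_subring_UNIV] supp_def)
    ultimately show False using trans mem_tilde_iff[OF \<alpha>S] by blast
  qed
  moreover have "0 \<in> supp ?\<alpha>" using prime_cone_zero[OF A pc] by (simp add: supp_iff')
  ultimately show supp: "supp ?\<alpha> = {0}" by blast
  define leq where "leq f g \<longleftrightarrow> g - f \<in> ?\<alpha>" for f g
  have antisym: "f = 0" if "f \<in> ?\<alpha>" "- f \<in> ?\<alpha>" for f using that supp supp_iff' by blast
  have "ring_ordering ?A leq"
    unfolding ring_ordering_def leq_def
  proof (intro conjI ballI impI)
    fix f g assume fg: "f \<in> ?A" "g \<in> ?A"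
    show "g - f \<in> ?\<alpha> \<or> f - g \<in> ?\<alpha>"
      using prime_cone_total[OF A pc polys_over_diff[OF M fg]] by auto
    show "f = g" if "g - f \<in> ?\<alpha> \<and> f - g \<in> ?\<alpha>" using antisym[of "f - g"] that by simp
    show "f * g - 0 \<in> ?\<alpha>" if "f - 0 \<in> ?\<alpha> \<and> g - 0 \<in> ?\<alpha>" using that prime_cone_mult[OF A pc] by simp
    fix h
    show "h - f \<in> ?\<alpha>" if "g - f \<in> ?\<alpha> \<and> h - g \<in> ?\<alpha>"
      using prime_cone_add[OF A pc, of "g - f" "h - g"] that by simp
    show "g + h - (f + h) \<in> ?\<alpha>" if "g - f \<in> ?\<alpha>" using that by simp
  qed
  moreover have "\<not> (leq 0 f \<and> f \<noteq> 0 \<and> leq f 1 \<and> f \<noteq> 1)" if "f \<in> ?A" for f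
    using discr[OF that] antisym[of "f - 1"] supp by (auto simp: leq_def)
  ultimately have "discrete_ordering ?A leq" by (auto simp: discrete_ordering_def)
  moreover have "leq (Const a) (Const b) \<longleftrightarrow> a \<le> b" if ab: "a \<in> M" "b \<in> M" for a b
  proof -
    have d: "Const b - Const a = (Const (b - a) :: ('n, 'a) mpoly)"
      by (simp add: Const_def single_diff)
    have pos: "Const c \<in> ?\<alpha>" if "c \<in> M" "0 \<le> c" for c using nonneg that by auto
    show ?thesis
    proof
      assume "leq (Const a) (Const b)"
      hence c: "Const (b - a) \<in> ?\<alpha>" by (simp add: leq_def d)
      show "a \<le> b"
      proof (rule ccontr)
        assume ba: "\<not> a \<le> b"
        hence "- Const (b - a) \<in> ?\<alpha>" using pos[of "a - b"] subring_diff[OF M ab] 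
          by (simp add: Const_uminus[symmetric])
        hence "Const (b - a) = (0 :: ('n, 'a) mpoly)" using c antisym by blast
        thus False using ba by simp
      qed
    next
      assume "a \<le> b"
      thus "leq (Const a) (Const b)" using pos[of "b - a"] subring_diff[OF M ab(2,1)] by (simp add: leq_def d)
    qed
  qed
  moreover have "?\<alpha> = positive_cone ?A leq" by (auto simp: positive_cone_def leq_def restrict_cone_def)
  ultimately show "is_discrete_positive_cone M ?\<alpha>" unfolding is_discrete_positive_cone_def by blast
qed

text \<open>That the cone is prime depends on the absence of zero divisors: if \<open>f < 0\<close> and \<open>g > 0\<close>, then
  \<open>f * g \<ge> 0\<close> is possible only for \<open>f * g = 0\<close>.\<close>

lemma discrete_positive_cone:
  fixes M :: "'a::linordered_field set" and \<beta> :: "('n::finite, 'a) mpoly set"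
  assumes M: "is_subring M" and \<beta>: "is_discrete_positive_cone M \<beta>"
  shows "prime_cone (polys_over M) \<beta>" "supp \<beta> = {0}" "\<And>c. c \<in> M \<Longrightarrow> Const c \<in> \<beta> \<longleftrightarrow> 0 \<le> c"
    "\<And>f. f \<in> polys_over M \<Longrightarrow> f \<in> \<beta> \<Longrightarrow> f \<noteq> 0 \<Longrightarrow> f - 1 \<in> \<beta>"
proof -
  let ?A = "polys_over M :: ('n, 'a) mpoly set"
  note A = is_subring_polys_over[OF M, where 'n = 'n]
  note cl = subring_zero[OF A] subring_one[OF A] subring_add[OF A] subring_diff[OF A] subring_uminus[OF A] subring_mult[OF A]
  obtain leq where leq: "discrete_ordering ?A leq" "\<And>a b. a \<in> M \<Longrightarrow> b \<in> M \<Longrightarrow> leq (Const a) (Const b) \<longleftrightarrow> a \<le> b"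
    "\<beta> = positive_cone ?A leq"
    using \<beta> by (auto simp: is_discrete_positive_cone_def)
  have ord: "ring_ordering ?A leq" and discr: "\<And>a. a \<in> ?A \<Longrightarrow> leq 0 a \<Longrightarrow> leq a 1 \<Longrightarrow> a \<noteq> 0 \<Longrightarrow> a = 1"
    using leq(1) by (auto simp: discrete_ordering_def)
  have total: "\<And>x y. x \<in> ?A \<Longrightarrow> y \<in> ?A \<Longrightarrow> leq x y \<or> leq y x"
    and antisym: "\<And>x y. x \<in> ?A \<Longrightarrow> y \<in> ?A \<Longrightarrow> leq x y \<Longrightarrow> leq y x \<Longrightarrow> x = y"
    and trans: "\<And>x y z. x \<in> ?A \<Longrightarrow> y \<in> ?A \<Longrightarrow> z \<in> ?A \<Longrightarrow> leq x y \<Longrightarrow> leq y z \<Longrightarrow> leq x z"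
    and add: "\<And>x y z. x \<in> ?A \<Longrightarrow> y \<in> ?A \<Longrightarrow> z \<in> ?A \<Longrightarrow> leq x y \<Longrightarrow> leq (x + z) (y + z)"
    and mult: "\<And>x y. x \<in> ?A \<Longrightarrow> y \<in> ?A \<Longrightarrow> leq 0 x \<Longrightarrow> leq 0 y \<Longrightarrow> leq 0 (x * y)"
    using ord unfolding ring_ordering_def by blast+
  have mem: "f \<in> \<beta> \<longleftrightarrow> f \<in> ?A \<and> leq 0 f" for f by (simp add: leq(3) positive_cone_def)
  have neg: "- f \<in> \<beta> \<longleftrightarrow> leq f 0" if f: "f \<in> ?A" for f
    using add[OF f cl(1) cl(5)[OF f]] add[OF cl(1) cl(5)[OF f] f] f cl(5)[OF f] by (auto simp: mem)
  have tot: "f \<in> \<beta> \<or> - f \<in> \<beta>" if "f \<in> ?A" for f using total[OF cl(1) that] neg[OF that] that by (auto simp: mem)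
  have anti: "f = 0" if "f \<in> \<beta>" "- f \<in> \<beta>" for f
    using that antisym[of f 0] neg[of f] cl(1) by (auto simp: mem)
  have add0: "f + g \<in> \<beta>" if "f \<in> \<beta>" "g \<in> \<beta>" for f g
    using that add[of 0 f g] trans[of 0 g "f + g"] cl(1) cl(3)[of f g] by (auto simp: mem)
  have mult0: "f * g \<in> \<beta>" if "f \<in> \<beta>" "g \<in> \<beta>" for f g
    using that mult[of f g] cl(6)[of f g] by (auto simp: mem)
  have sq: "f * f \<in> \<beta>" if "f \<in> ?A" for f
    using tot[OF that] mult0[of f f] mult0[of "- f" "- f"] by auto
  have one: "1 \<in> \<beta>" using sq[OF cl(2)] by simp
  show "prime_cone ?A \<beta>"
    unfolding prime_cone_def
  proof (intro conjI ballI impI)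
    show "\<beta> \<subseteq> ?A" by (auto simp: mem)
    show "- 1 \<notin> \<beta>" using anti[OF one] by auto
    fix f g assume fg: "f \<in> ?A" "g \<in> ?A" "f * g \<in> \<beta>"
    show "f \<in> \<beta> \<or> - g \<in> \<beta>"
    proof (rule ccontr)
      assume n: "\<not> (f \<in> \<beta> \<or> - g \<in> \<beta>)"
      hence "- f \<in> \<beta>" "g \<in> \<beta>" using tot fg by blast+
      hence "- (f * g) \<in> \<beta>" using mult0[of "- f" g] by simp
      hence "f * g = 0" using anti fg(3) by blast
      hence "f = 0 \<or> g = 0" by (simp add: mpoly_mult_eq_0_iff)
      moreover have "0 \<in> \<beta>" using sq[OF cl(1)] by simp
      ultimately show False using n by auto
    qed
  qed (use add0 mult0 sq in auto)
  have "0 \<in> \<beta>" using sq[OF cl(1)] by simp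
  thus "supp \<beta> = {0}" using anti by (auto simp: supp_def)
  show "Const c \<in> \<beta> \<longleftrightarrow> 0 \<le> c" if "c \<in> M" for c
  proof -
    have "Const c \<in> ?A" using Const_in_polys_over[OF that subring_zero[OF M]] .
    thus ?thesis using leq(2)[OF subring_zero[OF M] that] by (simp add: mem)
  qed
  show "f - 1 \<in> \<beta>" if f: "f \<in> ?A" "f \<in> \<beta>" "f \<noteq> 0" for f
  proof (rule ccontr)
    assume n: "f - 1 \<notin> \<beta>"
    hence "leq (f - 1) 0" using tot[OF cl(4)[OF f(1) cl(2)]] neg[OF cl(4)[OF f(1) cl(2)]] by auto
    hence "leq f 1" using add[OF cl(4)[OF f(1) cl(2)] cl(1) cl(2)] by simp
    hence "f = 1" using discr[OF f(1)] f(2,3) by (auto simp: mem)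
    thus False using n \<open>0 \<in> \<beta>\<close> by simp
  qed
qed

text \<open>If \<open>\<alpha>\<close> lies on the tilde of the zero set of \<open>F \<subseteq> M[X]\<close>, then \<open>F\<close> is in the support of the
  restriction, which is \<open>0\<close>; so the zero set of \<open>F\<close> is not a proper subset.\<close>

lemma transcendental_point_if_restriction:
  fixes M :: "'a::linordered_field set" and \<alpha> :: "('n::finite, 'a) mpoly set"
  assumes M: "is_subring M" and \<alpha>: "\<alpha> \<in> Spec_r UNIV" and \<beta>: "is_discrete_positive_cone M (restrict_cone M \<alpha>)"
  shows "transcendental_arithmetical_point M \<alpha>"
proof -
  let ?A = "polys_over M :: ('n, 'a) mpoly set"
  note b = discrete_positive_cone[OF M \<beta>]
  have "Const ` {c \<in> M. 0 \<le> c} \<inter> supp (restrict_cone M \<alpha>) = {0}"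
    using subring_zero[OF M] by (auto simp: b(2) intro!: image_eqI[of _ _ 0])
  hence "M_discrete_prime_cone M ?A (restrict_cone M \<alpha>)"
    unfolding M_discrete_prime_cone_def using b by (auto simp: Spec_r_def)
  moreover have "\<alpha> \<notin> tilde F" if F: "F \<subseteq> ?A" "zero_set F \<subset> UNIV" for F
  proof
    assume "\<alpha> \<in> tilde F"
    hence "F \<subseteq> supp \<alpha>" using mem_tilde_iff[OF \<alpha>] by simp
    hence F0: "f = 0" if "f \<in> F" for f
      using that F(1) b(2) is_subring_polys_over[OF M, where 'n = 'n, THEN subring_uminus]
      by (fastforce simp: supp_def restrict_cone_def)
    have "eval_at f x = 0" if "f \<in> F" for f x using F0[OF that] by (simp add: eval_at_def)
    hence "zero_set F = UNIV" by (simp add: zero_set_def)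
    thus False using F(2) by simp
  qed
  ultimately show ?thesis using \<alpha> by (auto simp: transcendental_arithmetical_point_def arithmetical_point_def)
qed

section \<open>Two real closed fields over a common ordered ring\<close>

lemma sum_reversed_powers:
  assumes "(x :: 'a::field) \<noteq> 0"
  shows "(\<Sum>i\<le>degree p. coeff p i * x ^ (2 * degree p - i)) =
    x ^ (2 * degree p) * poly p (inverse x)"
  unfolding poly_altdef sum_distrib_left
proof (intro sum.cong refl)
  fix i assume "i \<in> {..degree p}"
  hence "x ^ (2 * degree p - i) = x ^ (2 * degree p) / x ^ i"
    using assms by (intro power_diff) auto
  thus "coeff p i * x ^ (2 * degree p - i) =
    x ^ (2 * degree p) * (coeff p i * inverse x ^ i)"
    by (simp add: divide_inverse power_inverse)
qed

text \<open>The ordered ring \<open>N\<close> is a subring of the real closed field \<open>E\<close> and is embedded by \<open>\<nu>\<close> into a second one,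
  \<open>E1\<close>.  The question is which points \<open>s\<close> of \<open>E1\<close> resemble a given \<open>r \<in> E\<close> in the eyes of \<open>N\<close>.\<close>

locale order_embedding = R: real_closed_subfield E + K: real_closed_subfield E1
  for E :: "'k::field set" and E1 :: "'w::field set" +
  fixes N :: "'k set" and \<nu> :: "'k \<Rightarrow> 'w"
  assumes N: "is_subring N" and NE: "N \<subseteq> E" and \<nu>: "hom_on N \<nu>"
    and \<nu>_mem: "c \<in> N \<Longrightarrow> \<nu> c \<in> E1"
    and \<nu>_nonneg: "c \<in> N \<Longrightarrow> nonneg_in E1 (\<nu> c) \<longleftrightarrow> nonneg_in E c"
begin

lemma \<nu>_eq_zero_iff: "c \<in> N \<Longrightarrow> \<nu> c = 0 \<longleftrightarrow> c = 0"
proof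
  assume c: "c \<in> N" "\<nu> c = 0"
  hence "\<nu> (- c) = 0" by (simp add: hom_on_uminus[OF N \<nu>])
  hence "nonneg_in E c" "nonneg_in E (- c)"
    using \<nu>_nonneg[OF c(1)] \<nu>_nonneg[OF subring_uminus[OF N c(1)]] c(2) by (simp_all add: K.nonneg_iff)
  thus "c = 0" by (rule R.nonneg_antisym)
qed (simp add: hom_on_zero[OF N \<nu>])

lemma \<nu>_pos: "c \<in> N \<Longrightarrow> pos_in E1 (\<nu> c) \<longleftrightarrow> pos_in E c"
  using \<nu>_nonneg[of c] \<nu>_eq_zero_iff[of c] by (auto simp: pos_in_def)

lemma \<nu>_pos_diff: "a \<in> N \<Longrightarrow> b \<in> N \<Longrightarrow> pos_in E1 (\<nu> a - \<nu> b) \<longleftrightarrow> pos_in E (a - b)"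
  using \<nu>_pos[of "a - b"] subring_diff[OF N] by (simp add: hom_on_diff[OF N \<nu>])

lemma \<nu>_poly: "g \<in> poly_over N \<Longrightarrow> a \<in> N \<Longrightarrow> poly (map_poly \<nu> g) (\<nu> a) = \<nu> (poly g a)"
  by (rule hom_on_poly[OF N \<nu>, symmetric])

lemma over_E: "g \<in> poly_over N \<Longrightarrow> g \<in> poly_over E"
  using poly_over_mono[OF NE] by blast

lemma map_over_E1: "g \<in> poly_over N \<Longrightarrow> map_poly \<nu> g \<in> poly_over E1"
  by (rule map_poly_hom_over[OF N \<nu>]) (auto intro: \<nu>_mem)

lemma \<nu>_poly_pos: "g \<in> poly_over N \<Longrightarrow> a \<in> N \<Longrightarrow>
    pos_in E1 (poly (map_poly \<nu> g) (\<nu> a)) \<longleftrightarrow> pos_in E (poly g a)"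
  by (simp add: \<nu>_poly \<nu>_pos poly_in_subring[OF N])

lemma \<nu>_poly_pos2: "g \<in> poly_over N \<Longrightarrow> a \<in> N \<Longrightarrow> b \<in> N \<Longrightarrow>
    pos_in E1 (poly (map_poly \<nu> g) (\<nu> a) * poly (map_poly \<nu> g) (\<nu> b)) \<longleftrightarrow> pos_in E (poly g a * poly g b)"
  using \<nu>_pos[of "poly g a * poly g b"]
  by (simp add: \<nu>_poly hom_on_mult[OF N \<nu>] subring_mult[OF N] poly_in_subring[OF N])

lemma map_poly_pderiv: "g \<in> poly_over N \<Longrightarrow> map_poly \<nu> (pderiv g) = pderiv (map_poly \<nu> g)"
proof (rule poly_eqI)
  fix i assume g: "g \<in> poly_over N"
  have "\<nu> (of_nat n) = of_nat n" for n
    by (induction n) (simp_all add: hom_on_zero[OF N \<nu>] hom_on_one[OF N \<nu>] hom_on_add[OF N \<nu>] subring_of_nat[OF N] subring_one[OF N])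
  thus "coeff (map_poly \<nu> (pderiv g)) i = coeff (pderiv (map_poly \<nu> g)) i"
    using g by (simp add: coeff_map_hom[OF N \<nu>] coeff_pderiv hom_on_mult[OF N \<nu>] coeff_poly_over
        subring_of_nat[OF N] del: of_nat_Suc)
qed

lemma derivs_over: "g \<in> poly_over N \<Longrightarrow> (pderiv ^^ k) g \<in> poly_over N"
  by (induction k) (auto intro: poly_over_pderiv[OF N])

lemma map_poly_derivs: "g \<in> poly_over N \<Longrightarrow> map_poly \<nu> ((pderiv ^^ k) g) = (pderiv ^^ k) (map_poly \<nu> g)"
  by (induction k) (simp_all add: map_poly_pderiv derivs_over)

lemma map_poly_eq_0_iff: "g \<in> poly_over N \<Longrightarrow> map_poly \<nu> g = 0 \<longleftrightarrow> g = 0"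
  by (auto simp: poly_eq_iff coeff_map_hom[OF N \<nu>] \<nu>_eq_zero_iff coeff_poly_over)

text \<open>Negative values are covered by applying this to \<open>- g\<close>.\<close>

definition matches :: "'k \<Rightarrow> 'w \<Rightarrow> 'k poly \<Rightarrow> bool" where
  "matches r s g \<longleftrightarrow> (poly g r = 0 \<longrightarrow> poly (map_poly \<nu> g) s = 0) \<and>
     (pos_in E (poly g r) \<longrightarrow> pos_in E1 (poly (map_poly \<nu> g) s))"

text \<open>Multiplying \<open>g(1/c)\<close> by \<open>c\<close> to the power \<open>2 * degree g\<close> leads back to \<open>N\<close> without changing the sign.\<close>

lemma match_inverse:
  assumes c: "c \<in> N" "c \<noteq> 0" and g: "g \<in> poly_over N"
  shows "matches (inverse c) (inverse (\<nu> c)) g"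
proof -
  let ?n = "degree g"
  define d where "d = (\<Sum>i\<le>?n. coeff g i * c ^ (2 * ?n - i))"
  have dN: "d \<in> N" unfolding d_def
    by (intro subring_sum subring_mult subring_power N c coeff_poly_over g)
  have \<nu>c: "\<nu> c \<noteq> 0" using \<nu>_eq_zero_iff c by simp
  have d: "d = c ^ (2 * ?n) * poly g (inverse c)"
    unfolding d_def by (rule sum_reversed_powers[OF c(2)])
  have "degree (map_poly \<nu> g) = ?n"
  proof (cases "g = 0")
    case False
    hence "coeff (map_poly \<nu> g) ?n \<noteq> 0"
      by (simp add: coeff_map_hom[OF N \<nu>] \<nu>_eq_zero_iff coeff_poly_over g)
    thus ?thesis using le_degree map_poly_degree_leq[of \<nu> g] by fastforce
  qed simp
  moreover have "\<nu> d = (\<Sum>i\<le>?n. coeff (map_poly \<nu> g) i * \<nu> c ^ (2 * ?n - i))"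
    unfolding d_def
    by (subst hom_on_sum[OF N \<nu>])
      (simp_all add: coeff_map_hom[OF N \<nu>] hom_on_mult[OF N \<nu>] hom_on_power[OF N \<nu>] coeff_poly_over[OF g]
        subring_power[OF N] subring_mult[OF N] c(1))
  ultimately have "\<nu> d = \<nu> c ^ (2 * ?n) * poly (map_poly \<nu> g) (inverse (\<nu> c))"
    using sum_reversed_powers[OF \<nu>c, of "map_poly \<nu> g"] by simp
  moreover have "pos_in E (c ^ (2 * ?n))" "pos_in E1 (\<nu> c ^ (2 * ?n))"
    using R.pos_square[of "c ^ ?n"] K.pos_square[of "\<nu> c ^ ?n"] c NE \<nu>c \<nu>_mem[OF c(1)]
    by (auto simp: mult_2 power_add R.closed(7) K.closed(7))
  ultimately show ?thesis
    using d \<nu>_eq_zero_iff[OF dN] \<nu>_pos[OF dN] R.pos_mult K.pos_mult_cancel c(2) \<nu>c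
    unfolding matches_def by auto
qed

context
  assumes field: "is_subfield N"
begin

lemma degree_derivs: "degree ((pderiv ^^ k) (h :: 'k poly)) \<le> degree h - k"
proof (induction k)
  case (Suc k)
  have "degree (pderiv p) \<le> degree p - 1" for p :: "'k poly"
    by (rule degree_le) (auto simp: coeff_pderiv coeff_eq_0)
  from this[of "(pderiv ^^ k) h"] show ?case using Suc by simp
qed simp

lemma derivs_eventually_zero: "k > degree (h :: 'k poly) \<Longrightarrow> (pderiv ^^ k) h = 0"
proof -
  assume k: "k > degree h"
  then obtain k' where k': "k = Suc k'" "k' \<ge> degree h" by (cases k) auto
  hence "degree ((pderiv ^^ k') h) = 0" using degree_derivs[of k' h] by simp
  then obtain c where "(pderiv ^^ k') h = [:c:]" using degree_eq_zeroE by blast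
  thus ?thesis by (simp add: k'(1) pderiv_pCons)
qed

text \<open>The derivatives of \<open>h\<close> have only finitely many roots in \<open>E\<close>.  By hypothesis these lie in \<open>N\<close>, and so
  \<open>r\<close> can be isolated from them by elements of \<open>N\<close>.\<close>

lemma isolating_interval:
  assumes r: "r \<in> E" "r \<notin> N" and p: "p \<in> poly_over N" "p \<noteq> 0" "poly p r = 0"
    and h: "h \<in> poly_over N" "h \<noteq> 0"
    and roots: "\<forall>g\<in>poly_over N. \<forall>z\<in>E. g \<noteq> 0 \<and> degree g \<le> degree h \<and> poly g z = 0 \<longrightarrow> z \<in> N"
    and Z0: "finite Z0" "Z0 \<subseteq> N"
  obtains a b where "a \<in> N" "b \<in> N" "pos_in E (r - a)" "pos_in E (b - r)"
    "\<forall>z\<in>Z0. pos_in E (r - z) \<longrightarrow> pos_in E (a - z)" "\<forall>z\<in>Z0. pos_in E (z - r) \<longrightarrow> pos_in E (z - b)"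
    "\<forall>k x y. (pderiv ^^ k) h \<noteq> 0 \<and> nonneg_in E (x - a) \<and> nonneg_in E (b - x) \<and>
       nonneg_in E (y - a) \<and> nonneg_in E (b - y) \<longrightarrow>
       pos_in E (poly ((pderiv ^^ k) h) x * poly ((pderiv ^^ k) h) y)"
proof -
  define Z where "Z = Z0 \<union> (\<Union>k\<in>{k. k \<le> degree h \<and> (pderiv ^^ k) h \<noteq> 0}. {z \<in> E. poly ((pderiv ^^ k) h) z = 0})"
  have "finite Z" unfolding Z_def using Z0(1) by (auto intro: finite_subset[OF _ poly_roots_finite])
  moreover have "Z \<subseteq> N"
  proof
    fix z assume "z \<in> Z"
    thus "z \<in> N" unfolding Z_def
    proof (elim UnE UN_E)
      fix k assume k: "k \<in> {k. k \<le> degree h \<and> (pderiv ^^ k) h \<noteq> 0}" and z: "z \<in> {z \<in> E. poly ((pderiv ^^ k) h) z = 0}"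
      have "degree ((pderiv ^^ k) h) \<le> degree h" using degree_derivs[of k h] by simp
      thus "z \<in> N" using roots derivs_over[OF h(1), of k] k z by blast
    qed (use Z0 in auto)
  qed
  ultimately obtain a b where a: "a \<in> N" "pos_in E (r - a)" "\<forall>z\<in>Z. pos_in E (r - z) \<longrightarrow> pos_in E (a - z)"
    and b: "b \<in> N" "pos_in E (b - r)" "\<forall>z\<in>Z. pos_in E (z - r) \<longrightarrow> pos_in E (z - b)"
    using R.isolating_lower[OF field NE r(1) p] R.isolating_upper[OF field NE r(1) p] by metis
  have noZ: "z \<notin> Z" if "nonneg_in E (z - a)" "nonneg_in E (b - z)" for z
  proof
    assume z: "z \<in> Z"
    hence zE: "z \<in> E" "r - z \<in> E" "r \<noteq> z" using \<open>Z \<subseteq> N\<close> NE r R.closed(4) by auto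
    hence "pos_in E (r - z) \<or> pos_in E (z - r)" using R.trichotomy[of "r - z"] by auto
    thus False
    proof
      assume "pos_in E (r - z)"
      hence "pos_in E (a - z)" using a(3) z by blast
      thus False using R.pos_add_nonneg[OF _ that(1), of "a - z"] R.not_pos_zero by simp
    next
      assume "pos_in E (z - r)"
      hence "pos_in E (z - b)" using b(3) z by blast
      thus False using R.pos_add_nonneg[OF _ that(2), of "z - b"] R.not_pos_zero by simp
    qed
  qed
  have mem: "x \<in> E" if "nonneg_in E (x - a)" for x
    using R.nonneg_mem[OF that] R.closed(3)[of "x - a" a] a(1) NE by auto
  show ?thesis
  proof (rule that[OF a(1) b(1) a(2) b(2)]; (intro allI impI)?)
    show "\<forall>z\<in>Z0. pos_in E (r - z) \<longrightarrow> pos_in E (a - z)" using a(3) by (simp add: Z_def)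
    show "\<forall>z\<in>Z0. pos_in E (z - r) \<longrightarrow> pos_in E (z - b)" using b(3) by (simp add: Z_def)
    fix k x y assume A: "(pderiv ^^ k) h \<noteq> 0 \<and> nonneg_in E (x - a) \<and> nonneg_in E (b - x) \<and>
      nonneg_in E (y - a) \<and> nonneg_in E (b - y)"
    hence k: "(pderiv ^^ k) h \<noteq> 0" and xy: "nonneg_in E (x - a)" "nonneg_in E (b - x)" "nonneg_in E (y - a)" "nonneg_in E (b - y)"
      by auto
    have "k \<le> degree h" using k derivs_eventually_zero[of h k] by (meson not_le)
    hence nz: "poly ((pderiv ^^ k) h) z \<noteq> 0" if "nonneg_in E (z - a)" "nonneg_in E (b - z)" for z
      using noZ[OF that] mem[OF that(1)] k by (auto simp: Z_def)
    show "pos_in E (poly ((pderiv ^^ k) h) x * poly ((pderiv ^^ k) h) y)"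
    proof (rule R.no_root_same_sign[OF over_E[OF derivs_over[OF h(1)]] mem[OF xy(1)] mem[OF xy(3)] nz[OF xy(1,2)] nz[OF xy(3,4)]])
      fix c assume "pos_in E (c - x) \<and> pos_in E (y - c) \<or> pos_in E (c - y) \<and> pos_in E (x - c)"
      hence "nonneg_in E (c - a) \<and> nonneg_in E (b - c)"
        using R.nonneg_add[of "c - x" "x - a"] R.nonneg_add[of "y - c" "b - y"]
          R.nonneg_add[of "c - y" "y - a"] R.nonneg_add[of "x - c" "b - x"] xy
        by (auto simp: R.nonneg_iff)
      thus "poly ((pderiv ^^ k) h) c \<noteq> 0" using nz by blast
    qed
  qed
qed

lemma same_sign_transfer:
  assumes h: "h \<in> poly_over N" "h \<noteq> 0" and ab: "a \<in> N" "b \<in> N" "pos_in E (b - a)"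
    and derivs: "\<And>k. (pderiv ^^ k) h \<noteq> 0 \<Longrightarrow> pos_in E (poly ((pderiv ^^ k) h) a * poly ((pderiv ^^ k) h) b)"
    and x: "nonneg_in E1 (x - \<nu> a)" "nonneg_in E1 (\<nu> b - x)"
  shows "pos_in E1 (poly (map_poly \<nu> h) (\<nu> a) * poly (map_poly \<nu> h) x)"
proof (rule K.same_sign_if_derivatives[OF \<nu>_mem[OF ab(1)] \<nu>_mem[OF ab(2)] _ map_over_E1[OF h(1)] _ _ x])
  show "pos_in E1 (\<nu> b - \<nu> a)" using \<nu>_pos_diff ab by simp
  show "map_poly \<nu> h \<noteq> 0" using map_poly_eq_0_iff h by simp
  fix k assume "(pderiv ^^ k) (map_poly \<nu> h) \<noteq> 0"
  hence "(pderiv ^^ k) h \<noteq> 0" using map_poly_derivs[OF h(1), of k] by auto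
  thus "pos_in E1 (poly ((pderiv ^^ k) (map_poly \<nu> h)) (\<nu> a) * poly ((pderiv ^^ k) (map_poly \<nu> h)) (\<nu> b))"
    using derivs \<nu>_poly_pos2[OF derivs_over[OF h(1)] ab(1,2)] by (simp add: map_poly_derivs[OF h(1)])
qed

text \<open>By hypothesis the polynomials over \<open>N\<close> of smaller degree than \<open>f\<close> have all their roots in \<open>N\<close>.  In
  particular \<open>f'\<close> has no root near \<open>r\<close>; so \<open>f\<close> is monotone on an interval with ends in \<open>N\<close> and
  changes its sign there.  As the signs of the derivatives at the ends are the same in \<open>E1\<close>, the
  image of \<open>f\<close> is monotone there too and has exactly one root \<open>s\<close> in the corresponding interval.
  Whether an element of \<open>N\<close> lies below \<open>r\<close>, or below \<open>s\<close>, is visible from the sign of \<open>f\<close>; so \<open>r\<close> and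
  \<open>s\<close> fill the same cut.  Finally, the sign of \<open>g(r)\<close> is that of the remainder of \<open>g\<close> modulo \<open>f\<close>, which
  has constant sign on an interval around \<open>r\<close> with ends in \<open>N\<close>, and this is again certified by
  derivatives.\<close>

lemma match_algebraic:
  assumes r: "r \<in> E" "r \<notin> N" and f: "min_poly_over N r f"
    and roots: "\<And>g z. g \<in> poly_over N \<Longrightarrow> g \<noteq> 0 \<Longrightarrow> degree g < degree f \<Longrightarrow> z \<in> E \<Longrightarrow> poly g z = 0 \<Longrightarrow> z \<in> N"
  obtains s where "s \<in> E1" "\<And>g. g \<in> poly_over N \<Longrightarrow> matches r s g"
proof -
  have f0: "f \<in> poly_over N" "f \<noteq> 0" "poly f r = 0" using f by (auto simp: min_poly_over_def)
  note pE = poly_in_subring[OF R.subring] and pE1 = poly_in_subring[OF K.subring]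
  have degf: "degree f > 0"
  proof (rule ccontr)
    assume "\<not> degree f > 0"
    then obtain c where "f = [:c:]" using degree_eq_zeroE by blast
    thus False using f0 by auto
  qed
  have f': "pderiv f \<in> poly_over N" "pderiv f \<noteq> 0" "degree (pderiv f) < degree f"
    using poly_over_pderiv[OF N f0(1)] R.pderiv_nonzero[OF over_E[OF f0(1)] degf] R.degree_pderiv_less[OF degf] by auto
  have roots': "\<forall>g\<in>poly_over N. \<forall>z\<in>E. g \<noteq> 0 \<and> degree g \<le> degree (pderiv f) \<and> poly g z = 0 \<longrightarrow> z \<in> N"
    using roots f'(3) by (meson le_less_trans)
  obtain a b where ab: "a \<in> N" "b \<in> N" "pos_in E (r - a)" "pos_in E (b - r)"
    and sgn': "\<forall>k x y. (pderiv ^^ k) (pderiv f) \<noteq> 0 \<and> nonneg_in E (x - a) \<and> nonneg_in E (b - x) \<and>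
       nonneg_in E (y - a) \<and> nonneg_in E (b - y) \<longrightarrow>
       pos_in E (poly ((pderiv ^^ k) (pderiv f)) x * poly ((pderiv ^^ k) (pderiv f)) y)"
    by (rule isolating_interval[OF r f0 f'(1,2) roots' finite.emptyI empty_subsetI])
  note sgn = sgn'[rule_format, OF conjI, OF _ conjI, OF _ _ conjI, OF _ _ _ conjI]
  have aE: "a \<in> E" "b \<in> E" using ab NE by auto
  have ba: "pos_in E (b - a)" using R.pos_diff_trans[OF ab(3,4)] .
  have nn: "nonneg_in E (a - a)" "nonneg_in E (b - b)" "nonneg_in E (b - a)" using ba by (simp_all add: R.nonneg_iff)
  \<comment> \<open>Changing the sign of \<open>f\<close> if necessary, it increases on the interval.\<close>
  define \<epsilon> where "\<epsilon> = (if pos_in E (poly (pderiv f) a) then 1 else - 1 :: 'k)"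
  define F where "F = smult \<epsilon> f"
  have \<epsilon>: "\<epsilon> \<in> N" "\<epsilon> = 1 \<or> \<epsilon> = - 1" using subring_one[OF N] subring_uminus[OF N] by (auto simp: \<epsilon>_def)
  have FN: "F \<in> poly_over N" unfolding F_def by (rule poly_over_smult[OF N \<epsilon>(1) f0(1)])
  have Fr: "poly F r = 0" using f0(3) by (simp add: F_def)
  have F'a: "pos_in E (poly (pderiv F) a)"
  proof -
    have "poly (pderiv f) a \<in> E" using pE[OF over_E[OF f'(1)] aE(1)] .
    moreover have "poly (pderiv f) a \<noteq> 0" using sgn[of 0 a a] f'(2) nn R.not_pos_zero by auto
    ultimately show ?thesis using R.trichotomy[of "poly (pderiv f) a"] by (auto simp: F_def \<epsilon>_def pderiv_smult)
  qed
  have derivsF: "(pderiv ^^ k) (pderiv F) = smult \<epsilon> ((pderiv ^^ k) (pderiv f))" for k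
    by (induction k) (simp_all add: F_def pderiv_smult)
  have eps2: "\<epsilon> * u * (\<epsilon> * v) = u * v" for u v using \<epsilon>(2) by auto
  have sgnF: "pos_in E (poly ((pderiv ^^ k) (pderiv F)) x * poly ((pderiv ^^ k) (pderiv F)) y)"
    if "(pderiv ^^ k) (pderiv F) \<noteq> 0" "nonneg_in E (x - a)" "nonneg_in E (b - x)" "nonneg_in E (y - a)" "nonneg_in E (b - y)" for k x y
    using sgn[OF _ that(2-5), of k] that(1) unfolding derivsF by (auto simp: eps2)
  have F'0: "pderiv F \<noteq> 0" "pderiv F \<in> poly_over N" using F'a R.not_pos_zero poly_over_pderiv[OF N FN] by auto
  have inc: "pos_in E (poly F y - poly F x)"
    if "nonneg_in E (x - a)" "nonneg_in E (b - y)" "pos_in E (y - x)" "x \<in> E" "y \<in> E" for x y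
  proof (rule R.strictly_increasing[OF over_E[OF FN] that(4,5,3)])
    fix z assume z: "nonneg_in E (z - x)" "nonneg_in E (y - z)"
    have "nonneg_in E (z - a)" "nonneg_in E (b - z)"
      using R.nonneg_add[OF z(1) that(1)] R.nonneg_add[OF z(2) that(2)] by simp_all
    hence "pos_in E (poly (pderiv F) a * poly (pderiv F) z)" using sgnF[of 0 a z] F'0 nn by simp
    thus "pos_in E (poly (pderiv F) z)" using R.pos_mult_cancel F'a by blast
  qed
  have below: "pos_in E (- poly F x)" if "nonneg_in E (x - a)" "pos_in E (r - x)" "x \<in> E" for x
    using inc[OF that(1) _ that(2,3) r(1)] ab(4) Fr by (simp add: R.nonneg_iff)
  have above: "pos_in E (poly F x)" if "nonneg_in E (b - x)" "pos_in E (x - r)" "x \<in> E" for x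
    using inc[OF _ that(1,2) r(1) that(3)] ab(3) Fr by (simp add: R.nonneg_iff)
  let ?F = "map_poly \<nu> F"
  have neg\<nu>: "pos_in E1 (- poly ?F (\<nu> x))" if "x \<in> N" "nonneg_in E (x - a)" "pos_in E (r - x)" for x
  proof -
    have "- F \<in> poly_over N" by (rule poly_over_uminus[OF N FN])
    moreover have "map_poly \<nu> (- F) = - ?F"
      by (rule poly_eqI) (simp add: coeff_map_hom[OF N \<nu>] hom_on_uminus[OF N \<nu>] coeff_poly_over[OF FN])
    ultimately show ?thesis using \<nu>_poly_pos[of "- F" x] below[of x] that NE by auto
  qed
  have pos\<nu>: "pos_in E1 (poly ?F (\<nu> x))" if "x \<in> N" "nonneg_in E (b - x)" "pos_in E (x - r)" for x
    using \<nu>_poly_pos[OF FN that(1)] above[of x] that NE by auto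
  have F1: "?F \<in> poly_over E1" by (rule map_over_E1[OF FN])
  have \<nu>ab: "\<nu> a \<in> E1" "\<nu> b \<in> E1" "pos_in E1 (\<nu> b - \<nu> a)" using \<nu>_mem \<nu>_pos_diff ab ba by auto
  have F'a1: "pos_in E1 (poly (pderiv ?F) (\<nu> a))"
    using \<nu>_poly_pos[OF F'0(2) ab(1)] F'a by (simp add: map_poly_pderiv[OF FN])
  have inc1: "pos_in E1 (poly ?F y - poly ?F x)"
    if "nonneg_in E1 (x - \<nu> a)" "nonneg_in E1 (\<nu> b - y)" "pos_in E1 (y - x)" "x \<in> E1" "y \<in> E1" for x y
  proof (rule K.strictly_increasing[OF F1 that(4,5,3)])
    fix z assume z: "nonneg_in E1 (z - x)" "nonneg_in E1 (y - z)"
    have "nonneg_in E1 (z - \<nu> a)" "nonneg_in E1 (\<nu> b - z)"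
      using K.nonneg_add[OF z(1) that(1)] K.nonneg_add[OF z(2) that(2)] by simp_all
    hence "pos_in E1 (poly (map_poly \<nu> (pderiv F)) (\<nu> a) * poly (map_poly \<nu> (pderiv F)) z)"
      using sgnF nn by (intro same_sign_transfer[OF F'0(2,1) ab(1,2) ba]) auto
    thus "pos_in E1 (poly (pderiv ?F) z)"
      using K.pos_mult_cancel F'a1 by (simp add: map_poly_pderiv[OF FN])
  qed
  have "pos_in E1 (- (poly ?F (\<nu> a) * poly ?F (\<nu> b)))"
    using K.pos_mult[OF neg\<nu>[OF ab(1) nn(1) ab(3)] pos\<nu>[OF ab(2) nn(2) ab(4)]] by simp
  then obtain s where s: "pos_in E1 (s - \<nu> a)" "pos_in E1 (\<nu> b - s)" "poly ?F s = 0"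
    using K.intermediate_value[OF F1 \<nu>ab] by blast
  have sE1: "s \<in> E1" using K.pos_mem[OF s(1)] \<nu>ab(1) K.closed(3)[of "s - \<nu> a" "\<nu> a"] by auto
  \<comment> \<open>\<open>s\<close> fills the same cut of \<open>N\<close> as \<open>r\<close>.\<close>
  have cut_low: "pos_in E1 (s - \<nu> x)" if x: "x \<in> N" "pos_in E (x - a)" "pos_in E (r - x)" for x
  proof (rule ccontr)
    assume n: "\<not> pos_in E1 (s - \<nu> x)"
    have fx: "pos_in E1 (- poly ?F (\<nu> x))" using neg\<nu>[of x] x by (simp add: R.nonneg_iff)
    hence "s \<noteq> \<nu> x" using s(3) K.not_pos_zero by auto
    hence sx: "pos_in E1 (\<nu> x - s)" using n K.trichotomy[of "s - \<nu> x"] K.closed(4) sE1 \<nu>_mem[OF x(1)] by auto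
    have "pos_in E (b - x)" using R.pos_diff_trans[OF x(3) ab(4)] .
    hence "nonneg_in E1 (\<nu> b - \<nu> x)" using \<nu>_pos_diff ab(2) x(1) by (simp add: K.nonneg_iff)
    hence "pos_in E1 (poly ?F (\<nu> x) - poly ?F s)"
      using s(1) sx sE1 \<nu>_mem[OF x(1)] by (intro inc1) (auto simp: K.nonneg_iff)
    thus False using s(3) fx K.not_pos_both by simp
  qed
  have cut_high: "pos_in E1 (\<nu> x - s)" if x: "x \<in> N" "pos_in E (b - x)" "pos_in E (x - r)" for x
  proof (rule ccontr)
    assume n: "\<not> pos_in E1 (\<nu> x - s)"
    have fx: "pos_in E1 (poly ?F (\<nu> x))" using pos\<nu>[of x] x by (simp add: R.nonneg_iff)
    hence "s \<noteq> \<nu> x" using s(3) K.not_pos_zero by auto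
    hence sx: "pos_in E1 (s - \<nu> x)" using n K.trichotomy[of "\<nu> x - s"] K.closed(4) sE1 \<nu>_mem[OF x(1)] by auto
    have "pos_in E (x - a)" using R.pos_diff_trans[OF ab(3) x(3)] .
    hence "nonneg_in E1 (\<nu> x - \<nu> a)" using \<nu>_pos_diff ab(1) x(1) by (simp add: K.nonneg_iff)
    hence "pos_in E1 (poly ?F s - poly ?F (\<nu> x))"
      using s(2) sx sE1 \<nu>_mem[OF x(1)] by (intro inc1) (auto simp: K.nonneg_iff)
    thus False using s(3) fx K.not_pos_both by simp
  qed
  have fs: "poly (map_poly \<nu> f) s = 0"
  proof -
    have "?F = smult (\<nu> \<epsilon>) (map_poly \<nu> f)" unfolding F_def by (rule map_poly_hom_smult[OF N \<nu> \<epsilon>(1) f0(1)])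
    moreover have "\<nu> \<epsilon> \<noteq> 0" using \<nu>_eq_zero_iff[OF \<epsilon>(1)] \<epsilon>(2) by auto
    ultimately show ?thesis using s(3) by simp
  qed
  have small: "pos_in E1 (poly (map_poly \<nu> h) s)"
    if h: "h \<in> poly_over N" "degree h < degree f" "pos_in E (poly h r)" for h
  proof -
    have h0: "h \<noteq> 0" using h(3) R.not_pos_zero by auto
    have rh: "\<forall>g\<in>poly_over N. \<forall>z\<in>E. g \<noteq> 0 \<and> degree g \<le> degree h \<and> poly g z = 0 \<longrightarrow> z \<in> N"
      using roots h(2) by (meson le_less_trans)
    have fin: "finite {a, b}" "{a, b} \<subseteq> N" using ab by auto
    obtain a' b' where ab': "a' \<in> N" "b' \<in> N" "pos_in E (r - a')" "pos_in E (b' - r)"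
      and Z: "\<forall>z\<in>{a, b}. pos_in E (r - z) \<longrightarrow> pos_in E (a' - z)" "\<forall>z\<in>{a, b}. pos_in E (z - r) \<longrightarrow> pos_in E (z - b')"
      and sg': "\<forall>k x y. (pderiv ^^ k) h \<noteq> 0 \<and> nonneg_in E (x - a') \<and> nonneg_in E (b' - x) \<and>
       nonneg_in E (y - a') \<and> nonneg_in E (b' - y) \<longrightarrow> pos_in E (poly ((pderiv ^^ k) h) x * poly ((pderiv ^^ k) h) y)"
      by (rule isolating_interval[OF r f0 h(1) h0 rh fin])
    note sg = sg'[rule_format, OF conjI, OF _ conjI, OF _ _ conjI, OF _ _ _ conjI]
    have Z': "pos_in E (a' - a)" "pos_in E (b - b')" using Z ab by simp_all
    have ba': "pos_in E (b' - a')" using R.pos_diff_trans[OF ab'(3,4)] .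
    have n': "nonneg_in E (a' - a')" "nonneg_in E (b' - b')" "nonneg_in E (b' - a')" "nonneg_in E (r - a')" "nonneg_in E (b' - r)"
      using ba' ab' by (simp_all add: R.nonneg_iff)
    have "pos_in E (poly h a' * poly h r)" using sg[of 0 a' r] h0 n' by simp
    hence "pos_in E (poly h a')" using R.pos_mult_cancel[OF _ h(3)] by (simp add: mult.commute)
    hence p1: "pos_in E1 (poly (map_poly \<nu> h) (\<nu> a'))" using \<nu>_poly_pos[OF h(1) ab'(1)] by simp
    have "pos_in E1 (s - \<nu> a')" "pos_in E1 (\<nu> b' - s)"
      using cut_low[OF ab'(1) Z'(1) ab'(3)] cut_high[OF ab'(2) Z'(2) ab'(4)] by auto
    hence "pos_in E1 (poly (map_poly \<nu> h) (\<nu> a') * poly (map_poly \<nu> h) s)"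
      using sg n' by (intro same_sign_transfer[OF h(1) h0 ab'(1,2) ba']) (auto simp: K.nonneg_iff)
    thus ?thesis using K.pos_mult_cancel p1 by blast
  qed
  show ?thesis
  proof (rule that[OF sE1])
    fix g assume g: "g \<in> poly_over N"
    obtain q h where qh: "q \<in> poly_over N" "h \<in> poly_over N" "g = q * f + h" "h = 0 \<or> degree h < degree f"
      using poly_over_division[OF field f0(1,2) g] by blast
    have gr: "poly g r = poly h r" using qh(3) f0(3) by simp
    have "map_poly \<nu> g = map_poly \<nu> q * map_poly \<nu> f + map_poly \<nu> h"
      using qh f0(1) by (simp add: map_poly_hom_add[OF N \<nu>] map_poly_hom_mult[OF N \<nu>] poly_over_mult[OF N])
    hence gs: "poly (map_poly \<nu> g) s = poly (map_poly \<nu> h) s" using fs by simp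
    have "h = 0" if "poly h r = 0" using f qh(2,4) that unfolding min_poly_over_def by (meson leD)
    moreover have "pos_in E1 (poly (map_poly \<nu> h) s)" if "pos_in E (poly h r)"
      using small[OF qh(2) _ that] qh(4) that R.not_pos_zero by auto
    ultimately show "matches r s g" unfolding matches_def gr gs by auto
  qed
qed

text \<open>When no root in \<open>E\<close> of the given polynomials lies outside \<open>N\<close>, a point of \<open>N\<close> that the roots do not
  separate from \<open>r\<close> has the required signs.\<close>

lemma match_transcendental:
  assumes r: "r \<in> E" "r \<notin> N" 
    and roots: "\<And>g z. g \<in> poly_over N \<Longrightarrow> g \<noteq> 0 \<Longrightarrow> z \<in> E \<Longrightarrow> poly g z = 0 \<Longrightarrow> z \<in> N"
    and G: "finite G" "G \<subseteq> poly_over N"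
  obtains s where "s \<in> E1" "\<And>g. g \<in> G \<Longrightarrow> matches r s g"
proof -
  define Z where "Z = (\<Union>g\<in>G - {0}. {z \<in> E. poly g z = 0})"
  have "finite Z" unfolding Z_def using G(1) by (auto intro: finite_subset[OF _ poly_roots_finite])
  moreover have "Z \<subseteq> N" using roots G(2) by (auto simp: Z_def)
  ultimately obtain q where q: "q \<in> N" "\<And>z. z \<in> Z \<Longrightarrow> q \<noteq> z" "\<And>z. z \<in> Z \<Longrightarrow> pos_in E (r - z) \<longleftrightarrow> pos_in E (q - z)"
    using R.same_cut_point[OF field NE r] by blast
  have qE: "q \<in> E" using q(1) NE by auto
  show ?thesis
  proof (rule that[OF \<nu>_mem[OF q(1)]])
    fix g assume g: "g \<in> G"
    hence gN: "g \<in> poly_over N" using G(2) by auto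
    show "matches r (\<nu> q) g"
    proof (cases "g = 0")
      case True
      thus ?thesis using R.not_pos_zero by (simp add: matches_def)
    next
      case False
      have gr: "poly g r \<noteq> 0" using roots[OF gN False r(1)] r(2) by blast
      have inZ: "z \<in> Z" if "z \<in> E" "poly g z = 0" for z using that g False by (auto simp: Z_def)
      have gq: "poly g q \<noteq> 0" using inZ[OF qE] q(2) by blast
      have "pos_in E (poly g r * poly g q)"
      proof (rule R.no_root_same_sign[OF over_E[OF gN] r(1) qE gr gq])
        fix c assume c: "c \<in> E" "pos_in E (c - r) \<and> pos_in E (q - c) \<or> pos_in E (c - q) \<and> pos_in E (r - c)"
        show "poly g c \<noteq> 0"
        proof
          assume "poly g c = 0"
          hence "pos_in E (r - c) \<longleftrightarrow> pos_in E (q - c)" using q(3) inZ c(1) by blast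
          thus False using c(2) R.not_pos_both[of "r - c"] R.not_pos_both[of "q - c"] by auto
        qed
      qed
      thus ?thesis using gr R.pos_mult_cancel \<nu>_poly_pos[OF gN q(1)] by (auto simp: matches_def)
    qed
  qed
qed

end

end

section \<open>Ultrafilters\<close>

definition is_ultrafilter :: "'a set set \<Rightarrow> bool" where
  "is_ultrafilter \<U> \<longleftrightarrow> (\<forall>F. finite F \<and> F \<subseteq> \<U> \<longrightarrow> \<Inter>F \<noteq> {}) \<and> (\<forall>A. A \<in> \<U> \<or> - A \<in> \<U>)"

text \<open>A maximal family with the finite intersection property decides every set: if neither \<open>A\<close> nor its
  complement could be added, two finite intersections, and hence their intersection, would lead to
  a contradiction.\<close>

lemma ultrafilter_exists:
  assumes fip: "\<And>F. finite F \<Longrightarrow> F \<subseteq> \<A> \<Longrightarrow> \<Inter>F \<noteq> {}"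
  obtains \<U> where "\<A> \<subseteq> \<U>" "is_ultrafilter \<U>"
proof -
  let ?S = "{\<B>. \<A> \<subseteq> \<B> \<and> (\<forall>F. finite F \<and> F \<subseteq> \<B> \<longrightarrow> \<Inter>F \<noteq> {})}"
  have "\<exists>M\<in>?S. \<forall>D\<in>?S. M \<subseteq> D \<longrightarrow> D = M"
  proof (rule subset_Zorn_nonempty)
    show "?S \<noteq> {}" using fip by blast
    fix C assume C: "C \<noteq> {}" "subset.chain ?S C"
    have sub: "\<A> \<subseteq> D \<and> (\<forall>F. finite F \<and> F \<subseteq> D \<longrightarrow> \<Inter>F \<noteq> {})" if "D \<in> C" for D
      using C(2) that by (auto simp: subset_chain_def)
    have "\<Inter>F \<noteq> {}" if F: "finite F" "F \<subseteq> \<Union>C" for F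
    proof -
      obtain D where "D \<in> C" "F \<subseteq> D" using finite_subset_Union_chain[OF F C] by blast
      thus ?thesis using sub F(1) by blast
    qed
    moreover have "\<A> \<subseteq> \<Union>C" using sub C(1) by blast
    ultimately show "\<Union>C \<in> ?S" by blast
  qed
  then obtain \<U> where \<U>: "\<U> \<in> ?S" "\<forall>D\<in>?S. \<U> \<subseteq> D \<longrightarrow> D = \<U>" by (elim bexE)
  have ext: "\<exists>F. finite F \<and> F \<subseteq> \<U> \<and> \<Inter>F \<inter> A = {}" if A: "A \<notin> \<U>" for A
  proof -
    have "insert A \<U> \<notin> ?S"
    proof
      assume "insert A \<U> \<in> ?S"
      hence "insert A \<U> = \<U>" by (rule \<U>(2)[THEN bspec, THEN mp, OF _ subset_insertI])
      thus False using A by auto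
    qed
    moreover have "\<A> \<subseteq> insert A \<U>" using \<U>(1) by auto
    ultimately obtain F where F: "finite F" "F \<subseteq> insert A \<U>" "\<Inter>F = {}" by auto
    have "finite (F - {A})" "F - {A} \<subseteq> \<U>" "\<Inter>(F - {A}) \<inter> A = {}" using F by auto
    thus ?thesis by blast
  qed
  have "A \<in> \<U> \<or> - A \<in> \<U>" for A
  proof (rule ccontr)
    assume "\<not> (A \<in> \<U> \<or> - A \<in> \<U>)"
    then obtain F F' where F: "finite F" "F \<subseteq> \<U>" "\<Inter>F \<inter> A = {}" "finite F'" "F' \<subseteq> \<U>" "\<Inter>F' \<inter> - A = {}"
      using ext[of A] ext[of "- A"] by blast
    hence "\<Inter>F \<inter> \<Inter>F' = {}" by blast
    hence "\<Inter>(F \<union> F') = {}" by (simp add: Inter_Un_distrib)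
    moreover have "finite (F \<union> F')" "F \<union> F' \<subseteq> \<U>" using F by auto
    ultimately show False using \<U>(1) by blast
  qed
  hence "is_ultrafilter \<U>" using \<U>(1) by (auto simp: is_ultrafilter_def)
  thus ?thesis using that \<U>(1) by blast
qed

lemma ultrafilter_fip: "is_ultrafilter \<U> \<Longrightarrow> finite F \<Longrightarrow> F \<subseteq> \<U> \<Longrightarrow> \<Inter>F \<noteq> {}"
  and ultrafilter_cases: "is_ultrafilter \<U> \<Longrightarrow> A \<in> \<U> \<or> - A \<in> \<U>"
  by (simp_all add: is_ultrafilter_def)

lemma ultrafilter_not_disjoint: "is_ultrafilter \<U> \<Longrightarrow> A \<in> \<U> \<Longrightarrow> B \<in> \<U> \<Longrightarrow> A \<inter> B \<noteq> {}"
  using ultrafilter_fip[of \<U> "{A, B}"] by simp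

lemma ultrafilter_mono: assumes "is_ultrafilter \<U>" "A \<in> \<U>" "A \<subseteq> B" shows "B \<in> \<U>"
proof (rule ccontr)
  assume "B \<notin> \<U>"
  hence "A \<inter> - B \<noteq> {}" using ultrafilter_cases[OF assms(1), of B] ultrafilter_not_disjoint[OF assms(1,2)] by simp
  thus False using assms(3) by blast
qed

lemma ultrafilter_Int:
  assumes "is_ultrafilter \<U>" "A \<in> \<U>" "B \<in> \<U>" shows "A \<inter> B \<in> \<U>"
proof (rule ccontr)
  assume "A \<inter> B \<notin> \<U>"
  hence "A \<inter> (B \<inter> - (A \<inter> B)) \<noteq> {}"
    using ultrafilter_cases[OF assms(1), of "A \<inter> B"] ultrafilter_fip[OF assms(1), of "{A, B, - (A \<inter> B)}"] assms(2,3) by simp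
  thus False by blast
qed

lemma ultrafilter_UNIV: "is_ultrafilter \<U> \<Longrightarrow> UNIV \<in> \<U>"
  using ultrafilter_cases[of \<U> UNIV] ultrafilter_fip[of \<U> "{{}}"] by auto

lemma ultrafilter_INT:
  assumes "finite I" "is_ultrafilter \<U>" "\<And>i. i \<in> I \<Longrightarrow> A i \<in> \<U>" shows "(\<Inter>i\<in>I. A i) \<in> \<U>"
  using assms(1,3)
proof (induction I rule: finite_induct)
  case empty
  show ?case using ultrafilter_UNIV[OF assms(2)] by simp
next
  case (insert i I)
  thus ?case using ultrafilter_Int[OF assms(2)] by simp
qed

section \<open>Extension of cones to larger coefficient rings\<close>

definition lift_coeffs :: "('a::zero \<Rightarrow> 'b::comm_ring_1) \<Rightarrow> ('n, 'a) mpoly \<Rightarrow> ('n, 'b) mpoly" where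
  "lift_coeffs P f = (\<Sum>m\<in>Poly_Mapping.keys f. Poly_Mapping.single m (P (Poly_Mapping.lookup f m)))"

lemma lookup_lift_coeffs:
  "Poly_Mapping.lookup (lift_coeffs P f) m = (if m \<in> Poly_Mapping.keys f then P (Poly_Mapping.lookup f m) else 0)"
  by (simp add: lift_coeffs_def lookup_sum lookup_single when_def sum.delta)

lemma lift_coeffs_over:
  "f \<in> polys_over S \<Longrightarrow> (\<And>c. c \<in> S \<Longrightarrow> P c \<in> S') \<Longrightarrow> 0 \<in> S' \<Longrightarrow> lift_coeffs P f \<in> polys_over S'"
  by (auto simp: polys_over_def lookup_lift_coeffs)

lemma lookup_insertion_Const:
  assumes c: "hom_on UNIV (c :: 'a::comm_ring_1 \<Rightarrow> 'b::comm_ring_1)"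
  shows "Poly_Mapping.lookup (insertion (Const \<circ> c) Var f) m = c (Poly_Mapping.lookup f m)"
proof -
  have "insertion (Const \<circ> c) Var f = (\<Sum>m\<in>Poly_Mapping.keys f. Poly_Mapping.single m (c (Poly_Mapping.lookup f m)))"
    unfolding insertion_def single_eq_Const_mult by simp
  thus ?thesis using hom_on_zero[OF is_subring_UNIV c]
    by (simp add: lookup_sum lookup_single when_def sum.delta in_keys_iff)
qed

lemma hom_on_compose: "hom_on S f \<Longrightarrow> hom_on S' g \<Longrightarrow> f ` S \<subseteq> S' \<Longrightarrow> hom_on S (g \<circ> f)"
  by (auto simp: hom_on_def image_subset_iff)

definition intermediate_cone ::
    "'k::field set \<Rightarrow> 'k set \<Rightarrow> ('n::finite, 'k) mpoly set \<Rightarrow> 'k set \<Rightarrow> ('n, 'k) mpoly set \<Rightarrow> bool" where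
  "intermediate_cone E M \<beta> N \<gamma> \<longleftrightarrow> is_subring N \<and> M \<subseteq> N \<and> N \<subseteq> E \<and> prime_cone (polys_over N) \<gamma> \<and>
     (\<forall>c\<in>N. Const c \<in> \<gamma> \<longleftrightarrow> nonneg_in E c) \<and> \<gamma> \<inter> polys_over M = \<beta>"

text \<open>A polynomial over \<open>N[r]\<close> arises from one with coefficients in the polynomials over \<open>N\<close> by putting
  \<open>r\<close> (\<open>val_r\<close>); putting \<open>s \<in> E1\<close> instead gives an element of \<open>E1\<close> (\<open>val s\<close>).  The new cone consists of
  the polynomials whose value is non-negative for almost all \<open>s\<close>, in the sense of an ultrafilter
  that contains, for each \<open>g\<close>, the set of points that resemble \<open>r\<close> in the eyes of \<open>g\<close>.  The choice of
  the lift is immaterial, because coefficients that vanish at \<open>r\<close> vanish at almost all \<open>s\<close>.\<close>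

lemma extend_cone_by_element:
  fixes E :: "'k::field set" and \<psi> :: "('n::finite, 'k) mpoly \<Rightarrow> 'w::field"
  assumes good: "intermediate_cone E M \<beta> N \<gamma>"
    and \<psi>: "hom_on (polys_over N) \<psi>" "\<psi> ` polys_over N \<subseteq> E1" "\<And>f. f \<in> polys_over N \<Longrightarrow> f \<in> \<gamma> \<longleftrightarrow> nonneg_in E1 (\<psi> f)"
    and emb: "order_embedding E E1 N (\<psi> \<circ> Const)"
    and r: "r \<in> E"
    and fip: "\<And>G. finite G \<Longrightarrow> G \<subseteq> poly_over N \<Longrightarrow> \<exists>s\<in>E1. \<forall>g\<in>G. order_embedding.matches E E1 (\<psi> \<circ> Const) r s g"
  shows "\<exists>\<gamma>'. intermediate_cone E M \<beta> ((\<lambda>g. poly g r) ` poly_over N) \<gamma>' \<and> \<gamma> \<subseteq> \<gamma>'"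
proof -
  define \<nu> where "\<nu> = \<psi> \<circ> Const"
  interpret order_embedding E E1 N \<nu> using emb by (simp add: \<nu>_def)
  have pc: "prime_cone (polys_over N) \<gamma>" and MN: "M \<subseteq> N" and \<beta>: "\<gamma> \<inter> polys_over M = \<beta>"
    using good by (auto simp: intermediate_cone_def)
  define N' where "N' = (\<lambda>g. poly g r) ` poly_over N"
  define D where "D = (polys_over (poly_over N) :: ('n, 'k poly) mpoly set)"
  note PN = is_subring_poly_over[OF N]
  have D: "is_subring D" unfolding D_def by (rule is_subring_polys_over[OF PN])
  obtain \<U> where sub: "insert E1 ((\<lambda>g. {s \<in> E1. matches r s g}) ` poly_over N) \<subseteq> \<U>" and U: "is_ultrafilter \<U>"
  proof (rule ultrafilter_exists[of "insert E1 ((\<lambda>g. {s \<in> E1. matches r s g}) ` poly_over N)"])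
    fix F assume F: "finite F" "F \<subseteq> insert E1 ((\<lambda>g. {s \<in> E1. matches r s g}) ` poly_over N)"
    hence fin: "finite (F - {E1})" "F - {E1} \<subseteq> (\<lambda>g. {s \<in> E1. matches r s g}) ` poly_over N" by auto
    obtain G where G: "finite G" "G \<subseteq> poly_over N" "F - {E1} = (\<lambda>g. {s \<in> E1. matches r s g}) ` G"
      using finite_subset_image[OF fin] by auto
    obtain s where "s \<in> E1" "\<forall>g\<in>G. matches r s g" using fip[OF G(1,2)] by (auto simp: \<nu>_def)
    hence "s \<in> \<Inter>F" using G(3) by blast
    thus "\<Inter>F \<noteq> {}" by blast
  qed
  define almost where "almost P \<longleftrightarrow> {s \<in> E1. P s} \<in> \<U>" for P
  have almost_mono: "almost Q" if "almost P" "\<And>s. s \<in> E1 \<Longrightarrow> P s \<Longrightarrow> Q s" for P Q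
    using ultrafilter_mono[OF U, of "{s \<in> E1. P s}" "{s \<in> E1. Q s}"] that by (auto simp: almost_def)
  have almost_conj: "almost (\<lambda>s. P s \<and> Q s)" if "almost P" "almost Q" for P Q
    using ultrafilter_Int[OF U, of "{s \<in> E1. P s}" "{s \<in> E1. Q s}"] that
    by (simp add: almost_def Collect_conj_eq[symmetric] conj_ac) 
  have almost_all: "almost P" if "\<And>s. s \<in> E1 \<Longrightarrow> P s" for P
  proof -
    have "{s \<in> E1. P s} = E1" using that by auto
    thus ?thesis using sub by (simp add: almost_def)
  qed
  have almost_False: "\<not> almost (\<lambda>s. False)"
    using U ultrafilter_not_disjoint[OF U, of "{}" "{}"] by (auto simp: almost_def)
  have almost_not: "almost P \<or> almost (\<lambda>s. \<not> P s)" for P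
  proof -
    have "{s \<in> E1. P s} \<in> \<U> \<or> - {s \<in> E1. P s} \<in> \<U>" using U by (auto simp: is_ultrafilter_def)
    moreover have "{s \<in> E1. \<not> P s} = - {s \<in> E1. P s} \<inter> E1" by auto
    ultimately show ?thesis using ultrafilter_Int[OF U, of "- {s \<in> E1. P s}" E1] sub by (auto simp: almost_def)
  qed
  have almost_contra: False if "almost P" "almost Q" "\<And>s. s \<in> E1 \<Longrightarrow> P s \<Longrightarrow> Q s \<Longrightarrow> False" for P Q
    using almost_mono[OF almost_conj[OF that(1,2)], of "\<lambda>_. False"] that(3) almost_False by blast
  have match: "almost (\<lambda>s. matches r s g)" if "g \<in> poly_over N" for g
    using sub that by (auto simp: almost_def)
  have vanish: "almost (\<lambda>s. poly (map_poly \<nu> g) s = 0)" if "g \<in> poly_over N" "poly g r = 0" for g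
    using almost_mono[OF match[OF that(1)]] that(2) by (simp add: matches_def)
  have positive: "almost (\<lambda>s. pos_in E1 (poly (map_poly \<nu> g) s))" if "g \<in> poly_over N" "pos_in E (poly g r)" for g
    using almost_mono[OF match[OF that(1)]] that(2) by (simp add: matches_def)
  define val_r where "val_r = (insertion (Const \<circ> (\<lambda>p. poly p r)) Var :: ('n, 'k poly) mpoly \<Rightarrow> _)"
  define val where "val s = (insertion (\<lambda>p. poly (map_poly \<nu> p) s) (\<lambda>i. \<psi> (Var i)) :: ('n, 'k poly) mpoly \<Rightarrow> _)" for s
  have eval_r: "hom_on UNIV (\<lambda>p. poly p r)" by (simp add: hom_on_def)
  have val_r: "hom_on UNIV val_r"
    using hom_on_insertion[OF is_subring_UNIV hom_on_compose[OF eval_r hom_on_Const]] by (simp add: val_r_def)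
  have eval_s: "hom_on (poly_over N) (\<lambda>p. poly (map_poly \<nu> p) s)" for s
    using hom_on_map_poly[OF N \<nu>] by (simp add: hom_on_def)
  have val: "hom_on D (val s)" for s
    unfolding val_def D_def by (rule hom_on_insertion[OF PN eval_s])
  have lookup_val_r: "Poly_Mapping.lookup (val_r H) m = poly (Poly_Mapping.lookup H m) r" for H m
    unfolding val_r_def by (rule lookup_insertion_Const[OF eval_r])
  have VarE1: "\<psi> (Var i) \<in> E1" for i by (rule subsetD[OF \<psi>(2) imageI[OF Var_in_polys_over[OF N]]])
  have val_mem: "val s H \<in> E1" if "H \<in> D" "s \<in> E1" for s H
    unfolding val_def insertion_def using that VarE1
    by (intro subring_sum subring_mult subring_prod subring_power poly_in_subring map_over_E1 K.subring)
      (auto simp: D_def polys_over_def)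
  have zero: "almost (\<lambda>s. val s H = 0)" if H: "H \<in> D" "val_r H = 0" for H
  proof -
    have "poly (Poly_Mapping.lookup H m) r = 0" for m using lookup_val_r[of H m] H(2) by simp
    hence "{s \<in> E1. poly (map_poly \<nu> (Poly_Mapping.lookup H m)) s = 0} \<in> \<U>" for m
      using vanish H(1) by (auto simp: almost_def D_def polys_over_def)
    hence "(\<Inter>m\<in>Poly_Mapping.keys H. {s \<in> E1. poly (map_poly \<nu> (Poly_Mapping.lookup H m)) s = 0}) \<in> \<U>"
      by (intro ultrafilter_INT[OF _ U]) auto
    hence "E1 \<inter> (\<Inter>m\<in>Poly_Mapping.keys H. {s \<in> E1. poly (map_poly \<nu> (Poly_Mapping.lookup H m)) s = 0}) \<in> \<U>"
      (is "?Z \<in> _") using sub by (intro ultrafilter_Int[OF U]) auto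
    moreover have "?Z \<subseteq> {s \<in> E1. val s H = 0}" by (auto simp: val_def insertion_def)
    ultimately show ?thesis unfolding almost_def by (rule ultrafilter_mono[OF U])
  qed
  define \<gamma>' where "\<gamma>' = {f \<in> val_r ` D. \<forall>H\<in>D. val_r H = f \<longrightarrow> almost (\<lambda>s. nonneg_in E1 (val s H))}"
  have mem: "val_r H \<in> \<gamma>' \<longleftrightarrow> almost (\<lambda>s. nonneg_in E1 (val s H))" if H: "H \<in> D" for H
  proof
    assume a: "almost (\<lambda>s. nonneg_in E1 (val s H))"
    have "almost (\<lambda>s. nonneg_in E1 (val s H'))" if H': "H' \<in> D" "val_r H' = val_r H" for H'
    proof -
      have "val_r (H' - H) = 0" using H'(2) hom_on_diff[OF is_subring_UNIV val_r, of H' H] by simp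
      hence "almost (\<lambda>s. val s (H' - H) = 0)" using zero subring_diff[OF D H'(1) H] by blast
      from almost_conj[OF a this] show ?thesis
        by (rule almost_mono) (auto simp: hom_on_diff[OF D val H'(1) H])
    qed
    thus "val_r H \<in> \<gamma>'" using H by (auto simp: \<gamma>'_def)
  qed (use H in \<open>auto simp: \<gamma>'_def\<close>)
  have N': "is_subring N'" unfolding N'_def by (rule is_subring_simple_extension[OF N])
  have NN': "N \<subseteq> N'" unfolding N'_def by (rule subset_simple_extension[OF N])
  have img: "val_r ` D = polys_over N'"
  proof
    show "val_r ` D \<subseteq> polys_over N'" by (auto simp: polys_over_def lookup_val_r D_def N'_def)
    show "polys_over N' \<subseteq> val_r ` D"
    proof
      fix f :: "('n, 'k) mpoly" assume f: "f \<in> polys_over N'"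
      obtain P where P: "\<And>c. c \<in> N' \<Longrightarrow> P c \<in> poly_over N \<and> c = poly (P c) r" unfolding N'_def
        by (metis (no_types, lifting) image_iff)
      have "lift_coeffs P f \<in> D"
        unfolding D_def using P by (intro lift_coeffs_over[OF f] poly_over_0[OF N]) blast
      moreover have "val_r (lift_coeffs P f) = f"
        using P lookup_polys_over[OF f]
        by (intro poly_mapping_eqI) (auto simp: lookup_val_r lookup_lift_coeffs in_keys_iff)
      ultimately show "f \<in> val_r ` D" by (metis image_eqI)
    qed
  qed
  have extends: "f \<in> \<gamma>' \<longleftrightarrow> f \<in> \<gamma>" if f: "f \<in> polys_over N" for f
  proof -
    define H where "H = lift_coeffs (\<lambda>c. [:c:]) f"
    have HD: "H \<in> D" unfolding H_def D_def
      by (intro lift_coeffs_over[OF f] poly_over_pCons[OF N] poly_over_0[OF N])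
    have "val_r H = f" by (rule poly_mapping_eqI) (simp add: lookup_val_r H_def lookup_lift_coeffs in_keys_iff)
    moreover have "val s H = \<psi> f" for s
    proof -
      have "val s H = (\<Sum>m\<in>Poly_Mapping.keys f. val s (Poly_Mapping.single m [:Poly_Mapping.lookup f m:]))"
        unfolding H_def lift_coeffs_def using f
        by (intro hom_on_sum[OF D val]) (auto simp: D_def intro!: single_in_polys_over poly_over_pCons[OF N] poly_over_0[OF N] lookup_polys_over)
      also have "\<dots> = insertion \<nu> (\<psi> \<circ> Var) f"
        unfolding val_def insertion_single[OF PN eval_s] by (simp add: insertion_def map_poly_hom_const[OF N \<nu>])
      also have "\<dots> = \<psi> f" using hom_on_eq_insertion[OF N \<psi>(1) f] by (simp add: \<nu>_def)
      finally show ?thesis .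
    qed
    ultimately have "f \<in> \<gamma>' \<longleftrightarrow> almost (\<lambda>s. nonneg_in E1 (\<psi> f))" using mem[OF HD] by simp
    thus ?thesis using \<psi>(3)[OF f] almost_all[of "\<lambda>_. True"] almost_False by (cases "nonneg_in E1 (\<psi> f)") auto
  qed
  have "prime_cone (polys_over N') \<gamma>'"
    unfolding prime_cone_def
  proof (intro conjI ballI impI)
    show "\<gamma>' \<subseteq> polys_over N'" using img by (auto simp: \<gamma>'_def)
    have one: "1 \<in> polys_over N" by (rule subring_one[OF is_subring_polys_over[OF N]])
    have "- 1 \<in> polys_over N" using subring_uminus[OF is_subring_polys_over[OF N] one] .
    thus "- 1 \<notin> \<gamma>'" using extends prime_cone_minus_one[OF is_subring_polys_over[OF N] pc] by blast
  next
    fix f g assume "f \<in> \<gamma>'" "g \<in> \<gamma>'"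
    then obtain H H' where H: "H \<in> D" "H' \<in> D" "f = val_r H" "g = val_r H'" by (auto simp: \<gamma>'_def)
    with \<open>f \<in> \<gamma>'\<close> \<open>g \<in> \<gamma>'\<close> have a: "almost (\<lambda>s. nonneg_in E1 (val s H) \<and> nonneg_in E1 (val s H'))"
      using mem almost_conj by blast
    have "val_r (H + H') \<in> \<gamma>'" "val_r (H * H') \<in> \<gamma>'"
      using mem[OF subring_add[OF D H(1,2)]] mem[OF subring_mult[OF D H(1,2)]]
        almost_mono[OF a, of "\<lambda>s. nonneg_in E1 (val s (H + H'))"] almost_mono[OF a, of "\<lambda>s. nonneg_in E1 (val s (H * H'))"]
      by (auto simp: hom_on_add[OF D val H(1,2)] hom_on_mult[OF D val H(1,2)] K.nonneg_add K.nonneg_mult)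
    thus "f + g \<in> \<gamma>'" "f * g \<in> \<gamma>'"
      by (simp_all add: H hom_on_add[OF is_subring_UNIV val_r] hom_on_mult[OF is_subring_UNIV val_r])
  next
    fix f :: "('n, 'k) mpoly" assume "f \<in> polys_over N'"
    then obtain H where H: "H \<in> D" "f = val_r H" using img by auto
    have "val_r (H * H) \<in> \<gamma>'"
      unfolding mem[OF subring_mult[OF D H(1,1)]] hom_on_mult[OF D val H(1,1)]
      by (rule almost_all) (rule K.nonneg_square[OF val_mem[OF H(1)]])
    thus "f * f \<in> \<gamma>'" by (simp add: H hom_on_mult[OF is_subring_UNIV val_r])
    fix g :: "('n, 'k) mpoly" assume "g \<in> polys_over N'" and fg: "f * g \<in> \<gamma>'"
    then obtain H' where H': "H' \<in> D" "g = val_r H'" using img by auto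
    have fg': "almost (\<lambda>s. nonneg_in E1 (val s H * val s H'))"
      using fg mem[OF subring_mult[OF D H(1) H'(1)]]
      by (simp add: H H' hom_on_mult[OF is_subring_UNIV val_r] hom_on_mult[OF D val H(1) H'(1)])
    show "f \<in> \<gamma>' \<or> - g \<in> \<gamma>'"
    proof (cases "almost (\<lambda>s. nonneg_in E1 (val s H))")
      case True
      thus ?thesis using mem[OF H(1)] H(2) by simp
    next
      case False
      hence "almost (\<lambda>s. \<not> nonneg_in E1 (val s H))" using almost_not by blast
      from almost_conj[OF this fg'] have "almost (\<lambda>s. nonneg_in E1 (val s (- H')))"
      proof (rule almost_mono)
        fix s assume s: "s \<in> E1" and h: "\<not> nonneg_in E1 (val s H) \<and> nonneg_in E1 (val s H * val s H')"
        have E: "val s H \<in> E1" "val s H' \<in> E1" using val_mem H(1) H'(1) s by auto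
        have p: "pos_in E1 (- val s H)" using h K.not_nonneg_iff[OF E(1)] by simp
        have "nonneg_in E1 (- val s H')"
        proof (rule ccontr)
          assume "\<not> nonneg_in E1 (- val s H')"
          hence "pos_in E1 (val s H')" using K.not_nonneg_iff[of "- val s H'"] E(2) K.closed(5) by simp
          from K.pos_mult[OF p this] show False
            using h K.not_pos_both[of "val s H * val s H'"] K.not_pos_zero by (auto simp: K.nonneg_iff)
        qed
        thus "nonneg_in E1 (val s (- H'))" by (simp add: hom_on_uminus[OF D val H'(1)])
      qed
      hence "val_r (- H') \<in> \<gamma>'" using mem[OF subring_uminus[OF D H'(1)]] by simp
      thus ?thesis by (simp add: H' hom_on_uminus[OF is_subring_UNIV val_r])
    qed
  qed
  moreover have "Const c \<in> \<gamma>' \<longleftrightarrow> nonneg_in E c" if c: "c \<in> N'" for c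
  proof -
    obtain g where g: "g \<in> poly_over N" "c = poly g r" using c by (auto simp: N'_def)
    have HD: "Const g \<in> D" unfolding D_def by (rule Const_in_polys_over[OF g(1) poly_over_0[OF N]])
    have ar: "val_r (Const g) = Const c"
      unfolding val_r_def by (subst insertion_Const[OF is_subring_UNIV hom_on_compose[OF eval_r hom_on_Const]]) (simp_all add: g(2))
    have as: "val s (Const g) = poly (map_poly \<nu> g) s" for s
      unfolding val_def by (rule insertion_Const[OF PN eval_s])
    have iff: "Const c \<in> \<gamma>' \<longleftrightarrow> almost (\<lambda>s. nonneg_in E1 (poly (map_poly \<nu> g) s))"
      using mem[OF HD] unfolding ar as .
    show ?thesis
    proof
      assume "nonneg_in E c"
      hence "almost (\<lambda>s. poly (map_poly \<nu> g) s = 0) \<or> almost (\<lambda>s. pos_in E1 (poly (map_poly \<nu> g) s))"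
        using vanish positive g by (auto simp: R.nonneg_iff)
      thus "Const c \<in> \<gamma>'" unfolding iff by (elim disjE; elim almost_mono) (simp_all add: K.nonneg_iff)
    next
      assume a: "Const c \<in> \<gamma>'"
      show "nonneg_in E c"
      proof (rule ccontr)
        assume "\<not> nonneg_in E c"
        moreover have "c \<in> E" using g r poly_in_subring[OF R.subring over_E] by simp
        ultimately have "pos_in E (poly (- g) r)" using R.not_nonneg_iff[of c] g(2) by simp
        hence "almost (\<lambda>s. pos_in E1 (poly (map_poly \<nu> (- g)) s))"
          using positive poly_over_uminus[OF N g(1)] by blast
        moreover have "map_poly \<nu> (- g) = - map_poly \<nu> g"
          by (rule poly_eqI) (simp add: coeff_map_hom[OF N \<nu>] hom_on_uminus[OF N \<nu>] coeff_poly_over[OF g(1)])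
        ultimately have "almost (\<lambda>s. pos_in E1 (- poly (map_poly \<nu> g) s))" by simp
        thus False using a unfolding iff
          by (rule almost_contra) (auto simp: K.nonneg_iff K.not_pos_zero dest: K.not_pos_both)
      qed
    qed
  qed
  moreover have "\<gamma>' \<inter> polys_over M = \<beta>"
    using extends \<beta> polys_over_mono[OF MN] by blast
  moreover have "\<gamma> \<subseteq> \<gamma>'" using extends prime_cone_subset[OF is_subring_polys_over[OF N] pc] by blast
  moreover have "N' \<subseteq> E" unfolding N'_def using poly_in_subring[OF R.subring over_E r] by blast
  ultimately show ?thesis using N' NN' MN unfolding intermediate_cone_def N'_def[symmetric] by blast
qed

text \<open>The constants in a cone determine its coefficient ring, since one of \<open>c\<close> and \<open>- c\<close> is non-negative.\<close>

lemma intermediate_cone_subset: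
  assumes "intermediate_cone E M \<beta> N \<gamma>" "intermediate_cone E M \<beta> N' \<gamma>'" "\<gamma> \<subseteq> \<gamma>'" "ordered_subfield E"
  shows "N \<subseteq> N'"
proof
  interpret ordered_subfield E by (rule assms(4))
  fix c assume c: "c \<in> N"
  have N: "is_subring N" "N \<subseteq> E" "is_subring N'" "\<gamma>' \<subseteq> polys_over N'" "\<forall>c\<in>N. Const c \<in> \<gamma> \<longleftrightarrow> nonneg c"
    using assms(1,2) prime_cone_subset[OF is_subring_polys_over] by (auto simp: intermediate_cone_def)
  have mem: "d \<in> N'" if "d \<in> N" "nonneg d" for d
    using that N assms(3) Const_in_polys_over_iff[OF subring_zero[OF N(3)], of d] by blast
  have "nonneg c \<or> nonneg (- c)" using trichotomy[of c] c N(2) by (auto simp: nonneg_iff)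
  thus "c \<in> N'" using mem[OF c] mem[OF subring_uminus[OF N(1) c]] subring_uminus[OF N(3), of "- c"] by auto
qed

lemma maximal_intermediate_cone:
  fixes E :: "'k::field set" and \<beta> :: "('n::finite, 'k) mpoly set"
  assumes E: "ordered_subfield E" and "intermediate_cone E M \<beta> N0 \<gamma>0"
  obtains N \<gamma> where "intermediate_cone E M \<beta> N \<gamma>"
    "\<forall>N' \<gamma>'. intermediate_cone E M \<beta> N' \<gamma>' \<and> \<gamma> \<subseteq> \<gamma>' \<longrightarrow> N' = N"
proof -
  let ?A = "{\<gamma>. \<exists>N. intermediate_cone E M \<beta> N \<gamma>}"
  have "\<exists>\<gamma>\<in>?A. \<forall>\<gamma>'\<in>?A. \<gamma> \<subseteq> \<gamma>' \<longrightarrow> \<gamma>' = \<gamma>"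
  proof (rule subset_Zorn_nonempty)
    show "?A \<noteq> {}" using assms(2) by blast
    fix C assume C: "C \<noteq> {}" "subset.chain ?A C"
    hence "\<forall>\<gamma>\<in>C. \<exists>N. intermediate_cone E M \<beta> N \<gamma>" by (auto simp: subset_chain_def)
    then obtain n where n: "\<And>\<gamma>. \<gamma> \<in> C \<Longrightarrow> intermediate_cone E M \<beta> (n \<gamma>) \<gamma>" by metis
    hence n': "is_subring (n \<gamma>)" "M \<subseteq> n \<gamma>" "n \<gamma> \<subseteq> E" "prime_cone (polys_over (n \<gamma>)) \<gamma>"
      "\<forall>c\<in>n \<gamma>. Const c \<in> \<gamma> \<longleftrightarrow> nonneg_in E c" "\<gamma> \<inter> polys_over M = \<beta>" if "\<gamma> \<in> C" for \<gamma>
      using that by (auto simp: intermediate_cone_def)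
    have mono: "n \<gamma> \<subseteq> n \<gamma>'" if "\<gamma> \<in> C" "\<gamma>' \<in> C" "\<gamma> \<subseteq> \<gamma>'" for \<gamma> \<gamma>'
      using intermediate_cone_subset[OF n n _ E] that by blast
    define N where "N = \<Union>(n ` C)"
    have chain: "subset.chain UNIV (n ` C)"
      using C(2) mono unfolding subset_chain_def by (auto, metis subsetD)
    have N: "is_subring N" unfolding N_def
      using n'(1) C(1) by (intro is_subring_Union_chain[OF _ chain]) auto
    have cover: "\<exists>\<gamma>\<in>C. f \<in> polys_over (n \<gamma>)" if f: "f \<in> polys_over N" for f :: "('n, 'k) mpoly"
    proof -
      have "Poly_Mapping.lookup f ` Poly_Mapping.keys f \<subseteq> \<Union>(n ` C)"
        using lookup_polys_over[OF f] by (auto simp: N_def)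
      then obtain D where D: "D \<in> n ` C" "Poly_Mapping.lookup f ` Poly_Mapping.keys f \<subseteq> D"
        using finite_subset_Union_chain[OF _ _ _ chain] C(1) by (metis finite_imageI finite_keys image_is_empty)
      then obtain \<gamma> where \<gamma>: "\<gamma> \<in> C" "D = n \<gamma>" by blast
      have "Poly_Mapping.lookup f m \<in> n \<gamma>" for m
        using D(2) \<gamma> subring_zero[OF n'(1)[OF \<gamma>(1)]] by (cases "m \<in> Poly_Mapping.keys f") (auto simp: in_keys_iff)
      thus ?thesis using \<gamma>(1) by (auto simp: polys_over_def)
    qed
    have upper: "\<exists>\<gamma>''\<in>C. \<gamma> \<subseteq> \<gamma>'' \<and> \<gamma>' \<subseteq> \<gamma>''" if "\<gamma> \<in> C" "\<gamma>' \<in> C" for \<gamma> \<gamma>'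
      by (rule chain_upper_bound[OF C(2) that]) blast
    have pm: "polys_over (n \<gamma>) \<subseteq> polys_over (n \<gamma>')" if "\<gamma> \<in> C" "\<gamma>' \<in> C" "\<gamma> \<subseteq> \<gamma>'" for \<gamma> \<gamma>'
      using polys_over_mono[OF mono[OF that]] .
    have both: "\<exists>\<gamma>\<in>C. f \<in> \<gamma> \<and> g \<in> \<gamma>" if "f \<in> \<Union>C" "g \<in> \<Union>C" for f g
      using that upper by (meson UnionE subsetD)
    note pc = prime_cone_add[OF is_subring_polys_over[OF n'(1)] n'(4)] prime_cone_mult[OF is_subring_polys_over[OF n'(1)] n'(4)]
      prime_cone_square[OF is_subring_polys_over[OF n'(1)] n'(4)] prime_cone_minus_one[OF is_subring_polys_over[OF n'(1)] n'(4)]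
      prime_cone_prime[OF is_subring_polys_over[OF n'(1)] n'(4)] prime_cone_subset[OF is_subring_polys_over[OF n'(1)] n'(4)]
    have "prime_cone (polys_over N) (\<Union>C)"
      unfolding prime_cone_def
    proof (intro conjI ballI impI)
      show "\<Union>C \<subseteq> polys_over N"
      proof
        fix f assume "f \<in> \<Union>C"
        then obtain \<gamma> where "\<gamma> \<in> C" "f \<in> \<gamma>" by blast
        thus "f \<in> polys_over N" using pc(6)[of \<gamma>] polys_over_mono[of "n \<gamma>" N] by (auto simp: N_def)
      qed
      show "- 1 \<notin> \<Union>C" using pc(4) by blast
    next
      fix f g assume "f \<in> \<Union>C" "g \<in> \<Union>C"
      then obtain \<gamma> where "\<gamma> \<in> C" "f \<in> \<gamma>" "g \<in> \<gamma>" using both by blast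
      thus "f + g \<in> \<Union>C" "f * g \<in> \<Union>C" using pc(1,2) by blast+
    next
      fix f :: "('n, 'k) mpoly" assume f: "f \<in> polys_over N"
      thus "f * f \<in> \<Union>C" using cover pc(3) by blast
      fix g :: "('n, 'k) mpoly" assume g: "g \<in> polys_over N" and fg: "f * g \<in> \<Union>C"
      obtain \<gamma>1 \<gamma>2 \<gamma>3 where \<gamma>: "\<gamma>1 \<in> C" "f \<in> polys_over (n \<gamma>1)" "\<gamma>2 \<in> C" "g \<in> polys_over (n \<gamma>2)" "\<gamma>3 \<in> C" "f * g \<in> \<gamma>3"
        using cover[OF f] cover[OF g] fg by blast
      obtain \<gamma>4 where \<gamma>4: "\<gamma>4 \<in> C" "\<gamma>1 \<subseteq> \<gamma>4" "\<gamma>2 \<subseteq> \<gamma>4" using upper[OF \<gamma>(1,3)] by blast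
      obtain \<gamma>5 where \<gamma>5: "\<gamma>5 \<in> C" "\<gamma>4 \<subseteq> \<gamma>5" "\<gamma>3 \<subseteq> \<gamma>5" using upper[OF \<gamma>4(1) \<gamma>(5)] by blast
      have "f \<in> polys_over (n \<gamma>5)" "g \<in> polys_over (n \<gamma>5)" "f * g \<in> \<gamma>5"
        using \<gamma> \<gamma>4 \<gamma>5 pm[OF \<gamma>(1) \<gamma>5(1)] pm[OF \<gamma>(3) \<gamma>5(1)] by auto
      thus "f \<in> \<Union>C \<or> - g \<in> \<Union>C" using pc(5)[OF \<gamma>5(1)] \<gamma>5(1) by blast
    qed
    moreover have "Const c \<in> \<Union>C \<longleftrightarrow> nonneg_in E c" if "c \<in> N" for c
    proof
      assume "nonneg_in E c"
      thus "Const c \<in> \<Union>C" using that n'(5) by (auto simp: N_def)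
    next
      assume "Const c \<in> \<Union>C"
      then obtain \<gamma> where \<gamma>: "\<gamma> \<in> C" "Const c \<in> \<gamma>" by blast
      hence "c \<in> n \<gamma>" using pc(6) Const_in_polys_over_iff[OF subring_zero[OF n'(1)]] by blast
      thus "nonneg_in E c" using n'(5) \<gamma> by blast
    qed
    moreover have "\<Union>C \<inter> polys_over M = \<beta>" using n'(6) C(1) by blast
    moreover have "M \<subseteq> N" "N \<subseteq> E" using n'(2,3) C(1) unfolding N_def by blast+
    ultimately have "intermediate_cone E M \<beta> N (\<Union>C)" using N by (simp add: intermediate_cone_def)
    thus "\<Union>C \<in> ?A" by blast
  qed
  then obtain \<gamma> where \<gamma>: "\<gamma> \<in> ?A" "\<forall>\<gamma>'\<in>?A. \<gamma> \<subseteq> \<gamma>' \<longrightarrow> \<gamma>' = \<gamma>" by (elim bexE)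
  then obtain N where N: "intermediate_cone E M \<beta> N \<gamma>" by blast
  show ?thesis
  proof (rule that[OF N]; intro allI impI; elim conjE)
    fix N' \<gamma>' assume N': "intermediate_cone E M \<beta> N' \<gamma>'" "\<gamma> \<subseteq> \<gamma>'"
    hence "\<gamma>' = \<gamma>" using \<gamma>(2) by blast
    thus "N' = N" using intermediate_cone_subset[OF N N'(1) _ E] intermediate_cone_subset[OF N'(1) N _ E] by blast
  qed
qed

text \<open>The coefficient ring \<open>N\<close> of a maximal intermediate cone contains every \<open>r \<in> E\<close> that finitely many
  polynomials at a time cannot tell from a point of the real closure of the cone.  This applies
  in turn to inverses, to algebraic elements by induction on the degree, and to all the rest.\<close>

theorem extend_prime_cone:
  fixes E :: "'k::field set" and \<beta> :: "('n::finite, 'k) mpoly set"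
  assumes E: "real_closed_subfield E" and M: "is_subring M" "M \<subseteq> E" and \<beta>: "prime_cone (polys_over M) \<beta>"
    and const: "\<And>c. c \<in> M \<Longrightarrow> Const c \<in> \<beta> \<longleftrightarrow> nonneg_in E c"
  obtains \<gamma> where "prime_cone (polys_over E) \<gamma>" "\<gamma> \<inter> polys_over M = \<beta>"
proof -
  interpret R: real_closed_subfield E by (rule E)
  have ic: "intermediate_cone E M \<beta> M \<beta>"
    using M \<beta> const prime_cone_subset[OF is_subring_polys_over[OF M(1)] \<beta>] by (auto simp: intermediate_cone_def)
  obtain N \<gamma> where good: "intermediate_cone E M \<beta> N \<gamma>"
    and max: "\<forall>N' \<gamma>'. intermediate_cone E M \<beta> N' \<gamma>' \<and> \<gamma> \<subseteq> \<gamma>' \<longrightarrow> N' = N"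
    by (rule maximal_intermediate_cone[OF R.ordered_subfield_axioms ic])
  have NN: "is_subring N" "N \<subseteq> E" "prime_cone (polys_over N) \<gamma>" "\<And>c. c \<in> N \<Longrightarrow> Const c \<in> \<gamma> \<longleftrightarrow> nonneg_in E c"
    "\<gamma> \<inter> polys_over M = \<beta>" using good by (auto simp: intermediate_cone_def)
  obtain \<iota> :: "('n, 'k) mpoly \<Rightarrow> 'k mpoly_closure" where \<iota>: "hom_on UNIV \<iota>" "\<And>f. \<iota> f = 0 \<Longrightarrow> f = 0"
    using mpoly_embedding by blast
  obtain \<psi> :: "('n, 'k) mpoly \<Rightarrow> 'k mpoly_closure" and E1 where \<psi>: "hom_on (polys_over N) \<psi>" "real_closed_subfield E1"
    "\<psi> ` polys_over N \<subseteq> E1" "\<And>f. f \<in> polys_over N \<Longrightarrow> f \<in> \<gamma> \<longleftrightarrow> nonneg_in E1 (\<psi> f)"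
    using real_closure_of_prime_cone[OF is_subring_polys_over[OF NN(1)] NN(3) \<iota>] by metis
  interpret K: real_closed_subfield E1 by (rule \<psi>(2))
  have CN: "Const c \<in> (polys_over N :: ('n, 'k) mpoly set)" if "c \<in> N" for c
    by (rule Const_in_polys_over[OF that subring_zero[OF NN(1)]])
  interpret order_embedding E E1 N "\<psi> \<circ> Const"
  proof
    show "hom_on N (\<psi> \<circ> Const)"
      using CN by (intro hom_on_compose[OF hom_on_subset[OF hom_on_Const] \<psi>(1)]) auto
    show "(\<psi> \<circ> Const) c \<in> E1" if "c \<in> N" for c using CN[OF that] \<psi>(3) by auto
    show "nonneg_in E1 ((\<psi> \<circ> Const) c) \<longleftrightarrow> nonneg_in E c" if "c \<in> N" for c
      using \<psi>(4)[OF CN[OF that]] NN(4)[OF that] by simp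
  qed (use NN in auto)
  have closed: "r \<in> N" if r: "r \<in> E" and fip: "\<And>G. finite G \<Longrightarrow> G \<subseteq> poly_over N \<Longrightarrow> \<exists>s\<in>E1. \<forall>g\<in>G. matches r s g" for r
  proof -
    obtain \<gamma>' where \<gamma>': "intermediate_cone E M \<beta> ((\<lambda>g. poly g r) ` poly_over N) \<gamma>'" "\<gamma> \<subseteq> \<gamma>'"
      using extend_cone_by_element[OF good \<psi>(1,3,4) order_embedding_axioms r fip] by blast
    show ?thesis using max[rule_format, OF conjI[OF \<gamma>']] mem_simple_extension[OF NN(1), of r] by simp
  qed
  have "inverse c \<in> N" if c: "c \<in> N" for c
  proof (cases "c = 0")
    case False
    show ?thesis
    proof (rule closed)
      show "inverse c \<in> E" using c NN(2) R.closed(11) by blast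
      fix G assume "G \<subseteq> poly_over N"
      thus "\<exists>s\<in>E1. \<forall>g\<in>G. matches (inverse c) s g"
        using match_inverse[OF c False] \<nu>_mem[OF c] K.closed(11) by blast
    qed
  qed (use c in simp)
  hence field: "is_subfield N" using NN(1) by (simp add: is_subfield_def)
  have alg: "z \<in> N" if "g \<in> poly_over N" "g \<noteq> 0" "z \<in> E" "poly g z = 0" for g z
    using that
  proof (induction "degree g" arbitrary: g z rule: less_induct)
    case less
    show ?case
    proof (rule ccontr)
      assume z: "z \<notin> N"
      obtain f where f: "min_poly_over N z f" using min_poly_over_exists less.prems by blast
      have "degree f \<le> degree g" using f less.prems by (auto simp: min_poly_over_def)
      hence roots: "y \<in> N" if "h \<in> poly_over N" "h \<noteq> 0" "degree h < degree f" "y \<in> E" "poly h y = 0" for h y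
        using less.hyps[of h y] that by simp
      obtain s where s: "s \<in> E1" "\<And>g. g \<in> poly_over N \<Longrightarrow> matches z s g"
        using match_algebraic[OF field less.prems(3) z f] roots by blast
      have "z \<in> N" using closed[OF less.prems(3)] s by blast
      thus False using z by simp
    qed
  qed
  have "r \<in> N" if r: "r \<in> E" for r
  proof (rule ccontr)
    assume rN: "r \<notin> N"
    have "r \<in> N"
    proof (rule closed[OF r])
      fix G assume G: "finite G" "G \<subseteq> poly_over N"
      obtain s where "s \<in> E1" "\<And>g. g \<in> G \<Longrightarrow> matches r s g"
        by (rule match_transcendental[OF field r rN _ G]) (use alg in blast)+
      thus "\<exists>s\<in>E1. \<forall>g\<in>G. matches r s g" by blast
    qed
    thus False using rN by simp
  qed
  hence "N = E" using NN(2) by blast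
  thus ?thesis using that NN(3,5) by blast
qed

text \<open>With the non-negative elements as weights, weighted sums of squares are non-negative, so \<open>-1\<close> is
  not among them.\<close>

lemma real_closed_extension:
  obtains E :: "'a::linordered_field alg_closure set" where "real_closed_subfield E" "range to_ac \<subseteq> E"
    "\<forall>c. nonneg_in E (to_ac c) \<longleftrightarrow> 0 \<le> c"
proof -
  define T where "T = to_ac ` {c :: 'a. 0 \<le> c}"
  have T_mult: "t * t' \<in> T" if t: "t \<in> T" "t' \<in> T" for t t'
  proof -
    obtain c d where "0 \<le> c" "0 \<le> d" "t = to_ac c" "t' = to_ac d" using t by (auto simp: T_def)
    thus ?thesis unfolding T_def by (intro image_eqI[of _ _ "c * d"]) auto
  qed
  have T_one: "1 \<in> T" unfolding T_def by (rule image_eqI[of _ _ 1]) auto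
  have L: "is_subfield (UNIV :: 'a alg_closure set)" by (simp add: is_subfield_def is_subring_def)
  have F: "is_subfield (range (to_ac :: 'a \<Rightarrow> _))"
    unfolding is_subfield_def is_subring_def
    by (auto simp: image_iff simp flip: to_ac_diff to_ac_mult to_ac_inverse intro: exI[of _ 1])
  have ws: "s \<in> T" if "s \<in> weighted_squares T (range to_ac)" for s
    using that
  proof induction
    case zero
    show ?case unfolding T_def by (rule image_eqI[of _ _ 0]) auto
  next
    case (add s t x)
    then obtain a b c where "0 \<le> a" "s = to_ac a" "0 \<le> b" "t = to_ac b" "x = to_ac c" by (auto simp: T_def)
    thus ?case unfolding T_def by (intro image_eqI[of _ _ "a + b * (c * c)"]) auto
  qed
  have "- 1 \<notin> T"
  proof
    assume "- 1 \<in> T"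
    then obtain c :: 'a where "0 \<le> c" and c: "- 1 = to_ac c" by (auto simp: T_def)
    hence "to_ac (c + 1) = 0" using c[symmetric] by simp
    hence "c + 1 = 0" by (simp only: to_ac_eq_0_iff)
    thus False using \<open>0 \<le> c\<close> by simp
  qed
  hence "real_extension T UNIV (range to_ac)" using F ws by (auto simp: real_extension_def T_def)
  then obtain E where E: "real_extension T UNIV E" "range to_ac \<subseteq> E"
    and max: "\<And>E'. real_extension T UNIV E' \<Longrightarrow> E \<subseteq> E' \<Longrightarrow> E' = E"
    using maximal_real_extension by blast
  have root: "\<exists>x\<in>UNIV. poly p x = 0" if "degree p > 0" for p :: "'a alg_closure poly"
    using alg_closed_imp_poly_has_root[OF that] by blast
  have rc: "real_closed_subfield E"
    by (rule real_closed_subfield_if_maximal[OF T_mult T_one L _ E(1) max]) (use root in blast)+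
  interpret real_closed_subfield E by (rule rc)
  have nn: "nonneg (to_ac c)" if "0 \<le> c" for c
    by (rule nonneg_if_weight[OF T_mult T_one L _ E(1) max]) (use root that in \<open>auto simp: T_def\<close>)
  have "0 \<le> c" if "nonneg (to_ac c)" for c
  proof (rule ccontr)
    assume c: "\<not> 0 \<le> c"
    hence "nonneg (- to_ac c)" using nn[of "- c"] by simp
    hence "to_ac c = 0" using that nonneg_antisym by blast
    thus False using c by simp
  qed
  thus ?thesis using that[OF rc E(2)] nn by blast
qed

text \<open>The amalgamation takes place over a real closed extension \<open>E\<close> of the given field, where the
  intermediate value theorem is available; the cone obtained on \<open>E[X]\<close> is pulled back along the
  inclusion \<open>\<tau>\<close> of polynomial rings.\<close>

theorem prime_cone_lift:
  fixes M :: "'a::linordered_field set" and \<beta> :: "('n::finite, 'a) mpoly set"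
  assumes M: "is_subring M" and \<beta>: "prime_cone (polys_over M) \<beta>" and const: "\<And>c. c \<in> M \<Longrightarrow> Const c \<in> \<beta> \<longleftrightarrow> 0 \<le> c"
  obtains \<alpha> where "\<alpha> \<in> Spec_r UNIV" "restrict_cone M \<alpha> = \<beta>"
proof -
  obtain E :: "'a alg_closure set" where E: "real_closed_subfield E" "range to_ac \<subseteq> E"
    "\<forall>c. nonneg_in E (to_ac c) \<longleftrightarrow> 0 \<le> c" by (rule real_closed_extension)
  have ac: "hom_on UNIV (to_ac :: 'a \<Rightarrow> _)" by (simp add: hom_on_def)
  define \<tau> where "\<tau> = (insertion (Const \<circ> to_ac) Var :: ('n, 'a) mpoly \<Rightarrow> ('n, 'a alg_closure) mpoly)"
  have \<tau>: "hom_on UNIV \<tau>"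
    using hom_on_insertion[OF is_subring_UNIV hom_on_compose[OF ac hom_on_Const]] by (simp add: \<tau>_def)
  have lookup: "Poly_Mapping.lookup (\<tau> f) m = to_ac (Poly_Mapping.lookup f m)" for f m
    unfolding \<tau>_def by (rule lookup_insertion_Const[OF ac])
  have inj: "\<tau> f = \<tau> g \<longleftrightarrow> f = g" for f g
    by (metis lookup poly_mapping_eqI to_ac_eq_iff)
  have Const: "\<tau> (Const c) = Const (to_ac c)" for c
    unfolding \<tau>_def by (subst insertion_Const[OF is_subring_UNIV hom_on_compose[OF ac hom_on_Const]]) simp_all
  define M' where "M' = to_ac ` M"
  have M': "is_subring M'" unfolding M'_def by (rule is_subring_hom_image[OF M hom_on_subset[OF ac]]) simp
  have over_iff: "\<tau> f \<in> polys_over M' \<longleftrightarrow> f \<in> polys_over M" for f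
    by (auto simp: polys_over_def lookup M'_def)
  have img: "polys_over M' = \<tau> ` polys_over M"
  proof
    show "polys_over M' \<subseteq> \<tau> ` polys_over M"
    proof
      fix g :: "('n, 'a alg_closure) mpoly" assume g: "g \<in> polys_over M'"
      have "to_ac (of_ac (Poly_Mapping.lookup g m)) = Poly_Mapping.lookup g m" for m
        using lookup_polys_over[OF g, of m] by (intro to_ac_of_ac) (auto simp: M'_def)
      hence "\<tau> (lift_coeffs of_ac g) = g"
        by (intro poly_mapping_eqI) (simp add: lookup lookup_lift_coeffs in_keys_iff)
      thus "g \<in> \<tau> ` polys_over M" using over_iff[of "lift_coeffs of_ac g"] g by (metis image_eqI)
    qed
  qed (use over_iff in auto)
  note A = is_subring_polys_over[OF M, where 'n = 'n]
  note pc = prime_cone_add[OF A \<beta>] prime_cone_mult[OF A \<beta>] prime_cone_square[OF A \<beta>] prime_cone_minus_one[OF A \<beta>]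
    prime_cone_prime[OF A \<beta>] prime_cone_subset[OF A \<beta>]
  note hom = hom_on_add[OF is_subring_UNIV \<tau>] hom_on_mult[OF is_subring_UNIV \<tau>] hom_on_uminus[OF is_subring_UNIV \<tau>]
    hom_on_one[OF is_subring_UNIV \<tau>]
  have in_iff: "\<tau> f \<in> \<tau> ` \<beta> \<longleftrightarrow> f \<in> \<beta>" for f using inj by auto
  have "prime_cone (polys_over M') (\<tau> ` \<beta>)"
    unfolding prime_cone_def
  proof (intro conjI ballI impI)
    show "\<tau> ` \<beta> \<subseteq> polys_over M'" using pc(6) img by blast
    have "- 1 = \<tau> (- 1)" using hom(3)[of 1] hom(4) by simp
    thus "- 1 \<notin> \<tau> ` \<beta>" using in_iff pc(4) by metis
  next
    fix f g assume "f \<in> \<tau> ` \<beta>" "g \<in> \<tau> ` \<beta>"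
    thus "f + g \<in> \<tau> ` \<beta>" "f * g \<in> \<tau> ` \<beta>" using pc(1,2) by (auto simp: hom[symmetric] in_iff)
  next
    fix f :: "('n, 'a alg_closure) mpoly" assume "f \<in> polys_over M'"
    then obtain f' where f: "f' \<in> polys_over M" "f = \<tau> f'" using img by blast
    show "f * f \<in> \<tau> ` \<beta>" using pc(3)[OF f(1)] by (auto simp: f hom[symmetric] in_iff)
    fix g :: "('n, 'a alg_closure) mpoly" assume "g \<in> polys_over M'" and fg: "f * g \<in> \<tau> ` \<beta>"
    then obtain g' where g: "g' \<in> polys_over M" "g = \<tau> g'" using img by blast
    show "f \<in> \<tau> ` \<beta> \<or> - g \<in> \<tau> ` \<beta>"
      using pc(5)[OF f(1) g(1)] fg by (auto simp: f g hom[symmetric] in_iff)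
  qed
  moreover have "Const c \<in> \<tau> ` \<beta> \<longleftrightarrow> nonneg_in E c" if c: "c \<in> M'" for c
  proof -
    obtain d where "d \<in> M" "c = to_ac d" using c by (auto simp: M'_def)
    thus ?thesis using const[of d] E(3) in_iff[of "Const d"] by (simp add: Const)
  qed
  moreover have "M' \<subseteq> E" using E(2) by (auto simp: M'_def)
  ultimately obtain \<gamma> where \<gamma>: "prime_cone (polys_over E) \<gamma>" "\<gamma> \<inter> polys_over M' = \<tau> ` \<beta>"
    using extend_prime_cone[OF E(1) M'] by metis
  interpret E: real_closed_subfield E by (rule E(1))
  note A' = is_subring_polys_over[OF E.subring, where 'n = 'n]
  have \<tau>E: "\<tau> f \<in> polys_over E" for f using E(2) by (auto simp: polys_over_def lookup)
  define \<alpha> where "\<alpha> = {f. \<tau> f \<in> \<gamma>}"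
  have "prime_cone UNIV \<alpha>"
    unfolding prime_cone_def \<alpha>_def
  proof (intro conjI ballI impI)
    show "- 1 \<notin> {f. \<tau> f \<in> \<gamma>}" using prime_cone_minus_one[OF A' \<gamma>(1)] hom(3)[of 1] hom(4) by simp
    fix f g assume "f * g \<in> {f. \<tau> f \<in> \<gamma>}"
    thus "f \<in> {f. \<tau> f \<in> \<gamma>} \<or> - g \<in> {f. \<tau> f \<in> \<gamma>}"
      using prime_cone_prime[OF A' \<gamma>(1) \<tau>E \<tau>E, of f g] by (simp add: hom)
  qed (use prime_cone_add[OF A' \<gamma>(1)] prime_cone_mult[OF A' \<gamma>(1)] prime_cone_square[OF A' \<gamma>(1) \<tau>E] in \<open>auto simp: hom\<close>)
  hence "\<alpha> \<in> Spec_r UNIV" by (simp add: Spec_r_def)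
  moreover have "restrict_cone M \<alpha> = \<beta>"
  proof -
    have "f \<in> restrict_cone M \<alpha> \<longleftrightarrow> f \<in> \<beta>" for f
      using \<gamma>(2) over_iff[of f] in_iff[of f] by (auto simp: restrict_cone_def \<alpha>_def)
    thus ?thesis by blast
  qed
  ultimately show ?thesis by (rule that)
qed

theorem proposition3p19:
  fixes M :: "'a::real_closed_field set"
  assumes "discretely_ordered_subring M"
  shows "(\<forall>\<alpha> :: ('n::finite, 'a) mpoly set.
            transcendental_arithmetical_point M \<alpha> \<longrightarrow>
              supp (restrict_cone M \<alpha>) = {0} \<and>
              is_discrete_positive_cone M (restrict_cone M \<alpha>)) \<and>
         (\<forall>\<beta> :: ('n, 'a) mpoly set.
            is_discrete_positive_cone M \<beta> \<longrightarrow>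
              (\<exists>\<alpha>. transcendental_arithmetical_point M \<alpha> \<and> restrict_cone M \<alpha> = \<beta>))"
proof (intro conjI allI impI)
  have M: "is_subring M" by (rule discretely_ordered_subring_is_subring[OF assms])
  fix \<alpha> :: "('n, 'a) mpoly set"
  assume \<alpha>: "transcendental_arithmetical_point M \<alpha>"
  show "supp (restrict_cone M \<alpha>) = {0}" "is_discrete_positive_cone M (restrict_cone M \<alpha>)"
    by (rule transcendental_point_restriction[OF M \<alpha>])+
next
  have M: "is_subring M" by (rule discretely_ordered_subring_is_subring[OF assms])
  fix \<beta> :: "('n, 'a) mpoly set"
  assume \<beta>: "is_discrete_positive_cone M \<beta>"
  obtain \<alpha> where \<alpha>: "\<alpha> \<in> Spec_r UNIV" "restrict_cone M \<alpha> = \<beta>"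
    using prime_cone_lift[OF M discrete_positive_cone(1,3)[OF M \<beta>]] by blast
  hence "transcendental_arithmetical_point M \<alpha>"
    using transcendental_point_if_restriction[OF M \<alpha>(1)] \<beta> by simp
  thus "\<exists>\<alpha>. transcendental_arithmetical_point M \<alpha> \<and> restrict_cone M \<alpha> = \<beta>" using \<alpha>(2) by blast
qed

end
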